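(* Let $(Q,I)$ be a quadratic monomial presentation with $Q$ a finite quiver and let $A=\Bbbk Q/I$. The Connes spectral sequence $$E^1_{p,q}\cong\mathrm{HH}_{q-p}(A)\underset{p}{\Longrightarrow}\mathrm{HC}_{*}(A)$$ degenerates on its second page (i.e. all differentials $d^r$ with $r\ge2$ vanish), and therefore there are isomorphisms, for all $m\ge0$, $$\mathrm{HC}_m(A)\cong\mathrm{coker}\bigl(B_{m-1}:\mathrm{HH}_{m-1}(A)\to\mathrm{HH}_m(A)\bigr)\oplus\bigoplus_{i\ge1}\mathrm H_{\mathrm{dR}}^{m-2i}(A).$$
   Context: $\Bbbk$ is a field (of arbitrary characteristic). A quadratic monomial presentation $(Q,I)$ is a quiver $Q$ together with an ideal $I$ of the path algebra $\Bbbk Q$ generated by paths of length $2$. $\mathrm{HH}_*(A)$ and $\mathrm{HC}_*(A)$ denote Hochschild and cyclic homology over $\Bbbk$. $B_n:\mathrm{HH}_n(A)\to\mathrm{HH}_{n+1}(A)$ is the map induced by Connes' boundary operator $B$; it satisfies $B\circ B=0$. $\mathrm H^p_{\mathrm{dR}}(A)$ is the cohomology at $\mathrm{HH}_p(A)$ of the cochain complex $\mathrm{HH}_0(A)\xrightarrow{B_0}\mathrm{HH}_1(A)\xrightarrow{B_1}\mathrm{HH}_2(A)\to\cdots$; by convention $\mathrm{HH}_n(A)=0$ and $\mathrm H^n_{\mathrm{dR}}(A)=0$ for $n<0$. The Connes spectral sequence is the one arising from the filtration by columns of Connes' first-quadrant $(b,B)$-double complex $\mathcal{BC}_{p,q}=C_{q-p}(A,A)$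 for $0\le p\le q$ (and $0$ otherwise), where $C_*(A,A)$ is the Hochschild complex of $A$ (relative to the subalgebra $E=\Bbbk Q_0$, which gives the same homology), with vertical differential the Hochschild differential $b$ and horizontal differential $\mathcal{BC}_{p,q}\to\mathcal{BC}_{p-1,q}$ given by $B$. The homology of its total complex is $\mathrm{HC}_*(A)$. Its first page has $E^1_{p,q}=\mathrm{HH}_{q-p}(A)$ for $0\le p\le q$ and $0$ otherwise, with $d^1$ induced by $B$. *)

theory Defs
  imports
    "HOL-Library.Poly_Mapping"
    "HOL-Algebra.QuotRing"
    "HOL-Algebra.Module"
    "Graph_Theory.Arc_Walk"
begin

text \<open>
  The ground field is a type \<open>'k\<close> of class \<open>field\<close>.  Vector spaces and algebras over it are
  records of type \<open>('k, 'a) module\<close>.  For plain vector spaces the ring fields \<open>mult\<close> and \<open>one\<close> of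
  the record carry no information.
\<close>

section \<open>Linear algebra\<close>

definition fscale :: "'k::field \<Rightarrow> ('x \<Rightarrow>\<^sub>0 'k) \<Rightarrow> ('x \<Rightarrow>\<^sub>0 'k)" where
  "fscale c f = Poly_Mapping.map ((*) c) f"

lemma lookup_fscale [simp]: "Poly_Mapping.lookup (fscale c f) x = c * Poly_Mapping.lookup f x"
  by (simp add: fscale_def Poly_Mapping.map.rep_eq when_def)

global_interpretation free_vs: vector_space "fscale :: 'k::field \<Rightarrow> ('x \<Rightarrow>\<^sub>0 'k) \<Rightarrow> ('x \<Rightarrow>\<^sub>0 'k)"
  by unfold_locales (auto intro!: poly_mapping_eqI simp: lookup_add algebra_simps)

definition lin_ext :: "('x \<Rightarrow> 'y \<Rightarrow>\<^sub>0 'k::field) \<Rightarrow> ('x \<Rightarrow>\<^sub>0 'k) \<Rightarrow> ('y \<Rightarrow>\<^sub>0 'k)" where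
  "lin_ext g f = (\<Sum>x\<in>Poly_Mapping.keys f. fscale (Poly_Mapping.lookup f x) (g x))"

definition free_space :: "'x set \<Rightarrow> ('k::field, 'x \<Rightarrow>\<^sub>0 'k) module" where
  "free_space X = \<lparr>carrier = {f. Poly_Mapping.keys f \<subseteq> X}, mult = undefined, one = undefined,
     zero = 0, add = (+), smult = fscale\<rparr>"

text \<open>
  The quotient of a vector space by a subspace, and also the quotient of an algebra by a two-sided
  ideal.  Scalar multiplication and induced maps are written as unions over representatives in the
  style of \<^const>\<open>rcoset_mult\<close>; for well-defined maps this is a single coset.
\<close>

definition quot_space :: "('k, 'a) module \<Rightarrow> 'a set \<Rightarrow> ('k, 'a set) module" where
  "quot_space M N = ring.extend (M Quot N)
     (module.fields (\<lambda>c X. \<Union>x\<in>X. N +>\<^bsub>M\<^esub> (c \<odot>\<^bsub>M\<^esub> x)))"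

definition induced_map :: "('k, 'b) module \<Rightarrow> 'b set \<Rightarrow> ('a \<Rightarrow> 'b) \<Rightarrow> 'a set \<Rightarrow> 'b set" where
  "induced_map M N f X = (\<Union>x\<in>X. N +>\<^bsub>M\<^esub> f x)"

definition direct_sum :: "'i set \<Rightarrow> ('i \<Rightarrow> ('k, 'a) module) \<Rightarrow> ('k, 'i \<Rightarrow> 'a) module" where
  "direct_sum I M =
     \<lparr>carrier = {f \<in> \<Pi>\<^sub>E i\<in>I. carrier (M i). finite {i \<in> I. f i \<noteq> \<zero>\<^bsub>M i\<^esub>}},
      mult = undefined, one = undefined,
      zero = (\<lambda>i\<in>I. \<zero>\<^bsub>M i\<^esub>),
      add = (\<lambda>f g. \<lambda>i\<in>I. f i \<oplus>\<^bsub>M i\<^esub> g i),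
      smult = (\<lambda>c f. \<lambda>i\<in>I. c \<odot>\<^bsub>M i\<^esub> f i)\<rparr>"

definition direct_sum2 :: "('k, 'a) module \<Rightarrow> ('k, 'b) module \<Rightarrow> ('k, 'a \<times> 'b) module" where
  "direct_sum2 M N =
     \<lparr>carrier = carrier M \<times> carrier N, mult = undefined, one = undefined,
      zero = (\<zero>\<^bsub>M\<^esub>, \<zero>\<^bsub>N\<^esub>),
      add = (\<lambda>(x, y) (x', y'). (x \<oplus>\<^bsub>M\<^esub> x', y \<oplus>\<^bsub>N\<^esub> y')),
      smult = (\<lambda>c (x, y). (c \<odot>\<^bsub>M\<^esub> x, c \<odot>\<^bsub>N\<^esub> y))\<rparr>"

definition linear_iso :: "('k, 'a) module \<Rightarrow> ('k, 'b) module \<Rightarrow> ('a \<Rightarrow> 'b) \<Rightarrow> bool" where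
  "linear_iso M N f \<longleftrightarrow> bij_betw f (carrier M) (carrier N) \<and>
     (\<forall>x\<in>carrier M. \<forall>y\<in>carrier M. f (x \<oplus>\<^bsub>M\<^esub> y) = f x \<oplus>\<^bsub>N\<^esub> f y) \<and>
     (\<forall>c. \<forall>x\<in>carrier M. f (c \<odot>\<^bsub>M\<^esub> x) = c \<odot>\<^bsub>N\<^esub> f x)"

definition isomorphic_spaces :: "('k, 'a) module \<Rightarrow> ('k, 'b) module \<Rightarrow> bool" (infix \<open>\<cong>\<^sub>v\<close> 50) where
  "M \<cong>\<^sub>v N \<longleftrightarrow> (\<exists>f. linear_iso M N f)"

definition cokernel :: "('k, 'a) module \<Rightarrow> ('k, 'b) module \<Rightarrow> ('a \<Rightarrow> 'b) \<Rightarrow> ('k, 'b set) module" where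
  "cokernel M N f = quot_space N (f ` carrier M)"

definition homology_at ::
    "('k, 'a) module \<Rightarrow> ('k, 'b) module \<Rightarrow> ('k, 'c) module \<Rightarrow> ('a \<Rightarrow> 'b) \<Rightarrow> ('b \<Rightarrow> 'c) \<Rightarrow>
     ('k, 'b set) module" where
  "homology_at L M N f g = quot_space (M\<lparr>carrier := a_kernel M N g\<rparr>) (f ` carrier L)"


section \<open>The spectral sequence of a filtered complex\<close>

text \<open>
  \<open>T\<close> is a chain complex with differentials \<open>d n : T n \<rightarrow> T (n - 1)\<close>, and \<open>F p n\<close> is the \<open>p\<close>-th
  step of an increasing filtration of \<open>T n\<close>.  With
  \<open>Z\<^sup>r\<^sub>p = {x \<in> F\<^sub>p. d x \<in> F\<^bsub>p-r\<^esub>}\<close>, the page \<open>E\<^sup>r\<^sub>p\<close> for \<open>r \<ge> 1\<close> is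
  \<open>Z\<^sup>r\<^sub>p / (Z\<^bsup>r-1\<^esup>\<^bsub>p-1\<^esub> + d Z\<^bsup>r-1\<^esup>\<^bsub>p+r-1\<^esub>)\<close>.
\<close>

context
  fixes T :: "int \<Rightarrow> ('k, 'a) module"
    and d :: "int \<Rightarrow> 'a \<Rightarrow> 'a"
    and F :: "int \<Rightarrow> int \<Rightarrow> 'a set"
begin

definition ss_Z :: "int \<Rightarrow> int \<Rightarrow> int \<Rightarrow> 'a set" where
  "ss_Z r p n = {x \<in> F p n. d n x \<in> F (p - r) (n - 1)}"

definition ss_B :: "int \<Rightarrow> int \<Rightarrow> int \<Rightarrow> 'a set" where
  "ss_B r p n = ss_Z (r - 1) (p - 1) n <+>\<^bsub>T n\<^esub> d (n + 1) ` ss_Z (r - 1) (p + r - 1) (n + 1)"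

definition ss_page :: "int \<Rightarrow> int \<Rightarrow> int \<Rightarrow> ('k, 'a set) module" where
  "ss_page r p q = quot_space ((T (p + q))\<lparr>carrier := ss_Z r p (p + q)\<rparr>) (ss_B r p (p + q))"

text \<open>This is \<open>d\<^sup>r\<close> from \<open>(p, q)\<close> to \<open>(p - r, q + r - 1)\<close>, induced by \<open>d\<close>.\<close>

definition ss_diff :: "int \<Rightarrow> int \<Rightarrow> int \<Rightarrow> 'a set \<Rightarrow> 'a set" where
  "ss_diff r p q = induced_map (T (p + q - 1)) (ss_B r (p - r) (p + q - 1)) (d (p + q))"

end


section \<open>Hochschild complex of an algebra relative to a subalgebra\<close>

text \<open>
  The \<open>n\<close>-chains \<open>A \<otimes>\<^bsub>E\<^sup>e\<^esub> A \<otimes>\<^sub>E \<dots> \<otimes>\<^sub>E A\<close> (\<open>n + 1\<close> factors) are the quotient of the free vector space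
  on \<open>(n + 1)\<close>-tuples by multilinearity and by \<open>E\<close>-balancing at each of the \<open>n + 1\<close> cyclically
  adjacent pairs of factors.  Degrees are integers; there are no tuples, hence no nonzero chains,
  in negative degrees.
\<close>

definition tuples :: "('k, 'a) module \<Rightarrow> int \<Rightarrow> 'a list set" where
  "tuples A n = {xs. xs \<noteq> [] \<and> int (length xs) = n + 1 \<and> set xs \<subseteq> carrier A}"

definition tensor_relations ::
    "('k::field, 'a) module \<Rightarrow> 'a set \<Rightarrow> int \<Rightarrow> ('a list \<Rightarrow>\<^sub>0 'k) set" where
  "tensor_relations A E n =
     {Poly_Mapping.single (xs[i := x \<oplus>\<^bsub>A\<^esub> y]) 1
        - Poly_Mapping.single (xs[i := x]) 1 - Poly_Mapping.single (xs[i := y]) 1 | xs i x y.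
        xs \<in> tuples A n \<and> i < length xs \<and> x \<in> carrier A \<and> y \<in> carrier A}
   \<union> {Poly_Mapping.single (xs[i := c \<odot>\<^bsub>A\<^esub> x]) 1
        - fscale c (Poly_Mapping.single (xs[i := x]) 1) | xs i c x.
        xs \<in> tuples A n \<and> i < length xs \<and> x \<in> carrier A}
   \<union> {Poly_Mapping.single (xs[i := (xs ! i) \<otimes>\<^bsub>A\<^esub> e]) 1
        - Poly_Mapping.single (xs[j := e \<otimes>\<^bsub>A\<^esub> (xs ! j)]) 1 | xs i j e.
        xs \<in> tuples A n \<and> i < length xs \<and> j = (i + 1) mod length xs \<and> e \<in> E}"

definition tensor_kernel ::
    "('k::field, 'a) module \<Rightarrow> 'a set \<Rightarrow> int \<Rightarrow> ('a list \<Rightarrow>\<^sub>0 'k) set" where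
  "tensor_kernel A E n = free_vs.span (tensor_relations A E n)"

definition hochschild_chains ::
    "('k::field, 'a) module \<Rightarrow> 'a set \<Rightarrow> int \<Rightarrow> ('k, ('a list \<Rightarrow>\<^sub>0 'k) set) module" where
  "hochschild_chains A E n = quot_space (free_space (tuples A n)) (tensor_kernel A E n)"

definition free_b :: "('k::field, 'a) module \<Rightarrow> ('a list \<Rightarrow>\<^sub>0 'k) \<Rightarrow> ('a list \<Rightarrow>\<^sub>0 'k)" where
  "free_b A = lin_ext (\<lambda>xs.
     (\<Sum>i<length xs - 1.
        Poly_Mapping.single
          (take i xs @ [(xs ! i) \<otimes>\<^bsub>A\<^esub> (xs ! (i + 1))] @ drop (i + 2) xs) ((- 1) ^ i))
     + (if length xs \<ge> 2
        then Poly_Mapping.single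
          ((last xs \<otimes>\<^bsub>A\<^esub> hd xs) # tl (butlast xs)) ((- 1) ^ (length xs - 1))
        else 0))"

text \<open>
  Connes' operator on the unnormalised complex is \<open>B = (1 - t) s N\<close>, with \<open>t\<close> the signed cyclic
  permutation, \<open>N = 1 + t + \<dots> + t\<^sup>n\<close> and \<open>s\<close> the extra degeneracy.
\<close>

definition free_t :: "('a list \<Rightarrow>\<^sub>0 'k::field) \<Rightarrow> ('a list \<Rightarrow>\<^sub>0 'k)" where
  "free_t = lin_ext (\<lambda>xs.
     Poly_Mapping.single (last xs # butlast xs) ((- 1) ^ (length xs - 1)))"

definition free_N :: "('a list \<Rightarrow>\<^sub>0 'k::field) \<Rightarrow> ('a list \<Rightarrow>\<^sub>0 'k)" where
  "free_N = lin_ext (\<lambda>xs. \<Sum>i<length xs. (free_t ^^ i) (Poly_Mapping.single xs 1))"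

definition free_s :: "('k::field, 'a) module \<Rightarrow> ('a list \<Rightarrow>\<^sub>0 'k) \<Rightarrow> ('a list \<Rightarrow>\<^sub>0 'k)" where
  "free_s A = lin_ext (\<lambda>xs. Poly_Mapping.single (\<one>\<^bsub>A\<^esub> # xs) 1)"

definition free_B :: "('k::field, 'a) module \<Rightarrow> ('a list \<Rightarrow>\<^sub>0 'k) \<Rightarrow> ('a list \<Rightarrow>\<^sub>0 'k)" where
  "free_B A f = (let g = free_s A (free_N f) in g - free_t g)"

definition hochschild_b ::
    "('k::field, 'a) module \<Rightarrow> 'a set \<Rightarrow> int \<Rightarrow> ('a list \<Rightarrow>\<^sub>0 'k) set \<Rightarrow> ('a list \<Rightarrow>\<^sub>0 'k) set" where
  "hochschild_b A E n =
     induced_map (free_space (tuples A (n - 1))) (tensor_kernel A E (n - 1)) (free_b A)"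

definition chain_B ::
    "('k::field, 'a) module \<Rightarrow> 'a set \<Rightarrow> int \<Rightarrow> ('a list \<Rightarrow>\<^sub>0 'k) set \<Rightarrow> ('a list \<Rightarrow>\<^sub>0 'k) set" where
  "chain_B A E n =
     induced_map (free_space (tuples A (n + 1))) (tensor_kernel A E (n + 1)) (free_B A)"


section \<open>Hochschild, de Rham and cyclic homology\<close>

definition HH ::
    "('k::field, 'a) module \<Rightarrow> 'a set \<Rightarrow> int \<Rightarrow> ('k, ('a list \<Rightarrow>\<^sub>0 'k) set set) module" where
  "HH A E n = homology_at
     (hochschild_chains A E (n + 1)) (hochschild_chains A E n) (hochschild_chains A E (n - 1))
     (hochschild_b A E (n + 1)) (hochschild_b A E n)"

definition HH_B ::
    "('k::field, 'a) module \<Rightarrow> 'a set \<Rightarrow> int \<Rightarrow>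
     ('a list \<Rightarrow>\<^sub>0 'k) set set \<Rightarrow> ('a list \<Rightarrow>\<^sub>0 'k) set set" where
  "HH_B A E n = induced_map (hochschild_chains A E (n + 1))
     (hochschild_b A E (n + 2) ` carrier (hochschild_chains A E (n + 2))) (chain_B A E n)"

definition HdR ::
    "('k::field, 'a) module \<Rightarrow> 'a set \<Rightarrow> int \<Rightarrow> ('k, ('a list \<Rightarrow>\<^sub>0 'k) set set set) module" where
  "HdR A E p = homology_at (HH A E (p - 1)) (HH A E p) (HH A E (p + 1))
     (HH_B A E (p - 1)) (HH_B A E p)"

definition bicomplex ::
    "('k::field, 'a) module \<Rightarrow> 'a set \<Rightarrow> int \<Rightarrow> int \<Rightarrow> ('k, ('a list \<Rightarrow>\<^sub>0 'k) set) module" where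
  "bicomplex A E p q =
     (if 0 \<le> p \<and> p \<le> q then hochschild_chains A E (q - p)
      else (hochschild_chains A E (q - p))\<lparr>carrier := {\<zero>\<^bsub>hochschild_chains A E (q - p)\<^esub>}\<rparr>)"

definition bicomplex_b ::
    "('k::field, 'a) module \<Rightarrow> 'a set \<Rightarrow> int \<Rightarrow> int \<Rightarrow>
     ('a list \<Rightarrow>\<^sub>0 'k) set \<Rightarrow> ('a list \<Rightarrow>\<^sub>0 'k) set" where
  "bicomplex_b A E p q x =
     (if 0 \<le> p \<and> p \<le> q - 1 then hochschild_b A E (q - p) x else \<zero>\<^bsub>bicomplex A E p (q - 1)\<^esub>)"

definition bicomplex_B ::
    "('k::field, 'a) module \<Rightarrow> 'a set \<Rightarrow> int \<Rightarrow> int \<Rightarrow>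
     ('a list \<Rightarrow>\<^sub>0 'k) set \<Rightarrow> ('a list \<Rightarrow>\<^sub>0 'k) set" where
  "bicomplex_B A E p q x =
     (if 0 \<le> p - 1 \<and> p \<le> q then chain_B A E (q - p) x else \<zero>\<^bsub>bicomplex A E (p - 1) q\<^esub>)"

text \<open>An element of degree \<open>n\<close> of the total complex is the family of its components at \<open>(p, n - p)\<close>.\<close>

definition total ::
    "('k::field, 'a) module \<Rightarrow> 'a set \<Rightarrow> int \<Rightarrow> ('k, int \<Rightarrow> ('a list \<Rightarrow>\<^sub>0 'k) set) module" where
  "total A E n = direct_sum UNIV (\<lambda>p. bicomplex A E p (n - p))"

definition total_d ::
    "('k::field, 'a) module \<Rightarrow> 'a set \<Rightarrow> int \<Rightarrow>
     (int \<Rightarrow> ('a list \<Rightarrow>\<^sub>0 'k) set) \<Rightarrow> (int \<Rightarrow> ('a list \<Rightarrow>\<^sub>0 'k) set)" where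
  "total_d A E n x = (\<lambda>p. bicomplex_b A E p (n - p) (x p)
     \<oplus>\<^bsub>bicomplex A E p (n - 1 - p)\<^esub> bicomplex_B A E (p + 1) (n - (p + 1)) (x (p + 1)))"

definition HC ::
    "('k::field, 'a) module \<Rightarrow> 'a set \<Rightarrow> int \<Rightarrow> ('k, (int \<Rightarrow> ('a list \<Rightarrow>\<^sub>0 'k) set) set) module" where
  "HC A E n = homology_at (total A E (n + 1)) (total A E n) (total A E (n - 1))
     (total_d A E (n + 1)) (total_d A E n)"

definition column_filtration ::
    "('k::field, 'a) module \<Rightarrow> 'a set \<Rightarrow> int \<Rightarrow> int \<Rightarrow> (int \<Rightarrow> ('a list \<Rightarrow>\<^sub>0 'k) set) set" where
  "column_filtration A E p n =
     {x \<in> carrier (total A E n). \<forall>p'>p. x p' = \<zero>\<^bsub>bicomplex A E p' (n - p')\<^esub>}"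

definition connes_page ::
    "('k::field, 'a) module \<Rightarrow> 'a set \<Rightarrow> int \<Rightarrow> int \<Rightarrow> int \<Rightarrow>
     ('k, (int \<Rightarrow> ('a list \<Rightarrow>\<^sub>0 'k) set) set) module" where
  "connes_page A E = ss_page (total A E) (total_d A E) (column_filtration A E)"

definition connes_diff ::
    "('k::field, 'a) module \<Rightarrow> 'a set \<Rightarrow> int \<Rightarrow> int \<Rightarrow> int \<Rightarrow>
     (int \<Rightarrow> ('a list \<Rightarrow>\<^sub>0 'k) set) set \<Rightarrow> (int \<Rightarrow> ('a list \<Rightarrow>\<^sub>0 'k) set) set" where
  "connes_diff A E = ss_diff (total A E) (total_d A E) (column_filtration A E)"


section \<open>Quivers and quadratic monomial algebras\<close>

text \<open>
  A quiver is a \<^locale>\<open>wf_digraph\<close> (loops and parallel arrows are allowed).  A path is a triple of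
  its source, its list of arrows in the order in which they are traversed, and its target.
\<close>

type_synonym ('v, 'e) path = "'v \<times> 'e list \<times> 'v"

definition paths :: "('v, 'e) pre_digraph \<Rightarrow> ('v, 'e) path set" where
  "paths Q = {(u, es, v). pre_digraph.awalk Q u es v}"

definition path_length :: "('v, 'e) path \<Rightarrow> nat" where
  "path_length = (\<lambda>(u, es, v). length es)"

definition path_mult :: "('v, 'e) path \<Rightarrow> ('v, 'e) path \<Rightarrow> (('v, 'e) path \<Rightarrow>\<^sub>0 'k::field)" where
  "path_mult = (\<lambda>(u, es, v) (u', es', v').
     if v = u' then Poly_Mapping.single (u, es @ es', v') 1 else 0)"

definition path_algebra ::
    "('v, 'e) pre_digraph \<Rightarrow> ('k::field, ('v, 'e) path \<Rightarrow>\<^sub>0 'k) module" where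
  "path_algebra Q = \<lparr>carrier = {f. Poly_Mapping.keys f \<subseteq> paths Q},
     mult = (\<lambda>f g. lin_ext (\<lambda>x. lin_ext (path_mult x) g) f),
     one = (\<Sum>v\<in>verts Q. Poly_Mapping.single (v, [], v) 1),
     zero = 0, add = (+), smult = fscale\<rparr>"

definition quadratic_monomial_presentation ::
    "('v, 'e) pre_digraph \<Rightarrow> (('v, 'e) path \<Rightarrow>\<^sub>0 'k::field) set \<Rightarrow> bool" where
  "quadratic_monomial_presentation Q I \<longleftrightarrow> wf_digraph Q \<and>
     (\<exists>R \<subseteq> {x \<in> paths Q. path_length x = 2}.
        I = Idl\<^bsub>path_algebra Q\<^esub> ((\<lambda>x. Poly_Mapping.single x 1) ` R))"

definition vertex_subalgebra ::
    "('v, 'e) pre_digraph \<Rightarrow> (('v, 'e) path \<Rightarrow>\<^sub>0 'k::field) set \<Rightarrow> (('v, 'e) path \<Rightarrow>\<^sub>0 'k) set set" where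
  "vertex_subalgebra Q I = (\<lambda>f. I +>\<^bsub>path_algebra Q\<^esub> f) `
     {f. Poly_Mapping.keys f \<subseteq> {(v, [], v) | v. v \<in> verts Q}}"

end

theory Submission imports Defs "HOL-Library.Function_Algebras" "HOL-Library.Product_Plus"
begin

text \<open>
  The chains of \<open>A\<close> relative to \<open>E\<close> have a basis of cyclically composable words of nonzero paths.  The
  operators \<open>b\<close> and \<open>B\<close> preserve the cyclic word of arrows obtained by concatenation.  If it is empty or some
  cyclically adjacent pair of arrows in it is not a relation, the corresponding summand has no
  homology in degrees above 1.  If all of the \<open>m + 1\<close> cyclically adjacent pairs are relations, the
  summand has no chains below degree \<open>m\<close> and no homology above degree \<open>m + 1\<close>.  So every summand has
  homology in at most two adjacent degrees, there is no room for a differential \<open>d\<^sup>r\<close> with \<open>r \<ge> 2\<close>, and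
  each class killed by \<open>B\<close> lifts to a cycle of the total complex.  Choosing such lifts linearly splits
  the column filtration of cyclic homology.
\<close>

section \<open>Presentations of quotient spaces\<close>

text \<open>The spaces of the statement are iterated quotients: elements of \<open>HdR\<close> are
  sets of sets of sets of chains, and the records come without module axioms.
  \<open>presents\<close> describes each of them by two subspaces of one genuine vector space, and
  all computations take place there. Lifting succeeds because each step to the next column raises
  the degree by two: once the first correction is given, the obstruction to the next one is a cycle
  of degree at least \<open>m + 3\<close>, in a summand without homology above \<open>m + 1\<close>.
  There is no averaging over cyclic groups, so the argument holds in every characteristic. The
  delicate point is the vanishing above degree 1. Words are contracted by splitting single arrows
  off the letters near the head. All faces behave well under this except the cyclic one, which
  brings the last letter to the head and may reproduce a rotation of the same word. The recursion
  ends because a permitted pair somewhere in the cyclic word yields a rotation at which the process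
  stops.\<close>

definition presents ::
    "('k::field \<Rightarrow> 'c::ab_group_add \<Rightarrow> 'c) \<Rightarrow> ('k, 'a) module \<Rightarrow> 'c set \<Rightarrow> 'c set \<Rightarrow> ('c \<Rightarrow> 'a) \<Rightarrow> bool"
  where "presents scl M Y W f \<longleftrightarrow> vector_space scl \<and> module.subspace scl Y \<and> module.subspace scl W \<and> W \<subseteq> Y \<and>
    f ` Y = carrier M \<and> (\<forall>x\<in>Y. \<forall>y\<in>Y. f (x + y) = f x \<oplus>\<^bsub>M\<^esub> f y) \<and>
    (\<forall>c. \<forall>x\<in>Y. f (scl c x) = c \<odot>\<^bsub>M\<^esub> f x) \<and> (\<forall>x\<in>Y. f x = \<zero>\<^bsub>M\<^esub> \<longleftrightarrow> x \<in> W)"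

context
  fixes scl :: "'k::field \<Rightarrow> 'c::ab_group_add \<Rightarrow> 'c" and M :: "('k, 'a) module" and Y W f
  assumes pr: "presents scl M Y W f"
begin

interpretation vs: vector_space scl using pr by (simp add: presents_def)

lemma presents_subspace: "vs.subspace Y" "vs.subspace W"
  using pr by (auto simp: presents_def)

lemma presents_sub: "W \<subseteq> Y" and presents_carrier: "f ` Y = carrier M"
  and presents_add: "x \<in> Y \<Longrightarrow> y \<in> Y \<Longrightarrow> f (x + y) = f x \<oplus>\<^bsub>M\<^esub> f y"
  and presents_scale: "x \<in> Y \<Longrightarrow> f (scl c x) = c \<odot>\<^bsub>M\<^esub> f x"
  and presents_eq_zero: "x \<in> Y \<Longrightarrow> f x = \<zero>\<^bsub>M\<^esub> \<longleftrightarrow> x \<in> W"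
  using pr by (auto simp: presents_def)

lemma presents_zero: "f 0 = \<zero>\<^bsub>M\<^esub>"
  using presents_eq_zero[of 0] presents_subspace vs.subspace_0 by blast

lemma presents_eq_iff:
  assumes "x \<in> Y" "y \<in> Y" shows "f x = f y \<longleftrightarrow> x - y \<in> W"
proof
  have sub: "x - y \<in> Y" "- y \<in> Y"
    using assms presents_subspace by (auto intro: vs.subspace_diff vs.subspace_neg)
  {
    assume "f x = f y"
    then have "f (x + - y) = f (y + - y)" using assms sub by (metis presents_add)
    then show "x - y \<in> W" using presents_eq_zero[OF sub(1)] presents_zero by simp
  next
    assume "x - y \<in> W"
    then have "f (x - y) = f 0" using presents_eq_zero[OF sub(1)] presents_zero by simp
    then have "f (y + (x - y)) = f (y + 0)"
      using assms sub presents_subspace vs.subspace_0 by (metis presents_add)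
    then show "f x = f y" by simp
  }
qed

text \<open>Cosets in \<open>M\<close> are sets whose equality is awkward to test; pulled back to
  \<open>Y\<close>, membership becomes the linear condition \<open>x - y \<in> V\<close>.\<close>

lemma presents_coset:
  assumes V: "vs.subspace V" "W \<subseteq> V" "V \<subseteq> Y" and y: "y \<in> Y"
  shows "f ` V +>\<^bsub>M\<^esub> f y = {f x |x. x \<in> Y \<and> x - y \<in> V}"
proof (intro equalityI subsetI)
  fix a assume "a \<in> f ` V +>\<^bsub>M\<^esub> f y"
  then obtain v where "v \<in> V" "a = f v \<oplus>\<^bsub>M\<^esub> f y" by (auto simp: a_r_coset_def')
  then have "a = f (v + y)" "v + y \<in> Y" "v + y - y \<in> V"
    using V y presents_add presents_subspace vs.subspace_add by (auto simp: subset_iff)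
  then show "a \<in> {f x |x. x \<in> Y \<and> x - y \<in> V}" by blast
next
  fix a assume "a \<in> {f x |x. x \<in> Y \<and> x - y \<in> V}"
  then obtain x where x: "x \<in> Y" "x - y \<in> V" "a = f x" by blast
  then have "a = f (x - y) \<oplus>\<^bsub>M\<^esub> f y"
    using V(3) y presents_add[of "x - y" y] by (auto simp: subset_iff)
  then show "a \<in> f ` V +>\<^bsub>M\<^esub> f y" using x by (auto simp: a_r_coset_def')
qed

lemma presents_coset_eq_iff:
  assumes V: "vs.subspace V" "W \<subseteq> V" "V \<subseteq> Y" and xy: "x \<in> Y" "y \<in> Y"
  shows "f ` V +>\<^bsub>M\<^esub> f x = f ` V +>\<^bsub>M\<^esub> f y \<longleftrightarrow> x - y \<in> V"
proof
  assume "f ` V +>\<^bsub>M\<^esub> f x = f ` V +>\<^bsub>M\<^esub> f y"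
  moreover have "f x \<in> f ` V +>\<^bsub>M\<^esub> f x"
    unfolding presents_coset[OF V xy(1)] using xy V(1) vs.subspace_0 by auto
  ultimately obtain z where z: "z \<in> Y" "z - y \<in> V" "f x = f z"
    unfolding presents_coset[OF V xy(2)] by auto
  then have "x - z \<in> V" using presents_eq_iff xy V(2) by blast
  then have "(x - z) + (z - y) \<in> V" using V(1) z vs.subspace_add by blast
  then show "x - y \<in> V" by simp
next
  assume d: "x - y \<in> V"
  have "z - x \<in> V \<longleftrightarrow> z - y \<in> V" for z
    using vs.subspace_add[OF V(1) _ d, of "z - x"] vs.subspace_diff[OF V(1) _ d, of "z - y"] by auto
  then show "f ` V +>\<^bsub>M\<^esub> f x = f ` V +>\<^bsub>M\<^esub> f y"
    unfolding presents_coset[OF V xy(1)] presents_coset[OF V xy(2)] by simp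
qed

text \<open>The third isomorphism theorem \<open>(Y/W)/(V/W) = Y/V\<close>. Iterating it keeps
  homology of homology a quotient of two subspaces of the same vector space.\<close>

lemma presents_quot:
  assumes V: "vs.subspace V" "W \<subseteq> V" "V \<subseteq> Y" and N: "N = f ` V"
  shows "presents scl (quot_space M N) Y V (\<lambda>y. N +>\<^bsub>M\<^esub> f y)"
proof -
  have ne: "f ` V +>\<^bsub>M\<^esub> f y \<noteq> {}" if "y \<in> Y" for y
    unfolding presents_coset[OF V that] using that vs.subspace_0[OF V(1)] by force
  have zero: "N = N +>\<^bsub>M\<^esub> f 0"
    unfolding N presents_coset[OF V vs.subspace_0[OF presents_subspace(1)]] using V(3) by auto
  have smult: "(\<Union>x\<in>f ` V +>\<^bsub>M\<^esub> f y. f ` V +>\<^bsub>M\<^esub> (c \<odot>\<^bsub>M\<^esub> x)) = f ` V +>\<^bsub>M\<^esub> f (scl c y)"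
    if y: "y \<in> Y" for c y
  proof -
    \<comment> \<open>\<open>quot_space\<close> takes a union over all representatives; each of them
      contributes the same coset, and \<open>ne\<close> says that there is at least one.\<close>
    have "f ` V +>\<^bsub>M\<^esub> (c \<odot>\<^bsub>M\<^esub> x) = f ` V +>\<^bsub>M\<^esub> f (scl c y)" if x: "x \<in> f ` V +>\<^bsub>M\<^esub> f y" for x
    proof -
      obtain z where z: "x = f z" "z \<in> Y" "z - y \<in> V"
        using x unfolding presents_coset[OF V y] by blast
      have "scl c z - scl c y \<in> V"
        using vs.subspace_scale[OF V(1) z(3)] by (simp add: vs.scale_right_diff_distrib)
      then show ?thesis
        using z y presents_coset_eq_iff[OF V, of "scl c z" "scl c y"] presents_scale presents_subspace
          vs.subspace_scale by metis
    qed
    then show ?thesis using ne[OF y] by auto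
  qed
  have add: "(f ` V +>\<^bsub>M\<^esub> f x) <+>\<^bsub>M\<^esub> (f ` V +>\<^bsub>M\<^esub> f y) = f ` V +>\<^bsub>M\<^esub> f (x + y)"
    if xy: "x \<in> Y" "y \<in> Y" for x y
  proof -
    have xy': "x + y \<in> Y" using xy presents_subspace vs.subspace_add by blast
    show ?thesis
      unfolding presents_coset[OF V xy(1)] presents_coset[OF V xy(2)] presents_coset[OF V xy'] set_add_def'
    proof (intro equalityI subsetI; clarsimp)
      fix x' y' assume a: "x' \<in> Y" "x' - x \<in> V" "y' \<in> Y" "y' - y \<in> V"
      then have "x' + y' - (x + y) \<in> V" using vs.subspace_add[OF V(1) a(2,4)] by (simp add: algebra_simps)
      then show "\<exists>z. f x' \<oplus>\<^bsub>M\<^esub> f y' = f z \<and> z \<in> Y \<and> z - (x + y) \<in> V"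
        using a presents_add presents_subspace vs.subspace_add by metis
    next
      fix z assume a: "z \<in> Y" "z - (x + y) \<in> V"
      have "z - x \<in> Y" using a xy presents_subspace vs.subspace_diff by blast
      moreover have "z - x - y \<in> V" using a by (simp add: algebra_simps)
      moreover have "f z = f x \<oplus>\<^bsub>M\<^esub> f (z - x)"
        using presents_add[of x "z - x"] xy calculation by simp
      ultimately show "\<exists>a. (\<exists>x'. a = f x' \<and> x' \<in> Y \<and> x' - x \<in> V) \<and>
          (\<exists>b. (\<exists>x. b = f x \<and> x \<in> Y \<and> x - y \<in> V) \<and> f z = a \<oplus>\<^bsub>M\<^esub> b)"
        using xy vs.subspace_0[OF V(1)] by (metis diff_self)
    qed
  qed
  show ?thesis
    unfolding presents_def
  proof (intro conjI ballI allI)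
    show "(\<lambda>y. N +>\<^bsub>M\<^esub> f y) ` Y = carrier (quot_space M N)"
      unfolding quot_space_def ring.defs module.defs FactRing_def
      by (simp add: A_RCOSETS_def' presents_carrier[symmetric] UNION_singleton_eq_range image_image)
  next
    fix y assume y: "y \<in> Y"
    show "(N +>\<^bsub>M\<^esub> f y = \<zero>\<^bsub>quot_space M N\<^esub>) = (y \<in> V)"
      using presents_coset_eq_iff[OF V y, of 0] zero N vs.subspace_0[OF presents_subspace(1)]
      by (auto simp: quot_space_def ring.defs module.defs FactRing_def)
  qed (use V pr add smult N in \<open>auto simp: presents_def quot_space_def ring.defs module.defs FactRing_def\<close>)
qed

lemma presents_restrict:
  assumes "vs.subspace Y'" "W \<subseteq> Y'" "Y' \<subseteq> Y" "C = f ` Y'"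
  shows "presents scl (M\<lparr>carrier := C\<rparr>) Y' W f"
  using pr assms by (auto simp: presents_def subset_iff)

end

section \<open>Homology, cokernels and induced maps of presented spaces\<close>

lemma r_coset_restrict: "N +>\<^bsub>M\<lparr>carrier := C\<rparr>\<^esub> x = N +>\<^bsub>M\<^esub> x"
  by (simp add: a_r_coset_def')

lemma subspace_image_sum:
  assumes "Vector_Spaces.linear s1 s2 u" "module.subspace s1 Y" "module.subspace s2 W"
  shows "module.subspace s2 {w + u y |w y. w \<in> W \<and> y \<in> Y}"
proof -
  interpret u: Vector_Spaces.linear s1 s2 u by fact
  show ?thesis
  proof (rule u.vs2.subspaceI)
    show "0 \<in> {w + u y |w y. w \<in> W \<and> y \<in> Y}"
      using assms u.vs1.subspace_0 u.vs2.subspace_0 u.zero by (metis (mono_tags, lifting) add_0 mem_Collect_eq)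
  next
    fix x x' assume "x \<in> {w + u y |w y. w \<in> W \<and> y \<in> Y}" "x' \<in> {w + u y |w y. w \<in> W \<and> y \<in> Y}"
    then obtain w y w' y' where "x = w + u y" "x' = w' + u y'" "w \<in> W" "w' \<in> W" "y \<in> Y" "y' \<in> Y" by blast
    then have "x + x' = (w + w') + u (y + y')" "w + w' \<in> W" "y + y' \<in> Y"
      using assms u.vs1.subspace_add u.vs2.subspace_add by (auto simp: u.add algebra_simps)
    then show "x + x' \<in> {w + u y |w y. w \<in> W \<and> y \<in> Y}" by blast
  next
    fix c x assume "x \<in> {w + u y |w y. w \<in> W \<and> y \<in> Y}"
    then obtain w y where "x = w + u y" "w \<in> W" "y \<in> Y" by blast
    then have "s2 c x = s2 c w + u (s1 c y)" "s2 c w \<in> W" "s1 c y \<in> Y"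
      using assms u.vs1.subspace_scale u.vs2.subspace_scale by (auto simp: u.scale u.vs2.scale_right_distrib)
    then show "s2 c x \<in> {w + u y |w y. w \<in> W \<and> y \<in> Y}" by blast
  qed
qed

text \<open>Adding \<open>W\<close> does not change the image under \<open>f\<close>, but
  \<open>presents_quot\<close> asks for a subspace of \<open>Y\<close> that contains
  \<open>W\<close>.\<close>

lemma presents_image_sum:
  assumes L: "presents s1 L YL WL fL" and M: "presents s2 M Y W f"
    and u: "Vector_Spaces.linear s1 s2 u" "u ` YL \<subseteq> Y" and g: "\<And>y. y \<in> YL \<Longrightarrow> g (fL y) = f (u y)"
  shows "g ` carrier L = f ` {w + u y |w y. w \<in> W \<and> y \<in> YL}"
proof -
  interpret u: Vector_Spaces.linear s1 s2 u by fact
  have "f (w + u y) = f (u y)" if "w \<in> W" "y \<in> YL" for w y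
  proof -
    have "w + u y \<in> Y" "u y \<in> Y"
      using that u(2) presents_sub[OF M] presents_subspace[OF M] u.vs2.subspace_add by blast+
    then show ?thesis using presents_eq_iff[OF M] that by simp
  qed
  moreover have "0 \<in> W" using presents_subspace[OF M] u.vs2.subspace_0 by blast
  ultimately have "f ` {w + u y |w y. w \<in> W \<and> y \<in> YL} = (\<lambda>y. f (u y)) ` YL"
    by (auto simp: image_iff) metis
  then show ?thesis unfolding presents_carrier[OF L, symmetric] image_image using g by auto
qed

text \<open>Cycles and boundaries are taken modulo \<open>WN\<close> and \<open>W\<close>. So the
  same lemma serves for Hochschild homology, where these are \<open>{0}\<close>, and for de Rham
  cohomology, where they are the Hochschild boundaries.\<close>

lemma presents_homology:
  assumes L: "presents s1 L YL WL fL" and M: "presents s2 M Y W f" and N: "presents s3 N YN WN fN"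
    and u: "Vector_Spaces.linear s1 s2 u" "u ` YL \<subseteq> Y" and g: "\<And>y. y \<in> YL \<Longrightarrow> g (fL y) = f (u y)"
    and w: "Vector_Spaces.linear s2 s3 w" "w ` Y \<subseteq> YN" and h: "\<And>y. y \<in> Y \<Longrightarrow> h (f y) = fN (w y)"
    and wu: "\<And>y. y \<in> YL \<Longrightarrow> w (u y) \<in> WN" and wW: "\<And>y. y \<in> W \<Longrightarrow> w y \<in> WN"
  shows "presents s2 (homology_at L M N g h) {y \<in> Y. w y \<in> WN} {x + u y |x y. x \<in> W \<and> y \<in> YL}
    (\<lambda>y. (g ` carrier L) +>\<^bsub>M\<^esub> f y)"
proof -
  interpret vs: vector_space s2 using M by (simp add: presents_def)
  interpret w: Vector_Spaces.linear s2 s3 w by fact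
  have Z: "vs.subspace {y \<in> Y. w y \<in> WN}"
    using presents_subspace[OF M] presents_subspace[OF N]
    by (intro vs.subspaceI) (auto simp: w.zero w.add w.scale vs.subspace_0 vs.subspace_add vs.subspace_scale
        w.vs2.subspace_0 w.vs2.subspace_add w.vs2.subspace_scale)
  have ker: "a_kernel M N h = f ` {y \<in> Y. w y \<in> WN}"
    unfolding a_kernel_def kernel_def using presents_carrier[OF M] h w(2) presents_eq_zero[OF N]
    by (auto simp: image_iff) (metis imageE image_eqI subsetD)+
  have M': "presents s2 (M\<lparr>carrier := a_kernel M N h\<rparr>) {y \<in> Y. w y \<in> WN} W f"
    using presents_restrict[OF M Z _ _ ker] presents_sub[OF M] wW by auto
  have V: "vs.subspace {x + u y |x y. x \<in> W \<and> y \<in> YL}"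
    using subspace_image_sum[OF u(1) presents_subspace(1)[OF L] presents_subspace(2)[OF M]] .
  have WV: "W \<subseteq> {x + u y |x y. x \<in> W \<and> y \<in> YL}"
  proof
    interpret u: Vector_Spaces.linear s1 s2 u by fact
    fix x assume "x \<in> W"
    moreover have "0 \<in> YL" using presents_subspace[OF L] u.vs1.subspace_0 by blast
    ultimately show "x \<in> {x + u y |x y. x \<in> W \<and> y \<in> YL}" using u.zero by force
  qed
  have VZ: "{x + u y |x y. x \<in> W \<and> y \<in> YL} \<subseteq> {y \<in> Y. w y \<in> WN}"
    using presents_sub[OF M] u(2) presents_subspace[OF M] presents_subspace[OF N] wu wW
    by (auto simp: w.add intro!: vs.subspace_add w.vs2.subspace_add)
  show ?thesis
    unfolding homology_at_def
    using presents_quot[OF M' V WV VZ presents_image_sum[OF L M u g]] by (simp add: r_coset_restrict)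
qed

lemma presents_cokernel:
  assumes L: "presents s1 L YL WL fL" and M: "presents s2 M Y W f"
    and u: "Vector_Spaces.linear s1 s2 u" "u ` YL \<subseteq> Y" and g: "\<And>y. y \<in> YL \<Longrightarrow> g (fL y) = f (u y)"
  shows "presents s2 (cokernel L M g) Y {x + u y |x y. x \<in> W \<and> y \<in> YL} (\<lambda>y. (g ` carrier L) +>\<^bsub>M\<^esub> f y)"
proof -
  interpret u: Vector_Spaces.linear s1 s2 u by fact
  have V: "u.vs2.subspace {x + u y |x y. x \<in> W \<and> y \<in> YL}"
    using subspace_image_sum[OF u(1) presents_subspace(1)[OF L] presents_subspace(2)[OF M]] .
  have "0 \<in> YL" using presents_subspace[OF L] u.vs1.subspace_0 by blast
  then have WV: "W \<subseteq> {x + u y |x y. x \<in> W \<and> y \<in> YL}" using u.zero by force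
  have VY: "{x + u y |x y. x \<in> W \<and> y \<in> YL} \<subseteq> Y"
    using presents_sub[OF M] u(2) presents_subspace[OF M] by (auto intro!: u.vs2.subspace_add)
  show ?thesis
    unfolding cokernel_def using presents_quot[OF M V WV VY presents_image_sum[OF L M u g]] .
qed

text \<open>The union in \<open>induced_map\<close> collapses to a single coset because
  \<open>u\<close> maps \<open>V\<close> into \<open>V'\<close>.\<close>

lemma induced_map_presented:
  assumes M: "presents s1 M Y W f" and V: "module.subspace s1 V" "W \<subseteq> V" "V \<subseteq> Y"
    and M': "presents s2 M' Y' W' f'" and V': "module.subspace s2 V'" "W' \<subseteq> V'" "V' \<subseteq> Y'"
    and u: "Vector_Spaces.linear s1 s2 u" "u ` Y \<subseteq> Y'" "u ` V \<subseteq> V'"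
    and g: "\<And>y. y \<in> Y \<Longrightarrow> g (f y) = f' (u y)" and y: "y \<in> Y"
  shows "induced_map M' (f' ` V') g (f ` V +>\<^bsub>M\<^esub> f y) = f' ` V' +>\<^bsub>M'\<^esub> f' (u y)"
proof -
  interpret u: Vector_Spaces.linear s1 s2 u by fact
  have "f' ` V' +>\<^bsub>M'\<^esub> g x = f' ` V' +>\<^bsub>M'\<^esub> f' (u y)" if x: "x \<in> f ` V +>\<^bsub>M\<^esub> f y" for x
  proof -
    obtain z where z: "x = f z" "z \<in> Y" "z - y \<in> V"
      using x unfolding presents_coset[OF M V y] by blast
    then have "u z - u y \<in> V'" using u(3) u.diff by (metis image_subset_iff)
    then show ?thesis using z y g u(2) presents_coset_eq_iff[OF M' V', of "u z" "u y"] by auto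
  qed
  moreover have "f y \<in> f ` V +>\<^bsub>M\<^esub> f y"
    unfolding presents_coset[OF M V y] using y u.vs1.subspace_0[OF V(1)] by auto
  ultimately show ?thesis unfolding induced_map_def by auto
qed

section \<open>Direct sums and a criterion for isomorphism\<close>

definition fun_scale :: "('k \<Rightarrow> 'c \<Rightarrow> 'c) \<Rightarrow> 'k \<Rightarrow> ('i \<Rightarrow> 'c) \<Rightarrow> 'i \<Rightarrow> 'c" where
  "fun_scale scl c z = (\<lambda>i. scl c (z i))"

lemma vector_space_fun:
  assumes "vector_space scl" shows "vector_space (fun_scale scl)"
proof -
  interpret vector_space scl by fact
  show ?thesis
    by unfold_locales (auto simp: fun_scale_def scale_right_distrib scale_left_distrib)
qed

text \<open>A coordinate counts as zero when its representative lies in \<open>W i\<close>, so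
  finiteness of the support is required only modulo \<open>W\<close>. Coordinates outside
  \<open>I\<close> leave no trace in the direct sum and are fixed to \<open>0\<close>.\<close>

lemma presents_direct_sum:
  assumes scl: "vector_space scl" and M: "\<And>i. i \<in> I \<Longrightarrow> presents scl (M i) (Y i) (W i) (f i)"
  shows "presents (fun_scale scl) (direct_sum I M)
    {z. (\<forall>i\<in>I. z i \<in> Y i) \<and> (\<forall>i. i \<notin> I \<longrightarrow> z i = 0) \<and> finite {i\<in>I. z i \<notin> W i}}
    {z. (\<forall>i\<in>I. z i \<in> W i) \<and> (\<forall>i. i \<notin> I \<longrightarrow> z i = 0)}
    (\<lambda>z. \<lambda>i\<in>I. f i (z i))" (is "presents _ _ ?Y ?W ?f")
proof -
  interpret vs: vector_space scl by fact
  interpret fs: vector_space "fun_scale scl" using vector_space_fun[OF scl] .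
  note sub = presents_subspace[OF M] presents_sub[OF M]
  have fin: "finite {i \<in> I. z i + z' i \<notin> W i}"
    if "finite {i \<in> I. z i \<notin> W i}" "finite {i \<in> I. z' i \<notin> W i}" for z z'
    by (rule finite_subset[OF _ finite_UnI[OF that]]) (auto intro: vs.subspace_add[OF sub(2)])
  have fin': "finite {i \<in> I. scl c (z i) \<notin> W i}" if "finite {i \<in> I. z i \<notin> W i}" for z c
    by (rule finite_subset[OF _ that]) (auto intro: vs.subspace_scale[OF sub(2)])
  have "{i \<in> I. 0 \<notin> W i} = {}" using vs.subspace_0[OF sub(2)] by auto
  then have fin0: "finite {i \<in> I. 0 \<notin> W i}" by (metis finite.emptyI)
  have Y: "fs.subspace ?Y"
    using fin fin' fin0 by (intro fs.subspaceI)
      (auto simp: fun_scale_def vs.subspace_0[OF sub(1)] simp del: Collect_empty_eq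
        intro: vs.subspace_add[OF sub(1)] vs.subspace_scale[OF sub(1)])
  have W: "fs.subspace ?W"
    by (intro fs.subspaceI) (auto simp: fun_scale_def vs.subspace_0[OF sub(2)]
        intro: vs.subspace_add[OF sub(2)] vs.subspace_scale[OF sub(2)])
  have WY: "?W \<subseteq> ?Y"
  proof
    fix z assume z: "z \<in> ?W"
    then have "{i \<in> I. z i \<notin> W i} = {}" by auto
    then have "finite {i \<in> I. z i \<notin> W i}" by (metis finite.emptyI)
    moreover have "\<forall>i\<in>I. z i \<in> Y i" using z sub(3) by blast
    ultimately show "z \<in> ?Y" using z by simp
  qed
  have eq0: "{i\<in>I. f i (z i) \<noteq> \<zero>\<^bsub>M i\<^esub>} = {i\<in>I. z i \<notin> W i}" if "\<forall>i\<in>I. z i \<in> Y i" for z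
    using that presents_eq_zero[OF M] by auto
  have car: "?f ` ?Y = carrier (direct_sum I M)"
  proof (intro equalityI subsetI)
    fix x assume "x \<in> ?f ` ?Y"
    then obtain z where z: "z \<in> ?Y" "x = ?f z" by blast
    have "{i \<in> I. x i \<noteq> \<zero>\<^bsub>M i\<^esub>} = {i\<in>I. z i \<notin> W i}" using eq0[of z] z by auto
    then show "x \<in> carrier (direct_sum I M)"
      using z presents_carrier[OF M, symmetric] by (auto simp: direct_sum_def)
  next
    fix x assume x: "x \<in> carrier (direct_sum I M)"
    then have "\<forall>i\<in>I. x i \<in> f i ` Y i" by (auto simp: direct_sum_def presents_carrier[OF M])
    then have "\<forall>i\<in>I. \<exists>y\<in>Y i. f i y = x i" by (metis imageE)
    then obtain z where z: "\<forall>i\<in>I. z i \<in> Y i \<and> f i (z i) = x i" by metis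
    define z' where "z' = (\<lambda>i. if i \<in> I then z i else 0)"
    have "{i\<in>I. z' i \<notin> W i} = {i\<in>I. x i \<noteq> \<zero>\<^bsub>M i\<^esub>}" using eq0[of z] z by (simp add: z'_def cong: conj_cong)
    then have "z' \<in> ?Y" using z x by (auto simp: z'_def direct_sum_def)
    moreover have "?f z' = x" using z x by (auto simp: z'_def direct_sum_def PiE_def extensional_def fun_eq_iff)
    ultimately show "x \<in> ?f ` ?Y" by blast
  qed
  have zero: "(?f z = \<zero>\<^bsub>direct_sum I M\<^esub>) = (z \<in> ?W)" if "z \<in> ?Y" for z
    using that presents_eq_zero[OF M] by (auto simp: direct_sum_def fun_eq_iff)
  show ?thesis
    unfolding presents_def using scl Y W WY car zero
    by (auto simp: vector_space_fun direct_sum_def fun_eq_iff fun_scale_def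
        presents_add[OF M] presents_scale[OF M])
qed

definition prod_scale :: "('k \<Rightarrow> 'c \<Rightarrow> 'c) \<Rightarrow> ('k \<Rightarrow> 'd \<Rightarrow> 'd) \<Rightarrow> 'k \<Rightarrow> 'c \<times> 'd \<Rightarrow> 'c \<times> 'd" where
  "prod_scale s1 s2 c z = (s1 c (fst z), s2 c (snd z))"

lemma vector_space_prod:
  assumes "vector_space s1" "vector_space s2" shows "vector_space (prod_scale s1 s2)"
proof -
  interpret v1: vector_space s1 by fact
  interpret v2: vector_space s2 by fact
  show ?thesis
    by unfold_locales (auto simp: prod_scale_def v1.scale_right_distrib v1.scale_left_distrib
        v2.scale_right_distrib v2.scale_left_distrib)
qed

lemma presents_direct_sum2:
  assumes M: "presents s1 M Y W f" and N: "presents s2 N Y' W' f'"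
  shows "presents (prod_scale s1 s2) (direct_sum2 M N) (Y \<times> Y') (W \<times> W') (map_prod f f')"
proof -
  interpret v1: vector_space s1 using M by (simp add: presents_def)
  interpret v2: vector_space s2 using N by (simp add: presents_def)
  interpret v: vector_space "prod_scale s1 s2" by (rule vector_space_prod) unfold_locales
  have sub: "v.subspace (S \<times> S')" if "v1.subspace S" "v2.subspace S'" for S S'
    using that by (intro v.subspaceI) (auto simp: prod_scale_def v1.subspace_0 v2.subspace_0
        v1.subspace_add v2.subspace_add v1.subspace_scale v2.subspace_scale zero_prod_def)
  have car: "map_prod f f' ` (Y \<times> Y') = carrier M \<times> carrier N"
    unfolding presents_carrier[OF M, symmetric] presents_carrier[OF N, symmetric] by (rule map_prod_surj_on) auto
  show ?thesis
    unfolding presents_def car using sub presents_subspace[OF M] presents_subspace[OF N] presents_sub[OF M]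
      presents_sub[OF N] v.vector_space_axioms
    by (auto simp: direct_sum2_def prod_scale_def presents_add[OF M] presents_add[OF N] presents_scale[OF M]
        presents_scale[OF N] presents_eq_zero[OF M] presents_eq_zero[OF N])
qed

text \<open>\<open>\<theta>\<close> runs against the direction of the conclusion because in the
  application it is the lifting of homology classes, which maps the direct sum into cyclic homology;
  the isomorphism is the inverse of the map it induces.\<close>

lemma presents_isomorphic:
  assumes M: "presents s1 M Y W f" and N: "presents s2 N Y' W' f'"
    and \<theta>: "Vector_Spaces.linear s2 s1 \<theta>" "\<theta> ` Y' \<subseteq> Y"
    and inj: "\<And>y. y \<in> Y' \<Longrightarrow> \<theta> y \<in> W \<longleftrightarrow> y \<in> W'"
    and surj: "\<And>z. z \<in> Y \<Longrightarrow> \<exists>y\<in>Y'. z - \<theta> y \<in> W"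
  shows "M \<cong>\<^sub>v N"
proof -
  interpret \<theta>: Vector_Spaces.linear s2 s1 \<theta> by fact
  note sub = presents_subspace[OF N]
  have eq: "f (\<theta> y) = f (\<theta> y') \<longleftrightarrow> f' y = f' y'" if "y \<in> Y'" "y' \<in> Y'" for y y'
    using that \<theta>(2) presents_eq_iff[OF M, of "\<theta> y" "\<theta> y'"] presents_eq_iff[OF N, of y y']
      inj[of "y - y'"] \<theta>.vs1.subspace_diff[OF sub(1)] by (auto simp: \<theta>.diff)
  \<comment> \<open>By \<open>eq\<close> the choice of the representative does not affect the
    value.\<close>
  define g where "g x = f' (SOME y. y \<in> Y' \<and> f (\<theta> y) = x)" for x
  have g: "g (f (\<theta> y)) = f' y" if "y \<in> Y'" for y
    unfolding g_def by (rule someI2[of _ y]) (use that eq in auto)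
  have car: "\<exists>y\<in>Y'. x = f (\<theta> y)" if x: "x \<in> carrier M" for x
  proof -
    obtain z where z: "z \<in> Y" "x = f z" using x presents_carrier[OF M] by blast
    obtain y where "y \<in> Y'" "z - \<theta> y \<in> W" using surj z by blast
    then show ?thesis using presents_eq_iff[OF M z(1), of "\<theta> y"] \<theta>(2) z by blast
  qed
  have inM: "f (\<theta> y) \<in> carrier M" if "y \<in> Y'" for y using that \<theta>(2) presents_carrier[OF M] by blast
  have "linear_iso M N g"
    unfolding linear_iso_def
  proof (intro conjI ballI allI)
    show "bij_betw g (carrier M) (carrier N)"
      unfolding bij_betw_def
    proof
      show "inj_on g (carrier M)"
        by (rule inj_onI) (metis car g eq)
      show "g ` carrier M = carrier N"
        unfolding presents_carrier[OF N, symmetric] by (auto simp: image_iff) (metis car g inM)+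
    qed
  next
    fix x x' assume "x \<in> carrier M" "x' \<in> carrier M"
    then obtain y y' where y: "y \<in> Y'" "y' \<in> Y'" "x = f (\<theta> y)" "x' = f (\<theta> y')" using car by metis
    then have "x \<oplus>\<^bsub>M\<^esub> x' = f (\<theta> (y + y'))" using \<theta>(2) by (simp add: \<theta>.add presents_add[OF M] image_subset_iff)
    then show "g (x \<oplus>\<^bsub>M\<^esub> x') = g x \<oplus>\<^bsub>N\<^esub> g x'"
      using y g \<theta>.vs1.subspace_add[OF sub(1)] by (simp add: presents_add[OF N])
  next
    fix c x assume "x \<in> carrier M"
    then obtain y where y: "y \<in> Y'" "x = f (\<theta> y)" using car by metis
    then have "c \<odot>\<^bsub>M\<^esub> x = f (\<theta> (s2 c y))" using \<theta>(2) by (simp add: \<theta>.scale presents_scale[OF M] image_subset_iff)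
    then show "g (c \<odot>\<^bsub>M\<^esub> x) = c \<odot>\<^bsub>N\<^esub> g x"
      using y g \<theta>.vs1.subspace_scale[OF sub(1)] by (simp add: presents_scale[OF N])
  qed
  then show ?thesis unfolding isomorphic_spaces_def by blast
qed

section \<open>Mixed complexes\<close>

locale mixed_complex = vector_space scl for scl :: "'k::field \<Rightarrow> 'c::ab_group_add \<Rightarrow> 'c" +
  fixes K :: "int \<Rightarrow> 'c set" and b B :: "'c \<Rightarrow> 'c"
  assumes linear_b: "Vector_Spaces.linear scl scl b" and linear_B: "Vector_Spaces.linear scl scl B"
    and subspace_K: "subspace (K n)" and K_neg: "n < 0 \<Longrightarrow> K n = {0}"
    and b_K: "x \<in> K n \<Longrightarrow> b x \<in> K (n - 1)" and B_K: "x \<in> K n \<Longrightarrow> B x \<in> K (n + 1)"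
    and bb: "x \<in> K n \<Longrightarrow> b (b x) = 0" and BB: "x \<in> K n \<Longrightarrow> B (B x) = 0"
    and bB: "x \<in> K n \<Longrightarrow> b (B x) + B (b x) = 0"
begin

sublocale b: Vector_Spaces.linear scl scl b by (fact linear_b)
sublocale B: Vector_Spaces.linear scl scl B by (fact linear_B)
sublocale fs: vector_space "fun_scale scl"
  by (rule vector_space_fun[OF vector_space_axioms])

text \<open>The entry of the bicomplex at \<open>(p, n - p)\<close> is the space of chains of degree
  \<open>n - 2 * p\<close>.\<close>

definition Tot :: "int \<Rightarrow> (int \<Rightarrow> 'c) set" where
  "Tot n = {z. (\<forall>p\<ge>0. z p \<in> K (n - 2 * p)) \<and> (\<forall>p<0. z p = 0)}"

text \<open>The guard cuts off \<open>B\<close> out of column 0, whose target would be column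
  -1.\<close>

definition D :: "(int \<Rightarrow> 'c) \<Rightarrow> int \<Rightarrow> 'c" where
  "D z = (\<lambda>p. if 0 \<le> p then b (z p) + B (z (p + 1)) else 0)"

definition Fil :: "int \<Rightarrow> int \<Rightarrow> (int \<Rightarrow> 'c) set" where
  "Fil p n = {z \<in> Tot n. \<forall>p'>p. z p' = 0}"

lemma K_cong: "x \<in> K n \<Longrightarrow> n = m \<Longrightarrow> x \<in> K m" by simp

lemma Tot_iff: "z \<in> Tot n \<longleftrightarrow> (\<forall>p\<ge>0. z p \<in> K (n - 2 * p)) \<and> (\<forall>p<0. z p = 0)"
  by (simp add: Tot_def)

lemma Tot_K: "z \<in> Tot n \<Longrightarrow> 0 \<le> p \<Longrightarrow> z p \<in> K (n - 2 * p)"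
  and Tot_neg: "z \<in> Tot n \<Longrightarrow> p < 0 \<Longrightarrow> z p = 0"
  by (auto simp: Tot_iff)

lemma Tot_large: "z \<in> Tot n \<Longrightarrow> 0 \<le> p \<Longrightarrow> n < 2 * p \<Longrightarrow> z p = 0"
  using Tot_K[of z n p] K_neg[of "n - 2 * p"] by auto

lemma zero_K [simp]: "0 \<in> K n" using subspace_K subspace_0 by blast

lemma subspace_Tot: "fs.subspace (Tot n)"
  by (intro fs.subspaceI)
    (auto simp: Tot_iff fun_scale_def subspace_add[OF subspace_K] subspace_scale[OF subspace_K])

lemma subspace_Fil: "fs.subspace (Fil p n)"
  using subspace_Tot[of n] by (intro fs.subspaceI)
    (auto simp: Fil_def fs.subspace_0 fs.subspace_add fs.subspace_scale, auto simp: fun_scale_def)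

lemma Fil_Tot: "z \<in> Fil p n \<Longrightarrow> z \<in> Tot n" by (simp add: Fil_def)

lemma Fil_mono: "p \<le> p' \<Longrightarrow> Fil p n \<subseteq> Fil p' n" by (auto simp: Fil_def)

lemma linear_D: "Vector_Spaces.linear (fun_scale scl) (fun_scale scl) D"
  by unfold_locales (auto simp: D_def fun_scale_def fun_eq_iff b.add B.add b.scale B.scale
      scale_right_distrib algebra_simps)

sublocale D: Vector_Spaces.linear "fun_scale scl" "fun_scale scl" D by (fact linear_D)

lemma D_Tot: assumes z: "z \<in> Tot n" shows "D z \<in> Tot (n - 1)"
proof -
  have "b (z p) + B (z (p + 1)) \<in> K (n - 1 - 2 * p)" if "0 \<le> p" for p
  proof -
    have "b (z p) \<in> K (n - 1 - 2 * p)"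
      by (rule K_cong[OF b_K[OF Tot_K[OF z that]]]) simp
    moreover have "B (z (p + 1)) \<in> K (n - 1 - 2 * p)"
      by (rule K_cong[OF B_K[OF Tot_K[OF z, of "p + 1"]]]) (use that in simp_all)
    ultimately show ?thesis using subspace_add[OF subspace_K] by blast
  qed
  then show ?thesis by (auto simp: Tot_iff D_def)
qed

lemma DD: assumes z: "z \<in> Tot n" shows "D (D z) = 0"
proof
  fix p
  have "b (b (z p) + B (z (p + 1))) + B (b (z (p + 1)) + B (z (p + 1 + 1))) = 0" if "0 \<le> p"
    using bb[OF Tot_K[OF z that]] bB[OF Tot_K[OF z, of "p + 1"]] BB[OF Tot_K[OF z, of "p + 1 + 1"]] that
    by (simp add: b.add B.add)
  then show "D (D z) p = 0 p" by (auto simp: D_def B.zero)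
qed

definition Z :: "int \<Rightarrow> 'c set" where "Z n = {y \<in> K n. b y = 0}"

text \<open>This and \<open>dR_boundaries\<close> are the full preimages, in the chains, of the
  kernel and the image of Connes' map on Hochschild homology.\<close>

definition dR_cycles :: "int \<Rightarrow> 'c set" where
  "dR_cycles n = {x \<in> Z n. B x \<in> b ` K (n + 2)}"

definition dR_boundaries :: "int \<Rightarrow> 'c set" where
  "dR_boundaries n = {b u + B v |u v. u \<in> K (n + 1) \<and> v \<in> Z (n - 1)}"

lemma subspace_Z: "subspace (Z n)"
  by (intro subspaceI) (auto simp: Z_def b.zero b.add b.scale subspace_add[OF subspace_K] subspace_scale[OF subspace_K])

lemma subspace_bK: "subspace (b ` K n)"
  by (rule b.subspace_image[OF subspace_K])

lemma bK_Z: "b ` K (n + 1) \<subseteq> Z n"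
  using b_K bb by (force simp: Z_def)

lemma B_Z: "x \<in> Z n \<Longrightarrow> B x \<in> Z (n + 1)"
  using B_K bB[of x n] by (auto simp: Z_def B.zero)

end

text \<open>
  By \<open>lift\<close>, a cycle that survives \<open>d\<^sup>1\<close> is the leading term of a cycle of the total complex, and
  therefore survives every later page.
\<close>

locale lifting_mixed_complex = mixed_complex +
  assumes lift: "x \<in> K n \<Longrightarrow> b x = 0 \<Longrightarrow> y \<in> K (n + 2) \<Longrightarrow> B x + b y = 0 \<Longrightarrow>
    \<exists>z. z 0 = x \<and> (\<forall>i::nat. z i \<in> K (n + 2 * int i) \<and> B (z i) + b (z (Suc i)) = 0)"
begin

text \<open>Term \<open>i\<close> of the family given by \<open>lift\<close> goes to column
  \<open>p - i\<close>, and the family is cut off below column 0. For \<open>p = 0\<close> nothing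
  is asked of \<open>B x\<close>, as there is no column for it to land in; this is why column 0
  contributes a cokernel and the other columns contribute de Rham cohomology.\<close>

lemma lift_cycle:
  assumes p: "0 \<le> p" and x: "x \<in> Z (n - 2 * p)" and Bx: "p = 0 \<or> (\<exists>y\<in>K (n - 2 * p + 2). B x + b y = 0)"
  shows "\<exists>z\<in>Fil p n. D z = 0 \<and> z p = x"
proof (cases "p = 0")
  case True
  define z where "z = (\<lambda>q::int. if q = 0 then x else 0)"
  have xn: "x \<in> K n" "b x = 0" using x True by (simp_all add: Z_def)
  have "z \<in> Fil p n" using xn(1) True by (simp add: Fil_def Tot_iff z_def)
  moreover have "D z = 0"
  proof
    fix q
    show "D z q = 0 q" using xn(2) by (simp add: D_def z_def B.zero b.zero)
  qed
  moreover have "z p = x" using True by (simp add: z_def)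
  ultimately show ?thesis by blast
next
  case False
  then obtain y where "y \<in> K (n - 2 * p + 2)" "B x + b y = 0" using Bx by blast
  then obtain c where c: "c 0 = x"
      "\<And>i::nat. c i \<in> K (n - 2 * p + 2 * int i)" "\<And>i. B (c i) + b (c (Suc i)) = 0"
    using lift[of x "n - 2 * p" y] x unfolding Z_def by blast
  define z where "z = (\<lambda>q. if 0 \<le> q \<and> q \<le> p then c (nat (p - q)) else 0)"
  have "c (nat (p - q)) \<in> K (n - 2 * q)" if "q \<le> p" for q
    by (rule K_cong[OF c(2)]) (use that in simp)
  then have "z \<in> Fil p n"
    by (auto simp: z_def Fil_def Tot_iff)
  moreover have "D z = 0"
  proof
    fix q
    show "D z q = 0 q"
    proof (cases "0 \<le> q \<and> q < p")
      case True
      then have "nat (p - q) = Suc (nat (p - (q + 1)))" by auto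
      then have "z q = c (Suc (nat (p - (q + 1))))" "z (q + 1) = c (nat (p - (q + 1)))"
        using True unfolding z_def by simp_all
      then have "D z q = b (c (Suc (nat (p - (q + 1))))) + B (c (nat (p - (q + 1))))"
        using True unfolding D_def by presburger
      then show ?thesis using c(3)[of "nat (p - (q + 1))"] by (metis add.commute zero_fun_apply)
    next
      case False
      then consider "q < 0" | "q = p" | "q > p" by linarith
      then show ?thesis
        by cases (use c(1) x p in \<open>simp_all add: D_def z_def Z_def B.zero b.zero\<close>)
    qed
  qed
  moreover have "z p = x" using p c(1) by (simp add: z_def)
  ultimately show ?thesis by blast
qed

text \<open>Degeneration on the level of chains. Since \<open>D z\<close> vanishes in columns
  \<open>p\<close> and \<open>p - 1\<close>, the entry of \<open>z\<close> in column
  \<open>p\<close> survives to the second page, hence is the leading entry of a total cycle.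
  Subtracting that cycle pushes \<open>z\<close> down by one column and leaves \<open>D z\<close>
  unchanged.\<close>

lemma lower_filtration:
  assumes z: "z \<in> Fil p n" and dz: "D z \<in> Fil (p - 2) (n - 1)"
  shows "\<exists>z'\<in>Fil (p - 1) n. D z' = D z"
proof (cases "0 \<le> p")
  case False
  then have "z = 0" using z Tot_neg[of z n] by (force simp: Fil_def fun_eq_iff)
  then show ?thesis using fs.subspace_0[OF subspace_Fil] by blast
next
  case True
  have z': "z (p + 1) = 0" "z \<in> Tot n" using z by (auto simp: Fil_def)
  have "D z p = 0" using dz by (auto simp: Fil_def)
  then have x: "z p \<in> Z (n - 2 * p)" using z' True Tot_K by (simp add: D_def Z_def B.zero)
  have "\<exists>y\<in>K (n - 2 * p + 2). B (z p) + b y = 0" if "p \<noteq> 0"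
  proof
    have "D z (p - 1) = 0" using dz by (auto simp: Fil_def)
    moreover have "D z (p - 1) = b (z (p - 1)) + B (z p)" using True that by (simp add: D_def)
    ultimately show "B (z p) + b (z (p - 1)) = 0" by (metis add.commute)
    show "z (p - 1) \<in> K (n - 2 * p + 2)"
      by (rule K_cong[OF Tot_K[OF z'(2)]]) (use True that in simp_all)
  qed
  then obtain c where c: "c \<in> Fil p n" "D c = 0" "c p = z p" using lift_cycle[OF True x] by blast
  have "z - c \<in> Fil p n" using fs.subspace_diff[OF subspace_Fil z c(1)] .
  moreover have "(z - c) q = 0" if "q > p - 1" for q
    using that c(3) calculation by (cases "q = p") (auto simp: Fil_def)
  ultimately have "z - c \<in> Fil (p - 1) n" by (simp add: Fil_def)
  moreover have "D (z - c) = D z" using c by (simp add: D.diff)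
  ultimately show ?thesis by blast
qed

lemma Tot_bounded: "z \<in> Tot n \<Longrightarrow> max 0 n \<le> p \<Longrightarrow> z \<in> Fil p n"
  using Tot_large[of z n] by (auto simp: Fil_def)

text \<open>A boundary in step \<open>p\<close> of the filtration may come from a chain that reaches
  far beyond column \<open>p\<close>. Repeated lowering brings that chain down to column
  \<open>p + 1\<close>, where its top entry must be a \<open>b\<close>-cycle; then the leading entry
  of the boundary can be read off.\<close>

lemma boundary_leading_term:
  assumes p: "0 \<le> p" and w: "w \<in> Tot (n + 1)" and z: "D w \<in> Fil p n"
  shows "D w p \<in> dR_boundaries (n - 2 * p)"
proof -
  have "\<exists>w'\<in>Fil (p + 1) (n + 1). D w' = D w" if "w' \<in> Fil (p + 1 + int k) (n + 1)" "D w' = D w" for k w'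
    using that
  proof (induction k arbitrary: w')
    case (Suc k)
    have "D w' \<in> Fil (p + 1 + int (Suc k) - 2) (n + 1 - 1)"
      using z Fil_mono[of p "p + int k" n] Suc.prems by (auto simp: algebra_simps)
    then obtain w'' where "w'' \<in> Fil (p + 1 + int (Suc k) - 1) (n + 1)" "D w'' = D w'"
      using lower_filtration[OF Suc.prems(1)] by blast
    moreover have "p + 1 + int (Suc k) - 1 = p + 1 + int k" by simp
    ultimately show ?case using Suc.IH[of w''] Suc.prems(2) by metis
  qed auto
  \<comment> \<open>Columns beyond the total degree are zero, so every chain lies in some step of
    the filtration and the descent has a starting point.\<close>
  moreover have "w \<in> Fil (p + 1 + int (nat (max 0 (n + 1)))) (n + 1)"
    by (rule Tot_bounded[OF w]) (use p in auto)
  ultimately obtain w' where w': "w' \<in> Fil (p + 1) (n + 1)" "D w' = D w" by blast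
  have tot: "w' \<in> Tot (n + 1)" and 0: "w' (p + 1 + 1) = 0" using w' by (auto simp: Fil_def)
  have "D w' (p + 1) = 0" using z w' by (auto simp: Fil_def)
  then have "b (w' (p + 1)) = 0" using p 0 by (simp add: D_def B.zero)
  moreover have "w' p \<in> K (n - 2 * p + 1)"
    by (rule K_cong[OF Tot_K[OF tot p]]) simp
  moreover have "w' (p + 1) \<in> K (n - 2 * p - 1)"
    by (rule K_cong[OF Tot_K[OF tot]]) (use p in simp_all)
  moreover have "D w p = b (w' p) + B (w' (p + 1))" using w'(2)[symmetric] p by (simp add: D_def)
  ultimately show ?thesis by (auto simp: dR_boundaries_def Z_def)
qed

end

text \<open>A basis of \<open>W\<close> is extended to one of \<open>Y\<close>; the section is
  \<open>0\<close> on the first part and an arbitrary lift on the rest. Killing \<open>W\<close>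
  makes it descend to \<open>Y/W\<close>, at the price that it inverts \<open>\<pi>\<close> only
  modulo \<open>W\<close>.\<close>

lemma (in vector_space_pair) linear_section_mod:
  assumes WY: "vs1.subspace W" "W \<subseteq> Y" "vs1.subspace Y" and G: "vs2.subspace G"
    and \<pi>: "Vector_Spaces.linear s2 s1 \<pi>" and lift: "\<And>y. y \<in> Y \<Longrightarrow> \<exists>z\<in>G. \<pi> z = y"
  shows "\<exists>\<gamma>. Vector_Spaces.linear s1 s2 \<gamma> \<and> (\<forall>y\<in>Y. \<gamma> y \<in> G \<and> \<pi> (\<gamma> y) - y \<in> W) \<and> (\<forall>y\<in>W. \<gamma> y = 0)"
proof -
  interpret \<pi>: Vector_Spaces.linear s2 s1 \<pi> by fact
  obtain S where S: "S \<subseteq> W" "vs1.independent S" "W \<subseteq> vs1.span S" using vs1.maximal_independent_subset by blast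
  have "S \<subseteq> Y" using S WY by blast
  then obtain T where T: "S \<subseteq> T" "T \<subseteq> Y" "vs1.independent T" "Y \<subseteq> vs1.span T"
    using vs1.maximal_independent_subset_extend[OF _ S(2)] by metis
  obtain l where l: "\<And>y. y \<in> Y \<Longrightarrow> l y \<in> G \<and> \<pi> (l y) = y" using lift by metis
  obtain \<gamma> where \<gamma>: "Vector_Spaces.linear s1 s2 \<gamma>" "\<And>y. y \<in> T \<Longrightarrow> \<gamma> y = (if y \<in> S then 0 else l y)"
    using linear_independent_extend[OF T(3), of "\<lambda>y. if y \<in> S then 0 else l y"] by blast
  interpret \<gamma>: Vector_Spaces.linear s1 s2 \<gamma> by fact
  have "\<gamma> y \<in> G \<and> \<pi> (\<gamma> y) - y \<in> W" if "y \<in> vs1.span T" for y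
    using that
  proof (induction rule: vs1.span_induct_alt)
    case base
    show ?case using vs1.subspace_0[OF WY(1)] vs2.subspace_0[OF G] by (simp add: \<gamma>.zero \<pi>.zero)
  next
    case (step c x y)
    have "\<gamma> x \<in> G \<and> \<pi> (\<gamma> x) - x \<in> W"
      using \<gamma>(2)[OF step.hyps] l[of x] T(2) step.hyps S(1) vs1.subspace_0[OF WY(1)]
        vs2.subspace_0[OF G] vs1.subspace_neg[OF WY(1), of x] by (auto simp: \<pi>.zero)
    then have "s2 c (\<gamma> x) + \<gamma> y \<in> G" "s1 c (\<pi> (\<gamma> x) - x) + (\<pi> (\<gamma> y) - y) \<in> W"
      using step.IH vs1.subspace_add[OF WY(1)] vs1.subspace_scale[OF WY(1)] vs2.subspace_add[OF G]
        vs2.subspace_scale[OF G] by auto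
    then show ?case
      by (simp add: \<gamma>.add \<gamma>.scale \<pi>.add \<pi>.scale vs1.scale_right_diff_distrib algebra_simps)
  qed
  moreover have "\<gamma> y = 0" if "y \<in> vs1.span S" for y
    by (rule \<gamma>.eq_0_on_span[OF _ that]) (use \<gamma>(2) T(1) in auto)
  ultimately show ?thesis using \<gamma>(1) S(3) T(4) by blast
qed

text \<open>The interface between the quotients of the definitions and a concrete model: the kernel
  \<open>{0}\<close> says that \<open>f n\<close> identifies \<open>K n\<close> with the chains
  themselves.\<close>

locale presented_mixed_complex = lifting_mixed_complex scl K b B
  for scl :: "'k::field \<Rightarrow> 'c::ab_group_add \<Rightarrow> 'c" and K b B +
  fixes A :: "('k, 'a) module" and E :: "'a set" and f :: "int \<Rightarrow> 'c \<Rightarrow> ('a list \<Rightarrow>\<^sub>0 'k) set"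
  assumes chains: "presents scl (hochschild_chains A E n) (K n) {0} (f n)"
    and f_b: "x \<in> K n \<Longrightarrow> hochschild_b A E n (f n x) = f (n - 1) (b x)"
    and f_B: "x \<in> K n \<Longrightarrow> chain_B A E n (f n x) = f (n + 1) (B x)"
begin

lemma HH_presented:
  "presents scl (HH A E n) (Z n) (b ` K (n + 1))
    (\<lambda>y. f n ` (b ` K (n + 1)) +>\<^bsub>hochschild_chains A E n\<^esub> f n y)"
proof -
  have bK: "b y \<in> K n" if "y \<in> K (n + 1)" for y using b_K[OF that] by simp
  have im: "hochschild_b A E (n + 1) ` carrier (hochschild_chains A E (n + 1)) = f n ` (b ` K (n + 1))"
    unfolding presents_carrier[OF chains, symmetric] image_image by (intro image_cong) (simp_all add: f_b)
  have "presents scl (HH A E n) {y \<in> K n. b y \<in> {0}} {x + b y |x y. x \<in> {0} \<and> y \<in> K (n + 1)}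
    (\<lambda>y. hochschild_b A E (n + 1) ` carrier (hochschild_chains A E (n + 1)) +>\<^bsub>hochschild_chains A E n\<^esub> f n y)"
    unfolding HH_def
    by (rule presents_homology[OF chains chains chains linear_b _ _ linear_b])
      (use bK b_K bb in \<open>auto simp: f_b b.zero\<close>)
  moreover have "{x + b y |x y. x \<in> {0} \<and> y \<in> K (n + 1)} = b ` K (n + 1)" by auto
  ultimately show ?thesis by (simp add: Z_def im)
qed

abbreviation hh :: "int \<Rightarrow> 'c \<Rightarrow> ('a list \<Rightarrow>\<^sub>0 'k) set set" where
  "hh n y \<equiv> f n ` (b ` K (n + 1)) +>\<^bsub>hochschild_chains A E n\<^esub> f n y"

lemma B_bK: assumes "y \<in> b ` K n" shows "B y \<in> b ` K (n + 1)"
proof -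
  obtain k where k: "k \<in> K n" "y = b k" using assms by blast
  then have "B y = b (- B k)" using bB[OF k(1)] by (simp add: b.neg eq_neg_iff_add_eq_0 add.commute)
  then show ?thesis using B_K[OF k(1)] subspace_neg[OF subspace_K] by blast
qed

lemma HH_B_presented:
  assumes y: "y \<in> Z n" shows "HH_B A E n (hh n y) = hh (n + 1) (B y)"
proof -
  have e: "n + 1 + 1 = n + 2" by simp
  have im: "hochschild_b A E (n + 2) ` carrier (hochschild_chains A E (n + 2)) = f (n + 1) ` (b ` K (n + 1 + 1))"
    unfolding presents_carrier[OF chains, symmetric] image_image e
    by (intro image_cong) (auto simp: f_b algebra_simps)
  have bK: "b ` K (n + 1) \<subseteq> K n" "b ` K (n + 1 + 1) \<subseteq> K (n + 1)"
    by (metis add_diff_cancel_right' b_K image_subsetI)+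
  have BbK: "B ` (b ` K (n + 1)) \<subseteq> b ` K (n + 1 + 1)" using B_bK by blast
  show ?thesis
    unfolding HH_B_def im
    by (rule induced_map_presented[OF chains subspace_bK _ bK(1) chains subspace_bK _ bK(2) linear_B])
      (use y B_K f_B BbK subspace_0[OF subspace_bK] in \<open>auto simp: Z_def\<close>)
qed

lemma HH_B_image_sum: "{x + B y |x y. x \<in> b ` K (n + 1) \<and> y \<in> Z (n - 1)} = dR_boundaries n"
  unfolding dR_boundaries_def by blast

lemma HH_B_presented': "y \<in> Z (n - 1) \<Longrightarrow> HH_B A E (n - 1) (hh (n - 1) y) = hh n (B y)"
  using HH_B_presented[of y "n - 1"] by simp

lemma HdR_presented:
  "\<exists>h. presents scl (HdR A E n) (dR_cycles n) (dR_boundaries n) h"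
proof -
  have Z: "{y \<in> Z n. B y \<in> b ` K (n + 1 + 1)} = dR_cycles n"
    by (simp add: dR_cycles_def add.assoc)
  have "presents scl (HdR A E n) {y \<in> Z n. B y \<in> b ` K (n + 1 + 1)}
      {x + B y |x y. x \<in> b ` K (n + 1) \<and> y \<in> Z (n - 1)}
      (\<lambda>y. HH_B A E (n - 1) ` carrier (HH A E (n - 1)) +>\<^bsub>HH A E n\<^esub> hh n y)"
    unfolding HdR_def
  proof (rule presents_homology[OF HH_presented HH_presented HH_presented linear_B _ _ linear_B])
    show "B ` Z (n - 1) \<subseteq> Z n" using B_Z[of _ "n - 1"] by auto
    show "B ` Z n \<subseteq> Z (n + 1)" using B_Z by auto
    show "HH_B A E (n - 1) (hh (n - 1) y) = hh n (B y)" if "y \<in> Z (n - 1)" for y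
      using HH_B_presented'[OF that] .
    show "HH_B A E n (hh n y) = hh (n + 1) (B y)" if "y \<in> Z n" for y
      using HH_B_presented[OF that] .
    show "B (B y) \<in> b ` K (n + 1 + 1)" if "y \<in> Z (n - 1)" for y
      using BB[of y] that subspace_0[OF subspace_bK] by (auto simp: Z_def)
    show "B y \<in> b ` K (n + 1 + 1)" if "y \<in> b ` K (n + 1)" for y
      using B_bK[OF that] .
  qed
  then show ?thesis unfolding Z HH_B_image_sum by blast
qed

text \<open>The denominator is that of \<open>HdR\<close>, but the numerator consists of all cycles.
  This is the contribution of column 0, out of which no \<open>B\<close> leads.\<close>

lemma cokernel_presented:
  "\<exists>h. presents scl (cokernel (HH A E (n - 1)) (HH A E n) (HH_B A E (n - 1))) (Z n) (dR_boundaries n) h"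
proof -
  have "presents scl (cokernel (HH A E (n - 1)) (HH A E n) (HH_B A E (n - 1))) (Z n)
      {x + B y |x y. x \<in> b ` K (n + 1) \<and> y \<in> Z (n - 1)}
      (\<lambda>y. HH_B A E (n - 1) ` carrier (HH A E (n - 1)) +>\<^bsub>HH A E n\<^esub> hh n y)"
    by (rule presents_cokernel[OF HH_presented HH_presented linear_B])
      (use B_Z[of _ "n - 1"] HH_B_presented' in auto)
  then show ?thesis unfolding HH_B_image_sum by blast
qed

text \<open>The degree is spelled \<open>n - p - p\<close> because \<open>bicomplex\<close> computes
  it as \<open>q - p\<close> at \<open>q = n - p\<close>.\<close>

definition g :: "int \<Rightarrow> (int \<Rightarrow> 'c) \<Rightarrow> int \<Rightarrow> ('a list \<Rightarrow>\<^sub>0 'k) set" where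
  "g n z = (\<lambda>p. f (n - p - p) (z p))"

lemma f_zero: "f n 0 = \<zero>\<^bsub>hochschild_chains A E n\<^esub>"
  by (rule presents_zero[OF chains])

text \<open>On the side of the model the bound \<open>p \<le> q\<close> is automatic, as
  \<open>K\<close> vanishes in negative degrees.\<close>

lemma bicomplex_presented:
  "presents scl (bicomplex A E p q) (if 0 \<le> p then K (q - p) else {0}) {0} (f (q - p))"
proof (cases "0 \<le> p \<and> p \<le> q")
  case True then show ?thesis by (simp add: bicomplex_def chains)
next
  case False
  then have "(if 0 \<le> p then K (q - p) else {0}) = {0}" using K_neg[of "q - p"] by auto
  moreover have "presents scl ((hochschild_chains A E (q - p))\<lparr>carrier := {\<zero>\<^bsub>hochschild_chains A E (q - p)\<^esub>}\<rparr>) {0} {0} (f (q - p))"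
    by (rule presents_restrict[OF chains]) (auto simp: f_zero)
  ultimately show ?thesis using False by (auto simp: bicomplex_def)
qed

lemma zero_bicomplex: "\<zero>\<^bsub>bicomplex A E p q\<^esub> = f (q - p) 0"
  by (simp add: bicomplex_def f_zero)

lemma add_bicomplex: "x \<oplus>\<^bsub>bicomplex A E p q\<^esub> y = x \<oplus>\<^bsub>hochschild_chains A E (q - p)\<^esub> y"
  by (simp add: bicomplex_def)

lemma total_presented: "presents (fun_scale scl) (total A E n) (Tot n) {0} (g n)"
proof -
  have e: "n - p - p = n - 2 * p" for p :: int by simp
  have "finite {p. z p \<noteq> 0}" if z: "z \<in> Tot n" for z
  proof (rule finite_subset)
    show "{p. z p \<noteq> 0} \<subseteq> {0..n}" using Tot_large[OF z] Tot_neg[OF z] by (smt (verit) atLeastAtMost_iff mem_Collect_eq subsetI)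
  qed simp
  then have Y: "{z. (\<forall>p\<in>UNIV. z p \<in> (if 0 \<le> p then K (n - p - p) else {0})) \<and>
      (\<forall>p. p \<notin> UNIV \<longrightarrow> z p = 0) \<and> finite {p \<in> UNIV. z p \<notin> {0}}} = Tot n"
    by (auto simp: Tot_iff e split: if_splits)
  have W: "{z. (\<forall>p\<in>UNIV. z p \<in> {0}) \<and> (\<forall>p. p \<notin> UNIV \<longrightarrow> z p = 0)} = {0 :: int \<Rightarrow> 'c}"
    by (auto simp: fun_eq_iff)
  have "presents (fun_scale scl) (total A E n)
    {z. (\<forall>p\<in>UNIV. z p \<in> (if 0 \<le> p then K (n - p - p) else {0})) \<and>
      (\<forall>p. p \<notin> UNIV \<longrightarrow> z p = 0) \<and> finite {p \<in> UNIV. z p \<notin> {0}}}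
    {z. (\<forall>p\<in>UNIV. z p \<in> {0}) \<and> (\<forall>p. p \<notin> UNIV \<longrightarrow> z p = 0)} (\<lambda>z. \<lambda>p\<in>UNIV. f (n - p - p) (z p))"
    unfolding total_def
    by (rule presents_direct_sum[OF vector_space_axioms bicomplex_presented])
  then show ?thesis unfolding Y W by (simp add: g_def[abs_def] restrict_UNIV)
qed

text \<open>Outside their ranges \<open>bicomplex_b\<close> and \<open>bicomplex_B\<close> return
  zero by definition; there the operators of the model vanish too, by degree or by the guard in
  \<open>D\<close>.\<close>

lemma total_d_presented:
  assumes z: "z \<in> Tot n" shows "total_d A E n (g n z) = g (n - 1) (D z)"
proof
  fix p
  have zK: "z q \<in> K (n - q - q)" for q
    using Tot_K[OF z, of q] Tot_neg[OF z, of q] by (cases "0 \<le> q") (auto simp: algebra_simps)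
  have "bicomplex_b A E p (n - p) (g n z p) = f (n - 1 - p - p) (if 0 \<le> p then b (z p) else 0)"
  proof (cases "0 \<le> p \<and> p \<le> n - p - 1")
    case True
    then show ?thesis using f_b[OF zK[of p]] by (simp add: bicomplex_b_def g_def algebra_simps)
  next
    case False
    have "b (z p) = 0" if "0 \<le> p"
      using b_K[OF zK[of p]] K_neg[of "n - p - p - 1"] False that by simp
    then show ?thesis using False by (auto simp: bicomplex_b_def zero_bicomplex algebra_simps)
  qed
  moreover have "bicomplex_B A E (p + 1) (n - (p + 1)) (g n z (p + 1)) = f (n - 1 - p - p) (if 0 \<le> p then B (z (p + 1)) else 0)"
  proof (cases "0 \<le> p \<and> p + 1 \<le> n - (p + 1)")
    case True
    then show ?thesis using f_B[OF zK[of "p + 1"]] by (simp add: bicomplex_B_def g_def algebra_simps)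
  next
    case False
    have "B (z (p + 1)) = 0" if "0 \<le> p"
      using Tot_large[OF z, of "p + 1"] False that by (simp add: B.zero)
    then show ?thesis using False by (auto simp: bicomplex_B_def zero_bicomplex algebra_simps)
  qed
  moreover have "(if 0 \<le> p then b (z p) else 0) \<in> K (n - 1 - p - p)"
    using b_K[OF zK[of p]] by (auto simp: algebra_simps)
  moreover have "(if 0 \<le> p then B (z (p + 1)) else 0) \<in> K (n - 1 - p - p)"
    using B_K[OF zK[of "p + 1"]] by (auto simp: algebra_simps)
  moreover have "(if 0 \<le> p then b (z p) else 0) + (if 0 \<le> p then B (z (p + 1)) else 0) = D z p"
    by (simp add: D_def)
  ultimately show "total_d A E n (g n z) p = g (n - 1) (D z) p"
    unfolding total_d_def add_bicomplex
    using presents_add[OF chains, of "if 0 \<le> p then b (z p) else 0" "n - 1 - p - p"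
      "if 0 \<le> p then B (z (p + 1)) else 0"]
    by (simp add: g_def)
qed

lemma HC_presented:
  "\<exists>h. presents (fun_scale scl) (HC A E n) {z \<in> Tot n. D z = 0} (D ` Tot (n + 1)) h"
proof -
  have e: "n + 1 - 1 = n" by simp
  have "presents (fun_scale scl) (HC A E n) {z \<in> Tot n. D z \<in> {0}} {x + D y |x y. x \<in> {0} \<and> y \<in> Tot (n + 1)}
    (\<lambda>y. total_d A E (n + 1) ` carrier (total A E (n + 1)) +>\<^bsub>total A E n\<^esub> g n y)"
    unfolding HC_def
    by (rule presents_homology[OF total_presented total_presented total_presented linear_D _ _ linear_D])
      (use D_Tot[of _ "n + 1"] D_Tot[of _ n] DD total_d_presented[of _ "n + 1"] total_d_presented[of _ n] in
        \<open>auto simp: D.zero\<close>)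
  moreover have "{x + D y |x y. x \<in> {0} \<and> y \<in> Tot (n + 1)} = D ` Tot (n + 1)" by auto
  ultimately show ?thesis by auto
qed

lemma sum_fun_apply: "(\<Sum>i\<in>I. F i) x = (\<Sum>i\<in>I. (F i x :: 'd::comm_monoid_add))"
  by (induction I rule: infinite_finite_induct) auto

lemma boundaries_cycles: "dR_boundaries n \<subseteq> dR_cycles n"
proof
  fix x assume "x \<in> dR_boundaries n"
  then obtain u v where x: "x = b u + B v" "u \<in> K (n + 1)" "v \<in> Z (n - 1)" by (auto simp: dR_boundaries_def)
  have "x \<in> Z n" using bK_Z[of n] x B_Z[of v "n - 1"] subspace_add[OF subspace_Z] by auto
  moreover have "B x = B (b u)" using x BB[of v "n - 1"] by (simp add: B.add Z_def)
  ultimately show "x \<in> dR_cycles n"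
    using B_bK[of "b u" "n + 1"] x(2) by (simp add: dR_cycles_def add.assoc)
qed

lemma subspace_dR_cycles: "subspace (dR_cycles n)"
  using subspace_Z[of n] subspace_bK[of "n + 2"]
  by (intro subspaceI) (auto simp: dR_cycles_def B.zero B.add B.scale subspace_0 subspace_add subspace_scale)

lemma subspace_dR_boundaries: "subspace (dR_boundaries n)"
proof -
  have "subspace {x + B y |x y. x \<in> b ` K (n + 1) \<and> y \<in> Z (n - 1)}"
    by (rule subspace_image_sum[OF linear_B subspace_Z subspace_bK])
  then show ?thesis by (simp add: HH_B_image_sum)
qed

text \<open>Converse of \<open>boundary_leading_term\<close>: with \<open>u\<close> in column
  \<open>p\<close> and the cycle \<open>v\<close> in column \<open>p + 1\<close>, the boundary has
  nothing beyond column \<open>p\<close>.\<close>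

lemma boundary_in_filtration:
  assumes "0 \<le> p" "x \<in> dR_boundaries (n - 2 * p)"
  shows "\<exists>w\<in>Tot (n + 1). D w \<in> Fil p n \<and> D w p = x"
proof -
  obtain u v where x: "x = b u + B v" "u \<in> K (n - 2 * p + 1)" "v \<in> Z (n - 2 * p - 1)"
    using assms by (auto simp: dR_boundaries_def)
  define w where "w = (\<lambda>q. if q = p then u else if q = p + 1 then v else 0)"
  have "u \<in> K (n + 1 - 2 * p)" by (rule K_cong[OF x(2)]) simp
  moreover have "v \<in> K (n + 1 - 2 * (p + 1))" by (rule K_cong[of _ "n - 2 * p - 1"]) (use x(3) in \<open>simp_all add: Z_def\<close>)
  ultimately have w: "w \<in> Tot (n + 1)" using assms(1) by (simp add: Tot_iff w_def)
  have "D w q = 0" if "q > p" for q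
    using that x(3) by (simp add: D_def w_def Z_def b.zero B.zero)
  then have "D w \<in> Fil p n" using D_Tot[OF w] by (simp add: Fil_def)
  moreover have "D w p = x" using assms(1) x(1) by (simp add: D_def w_def)
  ultimately show ?thesis using w by blast
qed

text \<open>A total cycle is peeled off column by column. Its leading entry, if in column
  \<open>p\<close>, lies in \<open>Yp p\<close> and matters only modulo \<open>Wp p\<close>. The
  maps \<open>\<gamma> p\<close> lift such entries linearly to total cycles, and their sum
  \<open>\<Theta>\<close> induces the isomorphism.\<close>

theorem HC_decomposition:
  assumes m: "0 \<le> m"
  shows "HC A E m \<cong>\<^sub>v direct_sum2 (cokernel (HH A E (m - 1)) (HH A E m) (HH_B A E (m - 1)))
    (direct_sum {1..} (\<lambda>i::int. HdR A E (m - 2 * i)))"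
proof -
  define Yp where "Yp p = (if p = 0 then Z m else dR_cycles (m - 2 * p))" for p :: int
  define Wp where "Wp p = dR_boundaries (m - 2 * p)" for p :: int
  interpret vp: vector_space_pair scl "fun_scale scl" by unfold_locales
  have cyc: "x \<in> Z (m - 2 * p)" if "x \<in> Yp p" for x p
    using that by (auto simp: Yp_def dR_cycles_def split: if_splits)
  have "\<exists>\<gamma>. Vector_Spaces.linear scl (fun_scale scl) \<gamma> \<and>
      (\<forall>y\<in>Yp p. \<gamma> y \<in> {z \<in> Fil p m. D z = 0} \<and> \<gamma> y p - y \<in> Wp p) \<and> (\<forall>y\<in>Wp p. \<gamma> y = 0)" if p: "0 \<le> p" for p
  proof (rule vp.linear_section_mod[where \<pi> = "\<lambda>z. z p"])
    show "subspace (Wp p)" using subspace_dR_boundaries by (simp add: Wp_def)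
    show "Wp p \<subseteq> Yp p" using boundaries_cycles[of "m - 2 * p"] by (auto simp: Wp_def Yp_def dR_cycles_def)
    show "subspace (Yp p)" using subspace_Z subspace_dR_cycles by (simp add: Yp_def)
    show "fs.subspace {z \<in> Fil p m. D z = 0}"
      using subspace_Fil[of p m] by (intro fs.subspaceI)
        (auto simp: fs.subspace_0 fs.subspace_add fs.subspace_scale D.add D.scale D.zero)
    show "Vector_Spaces.linear (fun_scale scl) scl (\<lambda>z. z p)"
      by unfold_locales (auto simp: fun_scale_def)
    fix y assume y: "y \<in> Yp p"
    have "\<exists>y'\<in>K (m - 2 * p + 2). B y + b y' = 0" if p0: "p \<noteq> 0"
    proof -
      obtain k where "k \<in> K (m - 2 * p + 2)" "B y = b k" using y p0 by (auto simp: Yp_def dR_cycles_def)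
      then show ?thesis using subspace_neg[OF subspace_K] by (intro bexI[of _ "- k"]) (auto simp: b.neg)
    qed
    then obtain z where "z \<in> Fil p m" "D z = 0" "z p = y" using lift_cycle[OF p cyc[OF y]] by blast
    then show "\<exists>z\<in>{z \<in> Fil p m. D z = 0}. z p = y" by blast
  qed
  then have "\<forall>p\<in>{0..}. \<exists>\<gamma>. Vector_Spaces.linear scl (fun_scale scl) \<gamma> \<and>
      (\<forall>y\<in>Yp p. \<gamma> y \<in> {z \<in> Fil p m. D z = 0} \<and> \<gamma> y p - y \<in> Wp p) \<and> (\<forall>y\<in>Wp p. \<gamma> y = 0)" by simp
  from bchoice[OF this] obtain \<gamma> where \<gamma>0: "\<forall>p\<in>{0..}. Vector_Spaces.linear scl (fun_scale scl) (\<gamma> p) \<and>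
      (\<forall>y\<in>Yp p. \<gamma> p y \<in> {z \<in> Fil p m. D z = 0} \<and> \<gamma> p y p - y \<in> Wp p) \<and> (\<forall>y\<in>Wp p. \<gamma> p y = 0)"
    by blast
  have \<gamma>: "\<And>p. 0 \<le> p \<Longrightarrow> Vector_Spaces.linear scl (fun_scale scl) (\<gamma> p)"
    "\<And>p y. 0 \<le> p \<Longrightarrow> y \<in> Yp p \<Longrightarrow> \<gamma> p y \<in> Fil p m" "\<And>p y. 0 \<le> p \<Longrightarrow> y \<in> Yp p \<Longrightarrow> D (\<gamma> p y) = 0"
    "\<And>p y. 0 \<le> p \<Longrightarrow> y \<in> Yp p \<Longrightarrow> \<gamma> p y p - y \<in> Wp p" "\<And>p y. 0 \<le> p \<Longrightarrow> y \<in> Wp p \<Longrightarrow> \<gamma> p y = 0"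
    using \<gamma>0 by simp_all
  \<comment> \<open>A column \<open>p > m\<close> has chains of degree \<open>m - 2 * p < 0\<close>,
    so the finite range loses nothing.\<close>
  define \<Theta> where "\<Theta> y = (\<Sum>p\<in>{0..m}. \<gamma> p (y p))" for y
  define join where "join w = (\<lambda>p. if p = 0 then fst w else snd w p)" for w :: "'c \<times> (int \<Rightarrow> 'c)"
  have \<gamma>_add: "\<gamma> p (x + y) = \<gamma> p x + \<gamma> p y" and \<gamma>_scale: "\<gamma> p (scl c x) = fun_scale scl c (\<gamma> p x)"
    if "0 \<le> p" for p x y c
  proof -
    interpret l: Vector_Spaces.linear scl "fun_scale scl" "\<gamma> p" using \<gamma>(1) that .
    show "\<gamma> p (x + y) = \<gamma> p x + \<gamma> p y" "\<gamma> p (scl c x) = fun_scale scl c (\<gamma> p x)" by (rule l.add, rule l.scale)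
  qed
  have \<Theta>_add: "\<Theta> (\<lambda>p. y p + y' p) = \<Theta> y + \<Theta> y'" for y y'
    unfolding \<Theta>_def sum.distrib[symmetric]
    by (rule sum.cong) (auto simp: \<gamma>_add)
  have \<Theta>_scale: "\<Theta> (\<lambda>p. scl c (y p)) = fun_scale scl c (\<Theta> y)" for c y
    unfolding \<Theta>_def fs.scale_sum_right
    by (rule sum.cong) (auto simp: \<gamma>_scale)
  have \<Theta>_cycle: "\<Theta> y \<in> {z \<in> Tot m. D z = 0}" if "\<And>p. p \<in> {0..m} \<Longrightarrow> y p \<in> Yp p" for y
  proof -
    have "\<Theta> y \<in> Tot m" unfolding \<Theta>_def
      by (rule fs.subspace_sum[OF subspace_Tot]) (use that \<gamma>(2)[THEN Fil_Tot] in auto)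
    moreover have "D (\<Theta> y) = 0" unfolding \<Theta>_def D.sum
      by (rule sum.neutral) (use that \<gamma>(3) in auto)
    ultimately show ?thesis by simp
  qed
  have sub_W: "subspace (Wp p)" for p using subspace_dR_boundaries by (simp add: Wp_def)
  have inj: "y p \<in> Wp p"
    if y: "\<And>p. p \<in> {0..m} \<Longrightarrow> y p \<in> Yp p" and w: "w \<in> Tot (m + 1)" "\<Theta> y = D w" and p: "p \<in> {0..m}" for y w p
  proof (rule ccontr)
    assume "y p \<notin> Wp p"
    \<comment> \<open>At the largest index \<open>P\<close> whose coordinate is no boundary,
      \<open>D w\<close> can be read off: the higher summands vanish because \<open>\<gamma>\<close>
      kills \<open>Wp\<close>, and the lower ones do not reach column \<open>P\<close>.\<close>
    define S where "S = {p \<in> {0..m}. y p \<notin> Wp p}"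
    have "finite S" by (rule finite_subset[of _ "{0..m}"]) (auto simp: S_def)
    moreover have "S \<noteq> {}" using p \<open>y p \<notin> Wp p\<close> by (auto simp: S_def)
    ultimately have S: "finite S" "S \<noteq> {}" by blast+
    define P where "P = Max S"
    have P: "P \<in> {0..m}" "y P \<notin> Wp P" using Max_in[OF S] by (auto simp: P_def S_def)
    have zero: "\<gamma> q (y q) = 0" if "q \<in> {0..m}" "q > P" for q
    proof -
      have "q \<notin> S" using Max_ge[OF S(1), of q] that(2) by (auto simp: P_def)
      then show ?thesis using that \<gamma>(5)[of q] by (auto simp: S_def)
    qed
    have vanish: "\<gamma> q (y q) r = 0" if "q \<in> {0..m}" "r \<ge> P" "r \<noteq> P \<or> q \<noteq> P" for q r
      using zero[OF that(1)] \<gamma>(2)[of q "y q"] y[OF that(1)] that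
      by (cases "q > P") (auto simp: Fil_def)
    have "D w r = 0" if "r > P" for r
      unfolding w(2)[symmetric] \<Theta>_def sum_fun_apply by (rule sum.neutral) (use vanish that in auto)
    then have "D w \<in> Fil P m" using D_Tot[OF w(1)] by (simp add: Fil_def)
    then have "D w P \<in> Wp P"
      unfolding Wp_def using boundary_leading_term[OF _ w(1)] P by auto
    moreover have "D w P = \<gamma> P (y P) P"
    proof -
      have "D w P = (\<Sum>q\<in>{0..m}. if q = P then \<gamma> P (y P) P else 0)"
        unfolding w(2)[symmetric] \<Theta>_def sum_fun_apply by (rule sum.cong) (use vanish in auto)
      then show ?thesis using P(1) by simp
    qed
    ultimately have "\<gamma> P (y P) P \<in> Wp P" by simp
    moreover have "\<gamma> P (y P) P - y P \<in> Wp P" using \<gamma>(4)[of P "y P"] y P by auto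
    ultimately have "\<gamma> P (y P) P - (\<gamma> P (y P) P - y P) \<in> Wp P" by (rule subspace_diff[OF sub_W])
    then show False using P(2) by simp
  qed
  \<comment> \<open>The shift by one lets the induction start at \<open>Fil (- 1) m\<close>, which
    is zero.\<close>
  have surj: "\<exists>y. (\<forall>p\<in>{0..m}. y p \<in> Yp p) \<and> z - \<Theta> y \<in> D ` Tot (m + 1)"
    if "z \<in> Fil (int k - 1) m" "D z = 0" "int k - 1 \<le> m" for k z
    using that
  proof (induction k arbitrary: z)
    case 0
    then have "z = 0" using Tot_neg[of z m] by (force simp: Fil_def fun_eq_iff)
    moreover have "\<Theta> (\<lambda>_. 0) = 0"
      unfolding \<Theta>_def by (rule sum.neutral) (use \<gamma>(5) subspace_0[OF sub_W] in auto)
    ultimately have "z - \<Theta> (\<lambda>_. 0) = D 0" unfolding D.zero by (metis diff_self)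
    moreover have "0 \<in> Yp p" for p
      using subspace_0[OF subspace_Z] subspace_0[OF subspace_dR_cycles] by (simp add: Yp_def)
    ultimately show ?case using fs.subspace_0[OF subspace_Tot]
      by (intro exI[of _ "\<lambda>_. 0"]) blast
  next
    case (Suc k)
    then have zk: "z \<in> Fil (int k) m" and km: "int k \<le> m" by simp_all
    have z': "z (int k + 1) = 0" "z \<in> Tot m" using zk by (auto simp: Fil_def)
    have "D z (int k) = 0" using Suc.prems by simp
    then have "b (z (int k)) = 0" using z' by (simp add: D_def B.zero)
    then have xZ: "z (int k) \<in> Z (m - 2 * int k)" using Tot_K[OF z'(2)] by (simp add: Z_def)
    have xY: "z (int k) \<in> Yp (int k)"
    proof (cases "k = 0")
      case False
      have "D z (int k - 1) = 0" using Suc.prems by simp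
      then have "B (z (int k)) + b (z (int k - 1)) = 0" using False by (simp add: D_def add.commute)
      then have "B (z (int k)) = b (- z (int k - 1))" by (simp add: b.neg eq_neg_iff_add_eq_0)
      moreover have "z (int k - 1) \<in> K (m - 2 * int k + 2)"
        by (rule K_cong[OF Tot_K[OF z'(2)]]) (use False in simp_all)
      ultimately show ?thesis using False xZ subspace_neg[OF subspace_K] by (auto simp: Yp_def dR_cycles_def)
    qed (use xZ in \<open>simp add: Yp_def\<close>)
    define c where "c = \<gamma> (int k) (z (int k))"
    have c: "c \<in> Fil (int k) m" "D c = 0" "c (int k) - z (int k) \<in> Wp (int k)"
      using \<gamma>(2-4)[of "int k"] xY by (auto simp: c_def)
    \<comment> \<open>\<open>c\<close> matches the leading entry of \<open>z\<close> only modulo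
      \<open>Wp\<close>; the defect is removed by a total boundary that has it as its leading
      entry.\<close>
    obtain w where w: "w \<in> Tot (m + 1)" "D w \<in> Fil (int k) m" "D w (int k) = c (int k) - z (int k)"
      using boundary_in_filtration[of "int k" _ m] c(3) by (auto simp: Wp_def)
    define z1 where "z1 = z - c + D w"
    have "z1 \<in> Fil (int k) m"
      unfolding z1_def using fs.subspace_add[OF subspace_Fil fs.subspace_diff[OF subspace_Fil zk c(1)] w(2)] .
    moreover have "z1 q = 0" if "q > int k - 1" for q
      using that w(3) calculation by (cases "q = int k") (auto simp: z1_def Fil_def)
    ultimately have "z1 \<in> Fil (int k - 1) m" by (simp add: Fil_def)
    moreover have "D z1 = 0" unfolding z1_def D.add D.diff DD[OF w(1)] c(2) Suc.prems(2) by simp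
    moreover have "int k - 1 \<le> m" using km by simp
    ultimately obtain y where y0: "\<forall>p\<in>{0..m}. y p \<in> Yp p" and y2: "z1 - \<Theta> y \<in> D ` Tot (m + 1)"
      using Suc.IH by blast
    note y = bspec[OF y0] y2
    define y' where "y' = (\<lambda>p. if p = int k then z (int k) else 0)"
    have sub_Y: "subspace (Yp p)" for p using subspace_Z subspace_dR_cycles by (simp add: Yp_def)
    have "\<Theta> y' = (\<Sum>p\<in>{0..m}. if p = int k then c else 0)"
      unfolding \<Theta>_def by (rule sum.cong) (use \<gamma>(5) subspace_0[OF sub_W] in \<open>auto simp: y'_def c_def\<close>)
    then have "\<Theta> y' = c" using km by simp
    then have "z - \<Theta> (\<lambda>p. y p + y' p) = (z1 - \<Theta> y) - D w" unfolding \<Theta>_add z1_def by simp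
    also have "\<dots> \<in> D ` Tot (m + 1)"
      using fs.subspace_diff[OF D.subspace_image[OF subspace_Tot] y(2)] w(1) by blast
    finally have "z - \<Theta> (\<lambda>p. y p + y' p) \<in> D ` Tot (m + 1)" .
    moreover have "y p + y' p \<in> Yp p" if "p \<in> {0..m}" for p
      using y(1)[OF that] xY subspace_add[OF sub_Y] by (auto simp: y'_def)
    ultimately show ?case by (intro exI[of _ "\<lambda>p. y p + y' p"]) blast
  qed
  obtain h where h: "presents (fun_scale scl) (HC A E m) {z \<in> Tot m. D z = 0} (D ` Tot (m + 1)) h"
    using HC_presented by blast
  obtain h0 where h0: "presents scl (cokernel (HH A E (m - 1)) (HH A E m) (HH_B A E (m - 1))) (Z m) (dR_boundaries m) h0"
    using cokernel_presented by blast
  obtain h1 where h1: "\<And>i. presents scl (HdR A E i) (dR_cycles i) (dR_boundaries i) (h1 i)"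
    using HdR_presented by metis
  \<comment> \<open>The direct sum runs over all \<open>i \<ge> 1\<close>, while
    \<open>\<Theta>\<close> sees only \<open>i \<le> m\<close>; the remaining summands are zero for
    reasons of degree.\<close>
  have K0: "x = 0" if "x \<in> dR_cycles (m - 2 * i)" "m < i" for x i
  proof -
    have "x \<in> K (m - 2 * i)" using that by (simp add: dR_cycles_def Z_def)
    then show ?thesis using K_neg[of "m - 2 * i"] that m by auto
  qed
  note sum = presents_direct_sum2[OF h0 presents_direct_sum[of scl "{1..}" "\<lambda>i. HdR A E (m - 2 * i)"
      "\<lambda>i. dR_cycles (m - 2 * i)" "\<lambda>i. dR_boundaries (m - 2 * i)" "\<lambda>i. h1 (m - 2 * i)", OF vector_space_axioms h1]]
  show ?thesis
  proof (rule presents_isomorphic[OF h sum, where \<theta> = "\<lambda>w. \<Theta> (join w)"])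
    interpret pv: vector_space "prod_scale scl (fun_scale scl)" by (rule vector_space_prod) unfold_locales
    have "join (v + w) = (\<lambda>p. join v p + join w p)" "join (prod_scale scl (fun_scale scl) c w) = (\<lambda>p. scl c (join w p))"
      for v w c by (auto simp: join_def prod_scale_def fun_scale_def fun_eq_iff)
    then show "Vector_Spaces.linear (prod_scale scl (fun_scale scl)) (fun_scale scl) (\<lambda>w. \<Theta> (join w))"
      by unfold_locales (auto simp: \<Theta>_add \<Theta>_scale)
  next
    fix w assume w: "w \<in> Z m \<times> {z. (\<forall>i\<in>{1..}. z i \<in> dR_cycles (m - 2 * i)) \<and> (\<forall>i. i \<notin> {1..} \<longrightarrow> z i = 0) \<and>
        finite {i \<in> {1..}. z i \<notin> dR_boundaries (m - 2 * i)}}"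
    have Y: "join w p \<in> Yp p" if "p \<in> {0..m}" for p using w that by (auto simp: join_def Yp_def)
    show "\<Theta> (join w) \<in> D ` Tot (m + 1) \<longleftrightarrow> w \<in> dR_boundaries m \<times>
        {z. (\<forall>i\<in>{1..}. z i \<in> dR_boundaries (m - 2 * i)) \<and> (\<forall>i. i \<notin> {1..} \<longrightarrow> z i = 0)}" (is "?l \<longleftrightarrow> ?r")
    proof
      assume ?l
      then have W: "join w p \<in> Wp p" if "p \<in> {0..m}" for p using inj[OF Y _ _ that] by blast
      have "snd w i \<in> dR_boundaries (m - 2 * i)" if "1 \<le> i" for i
      proof (cases "i \<le> m")
        case True
        then show ?thesis using W[of i] that by (auto simp: join_def Wp_def)
      next
        case False
        have "snd w i = 0" by (rule K0) (use w that False in auto)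
        then show ?thesis using subspace_0[OF subspace_dR_boundaries] by simp
      qed
      moreover have "fst w \<in> dR_boundaries m" using W[of 0] m by (simp add: join_def Wp_def)
      ultimately show ?r using w by (cases w) auto
    next
      assume ?r
      then have "join w p \<in> Wp p" if "p \<in> {0..m}" for p using that by (auto simp: join_def Wp_def)
      then have "\<Theta> (join w) = 0" unfolding \<Theta>_def by (intro sum.neutral) (use \<gamma>(5) in auto)
      then show ?l using fs.subspace_0[OF subspace_Tot] D.zero by force
    qed
  next
    show "(\<lambda>w. \<Theta> (join w)) ` (Z m \<times> {z. (\<forall>i\<in>{1..}. z i \<in> dR_cycles (m - 2 * i)) \<and> (\<forall>i. i \<notin> {1..} \<longrightarrow> z i = 0) \<and>
        finite {i \<in> {1..}. z i \<notin> dR_boundaries (m - 2 * i)}}) \<subseteq> {z \<in> Tot m. D z = 0}"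
      by (rule image_subsetI, rule \<Theta>_cycle) (auto simp: join_def Yp_def)
  next
    fix z assume "z \<in> {z \<in> Tot m. D z = 0}"
    then have "z \<in> Fil (int (nat (m + 1)) - 1) m" "D z = 0" using m Tot_bounded[of z m m] by auto
    moreover have "int (nat (m + 1)) - 1 \<le> m" using m by simp
    ultimately obtain y where y0: "\<forall>p\<in>{0..m}. y p \<in> Yp p" and y2: "z - \<Theta> y \<in> D ` Tot (m + 1)"
      using surj by blast
    note y = bspec[OF y0] y2
    define w where "w = (y 0, \<lambda>i. if i \<in> {1..m} then y i else 0)"
    have "\<Theta> (join w) = \<Theta> y" unfolding \<Theta>_def by (rule sum.cong) (auto simp: join_def w_def)
    moreover have "y 0 \<in> Z m" using y(1)[of 0] m by (simp add: Yp_def)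
    moreover have "y i \<in> dR_cycles (m - 2 * i)" if "1 \<le> i" "i \<le> m" for i
      using y(1)[of i] that by (auto simp: Yp_def)
    moreover have "finite {i \<in> {1..}. snd w i \<notin> dR_boundaries (m - 2 * i)}"
      by (rule finite_subset[of _ "{1..m}"]) (auto simp: w_def subspace_0[OF subspace_dR_boundaries])
    ultimately show "\<exists>w\<in>Z m \<times> {z. (\<forall>i\<in>{1..}. z i \<in> dR_cycles (m - 2 * i)) \<and> (\<forall>i. i \<notin> {1..} \<longrightarrow> z i = 0) \<and>
        finite {i \<in> {1..}. z i \<notin> dR_boundaries (m - 2 * i)}}. z - \<Theta> (join w) \<in> D ` Tot (m + 1)"
      using y(2) by (intro bexI[of _ w]) (auto simp: w_def subspace_0[OF subspace_dR_cycles])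
  qed
qed

section \<open>Pages and differentials of the column filtration\<close>

definition ZZ :: "int \<Rightarrow> int \<Rightarrow> int \<Rightarrow> (int \<Rightarrow> 'c) set" where
  "ZZ r p n = {z \<in> Fil p n. D z \<in> Fil (p - r) (n - 1)}"

definition BZ :: "int \<Rightarrow> int \<Rightarrow> int \<Rightarrow> (int \<Rightarrow> 'c) set" where
  "BZ r p n = {a + D w |a w. a \<in> ZZ (r - 1) (p - 1) n \<and> w \<in> ZZ (r - 1) (p + r - 1) (n + 1)}"

lemma g_inj: "x \<in> Tot n \<Longrightarrow> y \<in> Tot n \<Longrightarrow> g n x = g n y \<longleftrightarrow> x = y"
  using presents_eq_iff[OF total_presented] by simp

lemma column_filtration_presented: "column_filtration A E p n = g n ` Fil p n"
proof -
  have eq: "(\<forall>p'>p. g n z p' = \<zero>\<^bsub>bicomplex A E p' (n - p')\<^esub>) \<longleftrightarrow> (\<forall>p'>p. z p' = 0)" if z: "z \<in> Tot n" for z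
  proof -
    have "z q \<in> K (n - q - q)" for q
      using Tot_K[OF z, of q] Tot_neg[OF z, of q] by (cases "0 \<le> q") (auto simp: algebra_simps)
    then show ?thesis using presents_eq_zero[OF chains] by (auto simp: g_def zero_bicomplex f_zero)
  qed
  show ?thesis
    unfolding column_filtration_def presents_carrier[OF total_presented, symmetric] Fil_def using eq by auto
qed

lemma ss_Z_presented:
  "ss_Z (total_d A E) (column_filtration A E) r p n = g n ` ZZ r p n"
proof -
  have "total_d A E n (g n z) \<in> g (n - 1) ` Fil (p - r) (n - 1) \<longleftrightarrow> D z \<in> Fil (p - r) (n - 1)" if "z \<in> Fil p n" for z
    using that total_d_presented[of z n] g_inj[OF D_Tot] Fil_Tot by (auto simp: image_iff)
  then show ?thesis unfolding ss_Z_def column_filtration_presented ZZ_def by auto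
qed

lemma ZZ_Tot: "ZZ r p n \<subseteq> Tot n" by (auto simp: ZZ_def Fil_def)

lemma ss_B_presented:
  "ss_B (total A E) (total_d A E) (column_filtration A E) r p n = g n ` BZ r p n"
proof -
  have im: "total_d A E (n + 1) ` g (n + 1) ` ZZ (r - 1) (p + r - 1) (n + 1) = g n ` D ` ZZ (r - 1) (p + r - 1) (n + 1)"
    unfolding image_image using total_d_presented[OF subsetD[OF ZZ_Tot], of _ _ _ "n + 1"] by (intro image_cong) auto
  have add: "g n a \<oplus>\<^bsub>total A E n\<^esub> g n (D w) = g n (a + D w)"
    if "a \<in> ZZ (r - 1) (p - 1) n" "w \<in> ZZ (r - 1) (p + r - 1) (n + 1)" for a w
    using that presents_add[OF total_presented] subsetD[OF ZZ_Tot] D_Tot[of w "n + 1"] by auto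
  show ?thesis
    unfolding ss_B_def ss_Z_presented im set_add_def' BZ_def using add by (auto simp: image_iff)
qed

lemma subspace_ZZ: "fs.subspace (ZZ r p n)"
  using subspace_Fil[of p n] subspace_Fil[of "p - r" "n - 1"]
  by (intro fs.subspaceI) (auto simp: ZZ_def D.zero D.add D.scale fs.subspace_0 fs.subspace_add fs.subspace_scale)

lemma subspace_BB': "fs.subspace (BZ r p n)"
  unfolding BZ_def by (rule subspace_image_sum[OF linear_D subspace_ZZ subspace_ZZ])

lemma BB'_ZZ: "BZ r p n \<subseteq> ZZ r p n"
proof
  fix x assume "x \<in> BZ r p n"
  then obtain a w where x: "x = a + D w" "a \<in> ZZ (r - 1) (p - 1) n" "w \<in> ZZ (r - 1) (p + r - 1) (n + 1)"
    by (auto simp: BZ_def)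
  have "p - 1 - (r - 1) = p - r" "p + r - 1 - (r - 1) = p" by auto
  then have a: "a \<in> Fil p n" "D a \<in> Fil (p - r) (n - 1)" "D w \<in> Fil p n"
    using x Fil_mono[of "p - 1" p n] by (auto simp: ZZ_def)
  have "w \<in> Tot (n + 1)" using x ZZ_Tot by blast
  then have "D x = D a" using x(1) DD by (simp add: D.add)
  then show "x \<in> ZZ r p n" using a x(1) fs.subspace_add[OF subspace_Fil] by (simp add: ZZ_def)
qed

text \<open>For \<open>r \<ge> 2\<close> the boundary of a representative is also the boundary of an
  element one column lower, and boundaries of such elements are divided out in the target of the
  differential.\<close>

theorem connes_degeneration:
  assumes r: "2 \<le> r" and X: "X \<in> carrier (connes_page A E r p q)"
  shows "connes_diff A E r p q X = \<zero>\<^bsub>connes_page A E r (p - r) (q + r - 1)\<^esub>"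
proof -
  define n where "n = p + q"
  let ?M = "(total A E n)\<lparr>carrier := g n ` ZZ r p n\<rparr>"
  have M: "presents (fun_scale scl) ?M (ZZ r p n) {0} (g n)"
    by (rule presents_restrict[OF total_presented subspace_ZZ])
      (use ZZ_Tot fs.subspace_0[OF subspace_ZZ] in auto)
  have BB0: "{0} \<subseteq> BZ r p n" for r p n using fs.subspace_0[OF subspace_BB'] by simp
  note page = presents_quot[OF M subspace_BB' BB0 BB'_ZZ refl]
  have "X \<in> carrier (quot_space ?M (g n ` BZ r p n))"
    using X by (simp add: connes_page_def ss_page_def ss_Z_presented ss_B_presented n_def)
  then obtain z where z: "z \<in> ZZ r p n" "X = g n ` BZ r p n +>\<^bsub>?M\<^esub> g n z"
    unfolding presents_carrier[OF page, symmetric] by blast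
  have DZ: "D z \<in> BZ r (p - r) (n - 1)" if z: "z \<in> ZZ r p n" for z
  proof -
    have "D z \<in> Fil (p - 2) (n - 1)" using z Fil_mono[of "p - r" "p - 2" "n - 1"] r by (auto simp: ZZ_def)
    then obtain z' where z': "z' \<in> Fil (p - 1) n" "D z' = D z" using lower_filtration[of z p n] z by (auto simp: ZZ_def)
    have "p - r + r - 1 = p - 1" "p - 1 - (r - 1) = p - r" "n - 1 + 1 = n" by auto
    then have "z' \<in> ZZ (r - 1) (p - r + r - 1) (n - 1 + 1)" using z' z by (simp add: ZZ_def)
    then have "0 + D z' \<in> BZ r (p - r) (n - 1)"
      unfolding BZ_def using fs.subspace_0[OF subspace_ZZ] by blast
    then show ?thesis using z' by simp
  qed
  have "connes_diff A E r p q X = induced_map (total A E (n - 1)) (g (n - 1) ` BZ r (p - r) (n - 1)) (total_d A E n)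
      (g n ` BZ r p n +>\<^bsub>?M\<^esub> g n z)"
    by (simp add: connes_diff_def ss_diff_def ss_B_presented n_def z(2))
  also have "\<dots> = g (n - 1) ` BZ r (p - r) (n - 1) +>\<^bsub>total A E (n - 1)\<^esub> g (n - 1) (D z)"
    by (rule induced_map_presented[OF M subspace_BB' BB0 BB'_ZZ total_presented subspace_BB' BB0 _ linear_D _ _ _ z(1)])
      (use DZ BB'_ZZ ZZ_Tot total_d_presented D_Tot in blast)+
  also have "\<dots> = g (n - 1) ` BZ r (p - r) (n - 1) +>\<^bsub>total A E (n - 1)\<^esub> g (n - 1) 0"
    by (subst presents_coset_eq_iff[OF total_presented subspace_BB' BB0])
      (use DZ[OF z(1)] fs.subspace_0[OF subspace_Tot] in
        \<open>auto dest: subsetD[OF BB'_ZZ] subsetD[OF ZZ_Tot]\<close>)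
  also have "\<dots> = g (n - 1) ` BZ r (p - r) (n - 1)"
  proof -
    have "BZ r (p - r) (n - 1) \<subseteq> Tot (n - 1)" using BB'_ZZ ZZ_Tot by blast
    then show ?thesis
      by (subst presents_coset[OF total_presented subspace_BB' BB0 _ fs.subspace_0[OF subspace_Tot]]) auto
  qed
  also have "\<dots> = \<zero>\<^bsub>connes_page A E r (p - r) (q + r - 1)\<^esub>"
  proof -
    have e: "p - r + (q + r - 1) = n - 1" by (simp add: n_def)
    show ?thesis
      unfolding connes_page_def ss_page_def quot_space_def e ss_B_presented
      by (simp add: ring.defs module.defs FactRing_def)
  qed
  finally show ?thesis .
qed

end

section \<open>Operators on spaces of lists\<close>

abbreviation lin :: "(('x \<Rightarrow>\<^sub>0 'k::field) \<Rightarrow> ('y \<Rightarrow>\<^sub>0 'k)) \<Rightarrow> bool" where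
  "lin \<equiv> Vector_Spaces.linear fscale fscale"

abbreviation delta :: "'x \<Rightarrow> ('x \<Rightarrow>\<^sub>0 'k::field)" (\<open>\<delta>\<close>) where
  "\<delta> x \<equiv> Poly_Mapping.single x 1"

lemma linI:
  assumes "\<And>x y. f (x + y) = f x + f y" "\<And>c x. f (fscale c x) = fscale c (f x)" shows "lin f"
  using assms by unfold_locales auto

lemma
  assumes "lin f"
  shows lin_add: "f (x + y) = f x + f y" and lin_diff: "f (x - y) = f x - f y"
    and lin_neg: "f (- x) = - f x" and lin_zero: "f 0 = 0"
    and lin_scale: "f (fscale c x) = fscale c (f x)" and lin_sum: "f (sum h I) = (\<Sum>i\<in>I. f (h i))"
proof -
  interpret Vector_Spaces.linear fscale fscale f by fact
  show "f (x + y) = f x + f y" "f (x - y) = f x - f y" "f (- x) = - f x" "f 0 = 0"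
    "f (fscale c x) = fscale c (f x)" "f (sum h I) = (\<Sum>i\<in>I. f (h i))"
    by (fact add diff neg zero scale sum)+
qed

lemmas lin_simps = lin_add lin_diff lin_neg lin_zero lin_scale lin_sum

lemma single_eq_fscale: "Poly_Mapping.single x c = fscale c (\<delta> x)"
  by (rule poly_mapping_eqI) (simp add: lookup_single when_def)

lemma poly_mapping_sum_keys:
  assumes "finite S" "Poly_Mapping.keys f \<subseteq> S"
  shows "f = (\<Sum>x\<in>S. fscale (Poly_Mapping.lookup f x) (\<delta> x))"
proof (rule poly_mapping_eqI)
  fix y
  have "Poly_Mapping.lookup (\<Sum>x\<in>S. fscale (Poly_Mapping.lookup f x) (\<delta> x)) y
      = (\<Sum>x\<in>S. if x = y then Poly_Mapping.lookup f y else 0)"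
    unfolding lookup_sum by (rule sum.cong) (auto simp: lookup_single when_def)
  then show "Poly_Mapping.lookup f y = Poly_Mapping.lookup (\<Sum>x\<in>S. fscale (Poly_Mapping.lookup f x) (\<delta> x)) y"
    using assms by (auto simp: not_in_keys_iff_lookup_eq_zero subset_iff)
qed

lemma lin_ext_superset:
  assumes "finite S" "Poly_Mapping.keys f \<subseteq> S"
  shows "lin_ext g f = (\<Sum>x\<in>S. fscale (Poly_Mapping.lookup f x) (g x))"
  unfolding lin_ext_def using assms
  by (intro sum.mono_neutral_left) (auto simp: not_in_keys_iff_lookup_eq_zero)

lemma lin_lin_ext: "lin (lin_ext g :: ('x \<Rightarrow>\<^sub>0 'k::field) \<Rightarrow> ('y \<Rightarrow>\<^sub>0 'k))"
proof (rule linI)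
  fix x y :: "'x \<Rightarrow>\<^sub>0 'k" and c
  let ?S = "Poly_Mapping.keys x \<union> Poly_Mapping.keys y"
  show "lin_ext g (x + y) = lin_ext g x + lin_ext g y"
    using keys_add[of x y]
    by (simp add: lin_ext_superset[of ?S] lookup_add free_vs.scale_left_distrib sum.distrib)
  have "Poly_Mapping.keys (fscale c x) \<subseteq> Poly_Mapping.keys x" by (auto simp: in_keys_iff)
  then show "lin_ext g (fscale c x) = fscale c (lin_ext g x)"
    by (simp add: lin_ext_superset[of "Poly_Mapping.keys x"] free_vs.scale_sum_right)
qed

lemmas lin_ext_simps [simp] = lin_simps[OF lin_lin_ext]

lemma lin_ext_delta [simp]: "lin_ext g (\<delta> x) = g x"
  by (simp add: lin_ext_superset[of "{x}"])

lemma span_of_deltas_induct [consumes 1, case_names zero step]: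
  assumes "Poly_Mapping.keys f \<subseteq> X" and "P 0"
    and "\<And>x c f. x \<in> X \<Longrightarrow> P f \<Longrightarrow> P (fscale c (\<delta> x) + f)"
  shows "P f"
proof -
  have "P (\<Sum>x\<in>S. fscale (Poly_Mapping.lookup f x) (\<delta> x))" if "finite S" "S \<subseteq> X" for S
    using that by induction (auto intro: assms)
  then show ?thesis using poly_mapping_sum_keys[of "Poly_Mapping.keys f" f] assms(1) by (metis finite_keys order_refl)
qed

lemma lin_eqI:
  assumes f: "lin f" and g: "lin g" and "\<And>x. x \<in> X \<Longrightarrow> f (\<delta> x) = g (\<delta> x)" and "Poly_Mapping.keys v \<subseteq> X"
  shows "f v = g v"
  using assms(4) by (induction rule: span_of_deltas_induct)
    (simp_all add: lin_simps[OF f] lin_simps[OF g] assms(3))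

lemma lin_comp: "lin f \<Longrightarrow> lin g \<Longrightarrow> lin (\<lambda>x. f (g x))"
  by (rule linI) (simp_all add: lin_simps)

lemma lin_plus: "lin f \<Longrightarrow> lin g \<Longrightarrow> lin (\<lambda>x. f x + g x)"
  by (rule linI) (simp_all add: lin_simps free_vs.scale_right_distrib)

lemma lin_minus: "lin f \<Longrightarrow> lin g \<Longrightarrow> lin (\<lambda>x. f x - g x)"
  by (rule linI) (simp_all add: lin_simps free_vs.scale_right_diff_distrib)

lemma lin_scaled: "lin f \<Longrightarrow> lin (\<lambda>x. fscale c (f x))"
  by (rule linI) (simp_all add: lin_simps free_vs.scale_right_distrib mult.commute)

lemma lin_sums: "(\<And>i. i \<in> I \<Longrightarrow> lin (f i)) \<Longrightarrow> lin (\<lambda>x. \<Sum>i\<in>I. f i x)"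
  by (rule linI) (simp_all add: lin_simps sum.distrib free_vs.scale_sum_right)

lemma lin_ident: "lin (\<lambda>x. x)" and lin_const0: "lin (\<lambda>x. 0)"
  by (rule linI; simp)+

lemma lin_funpow: "lin (f :: ('x \<Rightarrow>\<^sub>0 'k::field) \<Rightarrow> ('x \<Rightarrow>\<^sub>0 'k)) \<Longrightarrow> lin (f ^^ n)"
proof (induction n)
  case 0
  have "f ^^ 0 = (\<lambda>x. x)" by (simp add: fun_eq_iff)
  then show ?case by (simp only: lin_ident)
next
  case (Suc n)
  have "f ^^ Suc n = (\<lambda>x. f ((f ^^ n) x))" by (simp add: fun_eq_iff)
  then show ?case using Suc lin_comp[of f "f ^^ n"] by (simp only:)
qed

text \<open>The operators are registered in composed form, so that nested expressions are shown to
  be linear from the outside in.\<close>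

named_theorems lin_intros

declare lin_ident [lin_intros] lin_const0 [lin_intros] lin_plus [lin_intros] lin_minus [lin_intros]
  lin_scaled [lin_intros] lin_sums [lin_intros] lin_comp [OF lin_lin_ext, lin_intros]

lemma keys_lin_subset:
  assumes f: "lin f" and "\<And>x. x \<in> X \<Longrightarrow> Poly_Mapping.keys (f (\<delta> x)) \<subseteq> Y" and "Poly_Mapping.keys v \<subseteq> X"
  shows "Poly_Mapping.keys (f v) \<subseteq> Y"
  using assms(3)
proof (induction rule: span_of_deltas_induct)
  case (step x c v)
  have "Poly_Mapping.keys (fscale c (f (\<delta> x))) \<subseteq> Poly_Mapping.keys (f (\<delta> x))" by (auto simp: in_keys_iff)
  then show ?case
    using assms(2)[OF step(1)] step(2) keys_add[of "fscale c (f (\<delta> x))" "f v"]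
    by (simp add: lin_simps[OF f]) blast
qed (simp add: lin_simps[OF f])

definition homog :: "nat \<Rightarrow> ('p list \<Rightarrow>\<^sub>0 'k::field) set" where
  "homog L = {f. Poly_Mapping.keys f \<subseteq> {l. length l = L}}"

lemma subspace_keys: "free_vs.subspace {f :: 'x \<Rightarrow>\<^sub>0 'k::field. Poly_Mapping.keys f \<subseteq> X}"
proof (rule free_vs.subspaceI)
  fix x y :: "'x \<Rightarrow>\<^sub>0 'k"
  assume "x \<in> {f. Poly_Mapping.keys f \<subseteq> X}" "y \<in> {f. Poly_Mapping.keys f \<subseteq> X}"
  then show "x + y \<in> {f. Poly_Mapping.keys f \<subseteq> X}" using keys_add[of x y] by blast
next
  fix x :: "'x \<Rightarrow>\<^sub>0 'k" and c
  have "Poly_Mapping.keys (fscale c x) \<subseteq> Poly_Mapping.keys x" by (auto simp: in_keys_iff)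
  moreover assume "x \<in> {f. Poly_Mapping.keys f \<subseteq> X}"
  ultimately show "fscale c x \<in> {f. Poly_Mapping.keys f \<subseteq> X}" by blast
qed simp

lemma subspace_homog: "free_vs.subspace (homog L)"
  unfolding homog_def by (rule subspace_keys)

lemma homog_eqI:
  assumes "lin f" "lin g" "\<And>l. length l = L \<Longrightarrow> f (\<delta> l) = g (\<delta> l)" "v \<in> homog L"
  shows "f v = g v"
  using lin_eqI[OF assms(1,2), of "{l. length l = L}" v] assms(3,4) by (simp add: homog_def)

lemma homog_lin:
  assumes "lin f" "\<And>l. length l = L \<Longrightarrow> f (\<delta> l) \<in> homog L'" "v \<in> homog L"
  shows "f v \<in> homog L'"
  using keys_lin_subset[OF assms(1), of "{l. length l = L}" "{l. length l = L'}" v] assms(2,3)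
  by (simp add: homog_def)

lemma delta_homog [simp]: "\<delta> l \<in> homog L \<longleftrightarrow> length l = L"
  by (simp add: homog_def)

lemma zero_homog [simp]: "0 \<in> homog L" by (simp add: homog_def)

subsection \<open>The cyclic operator and the norm\<close>

lemma lin_t: "lin free_t" unfolding free_t_def by (rule lin_lin_ext)
lemma lin_N: "lin free_N" unfolding free_N_def by (rule lin_lin_ext)
lemmas [lin_intros] = lin_comp[OF lin_t] lin_comp[OF lin_N] lin_comp[OF lin_funpow[OF lin_t]]
lemmas t_simps [simp] = lin_simps[OF lin_t]
lemmas N_simps [simp] = lin_simps[OF lin_N]
lemmas tpow_simps [simp] = lin_simps[OF lin_funpow[OF lin_t]]

abbreviation rrot :: "'p list \<Rightarrow> 'p list" where "rrot l \<equiv> last l # butlast l"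

lemma t_delta: "free_t (\<delta> l) = fscale ((- 1) ^ (length l - 1)) (\<delta> (rrot l))"
  by (simp add: free_t_def single_eq_fscale[symmetric])

lemma length_rr: "l \<noteq> [] \<Longrightarrow> length (rrot l) = length l" by (cases l) auto

lemma rr_rotate1: "l \<noteq> [] \<Longrightarrow> rrot (rotate1 l) = l" by (cases l) auto

lemma rrpow_rotate: "l \<noteq> [] \<Longrightarrow> ((\<lambda>l. rrot l) ^^ k) (rotate k l) = l"
proof (induction k arbitrary: l)
  case (Suc k)
  have "((\<lambda>l. rrot l) ^^ Suc k) (rotate (Suc k) l) = ((\<lambda>l. rrot l) ^^ k) (rrot (rotate1 (rotate k l)))"
    by (simp only: funpow_Suc_right comp_def rotate_Suc)
  then show ?case using Suc rr_rotate1[of "rotate k l"] by simp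
qed simp

lemma length_rrpow: "l \<noteq> [] \<Longrightarrow> length (((\<lambda>l. rrot l) ^^ k) l) = length l"
  by (induction k) (auto simp: length_rr)

lemma rrpow_eq_rotate: assumes "l \<noteq> []" "i \<le> length l" shows "((\<lambda>l. rrot l) ^^ (length l - i)) l = rotate i l"
proof -
  have "rotate (length l - i) (rotate i l) = l" using assms by (simp add: rotate_rotate rotate_id)
  then show ?thesis using rrpow_rotate[of "rotate i l" "length l - i"] assms by simp
qed

lemma tpow_delta:
  "l \<noteq> [] \<Longrightarrow> (free_t ^^ k) (\<delta> l) = fscale ((- 1) ^ ((length l - 1) * k)) (\<delta> (((\<lambda>l. rrot l) ^^ k) l))"
proof (induction k)
  case (Suc k)
  have "length (((\<lambda>l. rrot l) ^^ k) l) = length l" using Suc by (simp add: length_rrpow)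
  then show ?case using Suc by (simp add: t_delta power_add[symmetric] add.commute)
qed simp

lemma t_hom: "f \<in> homog L \<Longrightarrow> 0 < L \<Longrightarrow> free_t f \<in> homog L"
  by (rule homog_lin[OF lin_t, of L])
    (auto simp: t_delta length_rr intro!: free_vs.subspace_scale[OF subspace_homog])

lemma tpow_hom: "f \<in> homog L \<Longrightarrow> 0 < L \<Longrightarrow> (free_t ^^ k) f \<in> homog L"
  by (induction k) (auto simp: t_hom)

lemma tpow_length: assumes "f \<in> homog L" "0 < L" shows "(free_t ^^ L) f = f"
proof (rule homog_eqI[OF lin_funpow[OF lin_t] lin_ident _ assms(1)])
  fix l :: "'a list" assume l: "length l = L"
  then have "l \<noteq> []" using assms(2) by auto
  \<comment> \<open>A full turn has the sign \<open>(- 1) ^ ((L - 1) * L)\<close>, whose exponent is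
    a product of consecutive numbers.\<close>
  moreover have "even ((L - 1) * L)" using assms(2) by (cases L) auto
  ultimately show "(free_t ^^ L) (\<delta> l) = \<delta> l"
    using rrpow_eq_rotate[of l 0] l by (simp add: tpow_delta)
qed

lemma N_eq: "f \<in> homog L \<Longrightarrow> free_N f = (\<Sum>i<L. (free_t ^^ i) f)"
  by (rule homog_eqI[OF lin_N, of _ L]) (auto intro!: lin_intros simp: free_N_def)

lemma N_hom: "f \<in> homog L \<Longrightarrow> 0 < L \<Longrightarrow> free_N f \<in> homog L"
  by (simp add: N_eq tpow_hom free_vs.subspace_sum[OF subspace_homog])

lemma tN: assumes "f \<in> homog L" "0 < L" shows "free_t (free_N f) = free_N f"
proof -
  have "free_t (free_N f) + f = (\<Sum>i<Suc L. (free_t ^^ i) f)"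
    unfolding N_eq[OF assms(1)] sum.lessThan_Suc_shift by simp
  then show ?thesis using tpow_length[OF assms] by (simp add: N_eq[OF assms(1)])
qed

lemma tpowN: "f \<in> homog L \<Longrightarrow> 0 < L \<Longrightarrow> (free_t ^^ k) (free_N f) = free_N f"
  by (induction k) (auto simp: tN)

lemma Nt: assumes "f \<in> homog L" "0 < L" shows "free_N (free_t f) = free_N f"
  using tN[OF assms] by (simp add: N_eq[OF assms(1)] N_eq[OF t_hom[OF assms]] funpow_swap1)

lemma Ntpow: "f \<in> homog L \<Longrightarrow> 0 < L \<Longrightarrow> free_N ((free_t ^^ k) f) = free_N f"
  by (induction k) (simp_all add: Nt[OF tpow_hom])

subsection \<open>The bar differentials of a partial multiplication\<close>

definition pre :: "'p \<Rightarrow> ('p list \<Rightarrow>\<^sub>0 'k::field) \<Rightarrow> ('p list \<Rightarrow>\<^sub>0 'k)" where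
  "pre p = lin_ext (\<lambda>l. \<delta> (p # l))"

definition suf :: "'p \<Rightarrow> ('p list \<Rightarrow>\<^sub>0 'k::field) \<Rightarrow> ('p list \<Rightarrow>\<^sub>0 'k)" where
  "suf p = lin_ext (\<lambda>l. \<delta> (l @ [p]))"

lemma lin_pre: "lin (pre p)" unfolding pre_def by (rule lin_lin_ext)
lemma lin_suf: "lin (suf p)" unfolding suf_def by (rule lin_lin_ext)
lemmas [lin_intros] = lin_comp[OF lin_pre] lin_comp[OF lin_suf]
lemmas pre_simps [simp] = lin_simps[OF lin_pre]
lemmas suf_simps [simp] = lin_simps[OF lin_suf]
lemma pre_delta [simp]: "pre p (\<delta> l) = \<delta> (p # l)" by (simp add: pre_def)
lemma suf_delta [simp]: "suf p (\<delta> l) = \<delta> (l @ [p])" by (simp add: suf_def)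

lemma suf_pre: "suf q (pre p f) = pre p (suf q f)"
  by (rule lin_eqI[of "\<lambda>f. suf q (pre p f)" _ UNIV]) (auto intro!: lin_intros)

lemma pre_hom: "f \<in> homog L \<Longrightarrow> pre p f \<in> homog (Suc L)"
  by (rule homog_lin[OF lin_pre, of L]) auto

definition delta_opt :: "'p option \<Rightarrow> 'p list \<Rightarrow> 'p list \<Rightarrow> ('p list \<Rightarrow>\<^sub>0 'k::field)" where
  "delta_opt u l r = (case u of None \<Rightarrow> 0 | Some u \<Rightarrow> \<delta> (l @ u # r))"

lemma dl_simps [simp]: "delta_opt None l r = 0" "delta_opt (Some u) l r = \<delta> (l @ u # r)"
  by (simp_all add: delta_opt_def)

lemma dl_hom: "delta_opt u l r \<in> homog (Suc (length l + length r))"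
  by (cases u) auto

text \<open>
  Products of basis elements are again basis elements or zero, and \<open>None\<close> stands for zero.
  Only \<open>mult_hd (free_t f)\<close> is ever needed: it is the face that multiplies the last letter by the
  first one.
\<close>

locale partial_mult =
  fixes pmult :: "'p \<Rightarrow> 'p \<Rightarrow> 'p option" and field_type :: "'k::field itself"
begin

text \<open>The differential of the acyclic bar complex, often written \<open>b'\<close>: all faces
  of the Hochschild differential except the cyclic one.\<close>

fun bar_list :: "'p list \<Rightarrow> ('p list \<Rightarrow>\<^sub>0 'k)" where
  "bar_list (p # q # r) = delta_opt (pmult p q) [] r - pre p (bar_list (q # r))"
| "bar_list _ = 0"

definition bar :: "('p list \<Rightarrow>\<^sub>0 'k) \<Rightarrow> ('p list \<Rightarrow>\<^sub>0 'k)" where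
  "bar = lin_ext bar_list"

definition mult_hd :: "('p list \<Rightarrow>\<^sub>0 'k) \<Rightarrow> ('p list \<Rightarrow>\<^sub>0 'k)" where
  "mult_hd = lin_ext (\<lambda>l. case l of p # q # r \<Rightarrow> delta_opt (pmult p q) [] r | _ \<Rightarrow> 0)"

definition hb :: "('p list \<Rightarrow>\<^sub>0 'k) \<Rightarrow> ('p list \<Rightarrow>\<^sub>0 'k)" where
  "hb f = bar f + mult_hd (free_t f)"

definition lmult :: "'p \<Rightarrow> ('p list \<Rightarrow>\<^sub>0 'k) \<Rightarrow> ('p list \<Rightarrow>\<^sub>0 'k)" where
  "lmult q = lin_ext (\<lambda>l. case l of p # r \<Rightarrow> delta_opt (pmult q p) [] r | [] \<Rightarrow> 0)"

definition rmult :: "'p \<Rightarrow> ('p list \<Rightarrow>\<^sub>0 'k) \<Rightarrow> ('p list \<Rightarrow>\<^sub>0 'k)" where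
  "rmult q = lin_ext (\<lambda>l. if l = [] then 0 else delta_opt (pmult (last l) q) (butlast l) [])"

lemma lin_bar: "lin bar" unfolding bar_def by (rule lin_lin_ext)
lemma lin_mult_hd: "lin mult_hd" unfolding mult_hd_def by (rule lin_lin_ext)
lemma lin_lmult: "lin (lmult q)" unfolding lmult_def by (rule lin_lin_ext)
lemma lin_rmult: "lin (rmult q)" unfolding rmult_def by (rule lin_lin_ext)
lemmas [lin_intros] = lin_comp[OF lin_bar] lin_comp[OF lin_mult_hd] lin_comp[OF lin_lmult] lin_comp[OF lin_rmult]
lemma lin_hb: "lin hb" unfolding hb_def[abs_def] by (intro lin_intros)
lemmas [lin_intros] = lin_comp[OF lin_hb]
lemmas bar_simps [simp] = lin_simps[OF lin_bar]
lemmas mh_simps [simp] = lin_simps[OF lin_mult_hd]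
lemmas lm_simps [simp] = lin_simps[OF lin_lmult]
lemmas rm_simps [simp] = lin_simps[OF lin_rmult]
lemmas hb_simps [simp] = lin_simps[OF lin_hb]

lemma bar_delta [simp]: "bar (\<delta> l) = bar_list l" by (simp add: bar_def)
lemma mh_delta [simp]: "mult_hd (\<delta> (p # q # r)) = delta_opt (pmult p q) [] r" by (simp add: mult_hd_def)
lemma lm_delta [simp]: "lmult q (\<delta> (p # r)) = delta_opt (pmult q p) [] r" "lmult q (\<delta> []) = 0" by (simp_all add: lmult_def)
lemma rm_delta [simp]: "rmult q (\<delta> (l @ [p])) = delta_opt (pmult p q) l []" "rmult q (\<delta> []) = 0" by (simp_all add: rmult_def)

lemma mh_lm: "w \<noteq> [] \<Longrightarrow> mult_hd (\<delta> (q # w)) = lmult q (\<delta> w)"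
  by (cases w) auto

lemma lm_pre: "lmult p (pre q f) = (case pmult p q of None \<Rightarrow> 0 | Some u \<Rightarrow> pre u f)"
  by (rule lin_eqI[of "\<lambda>f. lmult p (pre q f)" "\<lambda>f. case pmult p q of None \<Rightarrow> 0 | Some u \<Rightarrow> pre u f" UNIV];
      cases "pmult p q") (auto intro!: lin_intros)

lemma rm_pre: assumes "f \<in> homog L" "0 < L" shows "rmult q (pre p f) = pre p (rmult q f)"
proof (rule homog_eqI[OF _ _ _ assms(1)])
  fix l :: "'p list" assume "length l = L"
  then obtain l' x where "l = l' @ [x]" using assms(2) by (cases l rule: rev_exhaust) auto
  then have "rmult q (\<delta> (p # l)) = pre p (rmult q (\<delta> l))"
    using rm_delta(1)[of q "p # l'" x] by (cases "pmult x q") auto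
  then show "rmult q (pre p (\<delta> l)) = pre p (rmult q (\<delta> l))" by simp
qed (intro lin_intros)+

lemma bar_hom: "f \<in> homog L \<Longrightarrow> bar f \<in> homog (L - 1)"
proof (rule homog_lin[OF lin_bar, of L])
  fix l :: "'p list" show "length l = L \<Longrightarrow> bar (\<delta> l) \<in> homog (L - 1)"
  proof (induction l arbitrary: L rule: bar_list.induct)
    case (1 p q r)
    have "bar_list (q # r) \<in> homog (Suc (length r) - 1)" using 1 by simp
    then have "pre p (bar_list (q # r)) \<in> homog (Suc (length r))" using pre_hom by fastforce
    then show ?case using dl_hom[of "pmult p q" "[]" r] 1 free_vs.subspace_diff[OF subspace_homog] by auto
  qed auto
qed

lemma mh_hom: "f \<in> homog L \<Longrightarrow> mult_hd f \<in> homog (L - 1)"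
proof (rule homog_lin[OF lin_mult_hd, of L])
  fix l :: "'p list" assume "length l = L"
  then show "mult_hd (\<delta> l) \<in> homog (L - 1)"
    using dl_hom[of "pmult p q" "[]" r for p q r] by (cases l rule: bar_list.cases) (auto simp: mult_hd_def)
qed

lemma bar_snoc: "w \<noteq> [] \<Longrightarrow> bar (\<delta> (w @ [q])) = suf q (bar (\<delta> w)) + fscale ((- 1) ^ (length w - 1)) (rmult q (\<delta> w))"
proof (induction w rule: bar_list.induct)
  case (1 p p' r)
  have "delta_opt (pmult p p') [] (r @ [q]) = (suf q (delta_opt (pmult p p') [] r) :: 'p list \<Rightarrow>\<^sub>0 'k)" by (cases "pmult p p'") auto
  moreover have "rmult q (\<delta> (p # p' # r)) = pre p (rmult q (\<delta> (p' # r)))"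
    using rm_pre[of "\<delta> (p' # r)" "Suc (length r)" q p] by simp
  ultimately show ?case using 1 by (simp add: suf_pre del: rm_delta)
next
  case ("2_2" p)
  then show ?case using rm_delta(1)[of q "[]" p] by simp
qed auto

text \<open>Peeling off the last letter turns the last inner face and the cyclic face into right and
  left multiplication of \<open>w\<close> by \<open>q\<close>. With this form, \<open>hb_hb\<close>
  reduces to associativity and to the fact that \<open>bar\<close> commutes with both
  multiplications.\<close>

lemma hb_snoc:
  "w \<noteq> [] \<Longrightarrow> hb (\<delta> (w @ [q])) = suf q (bar (\<delta> w)) + fscale ((- 1) ^ (length w - 1)) (rmult q (\<delta> w))
    + fscale ((- 1) ^ length w) (lmult q (\<delta> w))"
  unfolding hb_def bar_snoc t_delta by (simp add: mh_lm)

lemma hb_suf: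
  assumes "f \<in> homog L" "0 < L"
  shows "hb (suf q f) = suf q (bar f) + fscale ((- 1) ^ (L - 1)) (rmult q f) + fscale ((- 1) ^ L) (lmult q f)"
proof (rule homog_eqI[OF _ _ _ assms(1)])
  fix l :: "'p list" assume "length l = L"
  then show "hb (suf q (\<delta> l)) = suf q (bar (\<delta> l)) + fscale ((- 1) ^ (L - 1)) (rmult q (\<delta> l)) + fscale ((- 1) ^ L) (lmult q (\<delta> l))"
    using hb_snoc[of l q] assms(2) by auto
qed (intro lin_intros)+

text \<open>The \<open>i\<close>-th face is the conjugate of the first one by the \<open>i\<close>-th power of the cyclic operator.\<close>

lemma barb_faces:
  "bar_list l = (\<Sum>i<length l - 1. fscale ((- 1) ^ i) (delta_opt (pmult (l ! i) (l ! Suc i)) (take i l) (drop (i + 2) l)))"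
proof (induction l rule: bar_list.induct)
  case (1 p q r)
  have "pre p (delta_opt u l' r') = (delta_opt u (p # l') r' :: 'p list \<Rightarrow>\<^sub>0 'k)" for u l' r' by (cases u) auto
  moreover define F where "F i = fscale ((- 1) ^ i) (delta_opt (pmult ((p # q # r) ! i) ((p # q # r) ! Suc i))
      (take i (p # q # r)) (drop (i + 2) (p # q # r)) :: 'p list \<Rightarrow>\<^sub>0 'k)" for i
  ultimately have "pre p (bar_list (q # r)) = (\<Sum>i<length r. - F (Suc i))"
    unfolding 1 pre_simps by (intro sum.cong) simp_all
  moreover have "(\<Sum>i<Suc (length r). F i) = F 0 + (\<Sum>i<length r. F (Suc i))"
    by (rule sum.lessThan_Suc_shift)
  moreover have "F 0 = delta_opt (pmult p q) [] r" "length (p # q # r) - 1 = Suc (length r)" by (simp_all add: F_def)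
  ultimately show ?case unfolding F_def[symmetric] bar_list.simps by (simp only: sum_negf diff_minus_eq_add)
qed auto

lemma face_conjugate:
  assumes "Suc i < length l"
  shows "(free_t ^^ i) (mult_hd ((free_t ^^ (length l - i)) (\<delta> l)))
    = fscale ((- 1) ^ i) (delta_opt (pmult (l ! i) (l ! Suc i)) (take i l) (drop (i + 2) l))"
proof -
  let ?L = "length l"
  have l: "l \<noteq> []" using assms by auto
  have "rotate i l = l ! i # l ! Suc i # drop (i + 2) l @ take i l"
    using assms by (simp add: rotate_drop_take Cons_nth_drop_Suc)
  then have "(free_t ^^ (?L - i)) (\<delta> l :: 'p list \<Rightarrow>\<^sub>0 'k) = fscale ((- 1) ^ ((?L - 1) * (?L - i))) (\<delta> (l ! i # l ! Suc i # drop (i + 2) l @ take i l))"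
    using rrpow_eq_rotate[OF l, of i] assms by (simp add: tpow_delta[OF l])
  moreover have "(free_t ^^ i) (\<delta> (u # drop (i + 2) l @ take i l) :: 'p list \<Rightarrow>\<^sub>0 'k) = fscale ((- 1) ^ ((?L - 2) * i)) (\<delta> (take i l @ u # drop (i + 2) l))" for u
  proof -
    have "rotate i (take i l @ u # drop (i + 2) l) = u # drop (i + 2) l @ take i l"
      using assms rotate_append[of "take i l" "u # drop (i + 2) l"] by simp
    then show ?thesis
      using rrpow_rotate[of "take i l @ u # drop (i + 2) l" i] assms by (simp add: tpow_delta)
  qed
  moreover have "(- 1) ^ ((?L - 1) * (?L - i)) * (- 1) ^ ((?L - 2) * i) = (- 1 :: 'k) ^ i"
  proof -
    obtain k where k: "?L = Suc (Suc (i + k))" using assms less_iff_Suc_add by (metis add_Suc_right Suc_less_eq less_natE)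
    \<comment> \<open>The last two terms add up to \<open>(?L - 1) * i\<close>, so the exponent is
      \<open>(?L - 1) * ?L\<close>.\<close>
    have "even ((?L - 1) * (?L - i) + (?L - 2) * i + i)" unfolding k by (auto simp: even_add even_mult_iff)
    then have "(- 1) ^ ((?L - 1) * (?L - i) + (?L - 2) * i + i) = (1 :: 'k)" by (rule neg_one_even_power)
    then have "(- 1) ^ ((?L - 1) * (?L - i)) * (- 1) ^ ((?L - 2) * i) * (- 1) ^ i = (1 :: 'k)"
      by (simp add: power_add)
    moreover have "(- 1) ^ i * (- 1) ^ i = (1 :: 'k)" by (simp add: power_mult_distrib[symmetric])
    moreover have "x = c" if "x * c = 1" "c * c = 1" for x c :: 'k
    proof -
      have "x = x * c * c" using that(2) by (simp add: mult.assoc)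
      then show ?thesis using that(1) by simp
    qed
    ultimately show ?thesis by blast
  qed
  ultimately show ?thesis
    by (cases "pmult (l ! i) (l ! Suc i)") simp_all
qed

lemma bar_eq: assumes "f \<in> homog L" shows "bar f = (\<Sum>i<L - 1. (free_t ^^ i) (mult_hd ((free_t ^^ (L - i)) f)))"
proof (rule homog_eqI[OF lin_bar _ _ assms])
  fix l :: "'p list" assume "length l = L"
  then show "bar (\<delta> l) = (\<Sum>i<L - 1. (free_t ^^ i) (mult_hd ((free_t ^^ (L - i)) (\<delta> l))))"
    unfolding bar_delta barb_faces by (intro sum.cong) (auto simp: face_conjugate)
qed (intro lin_intros)

text \<open>The identity \<open>b (1 - t) = (1 - t) b'\<close>: by the conjugation formula, the
  difference of \<open>bar (free_t f)\<close> and \<open>free_t (bar f)\<close> telescopes to the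
  two cyclic faces that \<open>hb\<close> adds.\<close>

lemma hb_t:
  assumes f: "f \<in> homog L" "0 < L" shows "hb (f - free_t f) = bar f - free_t (bar f)"
proof -
  define F where "F j = (free_t ^^ j) (mult_hd ((free_t ^^ (L - j)) (free_t f)))" for j
  have "bar (free_t f) = (\<Sum>i<L - 1. F i)" by (simp add: bar_eq[OF t_hom[OF f]] F_def)
  moreover have "free_t (bar f) = (\<Sum>i<L - 1. F (Suc i))"
  proof -
    have "(free_t ^^ (L - i)) f = (free_t ^^ (L - Suc i)) (free_t f)" if "i < L - 1" for i
    proof -
      have "L - i = Suc (L - Suc i)" using that by simp
      then show ?thesis by (simp only: funpow_Suc_right comp_def)
    qed
    then show ?thesis by (simp add: bar_eq[OF f(1)] F_def)
  qed
  ultimately have "bar (free_t f) - free_t (bar f) = F 0 - F (L - 1)"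
    by (simp add: sum_subtractf[symmetric] sum_lessThan_telescope')
  also have "F 0 = mult_hd (free_t f)" using tpow_length[OF t_hom[OF f] f(2)] by (simp add: F_def)
  also have "F (L - 1) = mult_hd (free_t (free_t f))"
  proof (cases "L = 1")
    case False
    then have "0 < L - 1" using f by simp
    moreover have "L - (L - 1) = 1" using f by simp
    ultimately show ?thesis unfolding F_def using tpow_length[OF mh_hom[OF t_hom[OF t_hom[OF f] f(2)]]] by simp
  qed (simp add: F_def)
  finally show ?thesis by (simp add: hb_def algebra_simps)
qed

text \<open>The identity \<open>b' N = N b\<close>: the norm absorbs \<open>t\<close> on either
  side, so that under it every face becomes the first face of some rotation of
  \<open>f\<close>.\<close>

lemma bar_N: assumes f: "f \<in> homog L" "0 < L" shows "bar (free_N f) = free_N (hb f)"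
proof (cases "L = 1")
  case True
  have "mult_hd g = 0" if "g \<in> homog 1" for g :: "'p list \<Rightarrow>\<^sub>0 'k"
    by (rule homog_eqI[OF lin_mult_hd lin_const0 _ that]) (auto simp: mult_hd_def length_Suc_conv)
  moreover have "bar g = 0" if "g \<in> homog 1" for g :: "'p list \<Rightarrow>\<^sub>0 'k"
    by (rule homog_eqI[OF lin_bar lin_const0 _ that]) (auto simp: length_Suc_conv)
  ultimately show ?thesis using f True N_hom[OF f] t_hom[OF f] by (simp add: hb_def)
next
  case False
  then have L: "0 < L - 1" using f by simp
  have m: "mult_hd ((free_t ^^ k) f) \<in> homog (L - 1)" for k using mh_hom[OF tpow_hom[OF f]] .
  have "free_N (hb f) = (\<Sum>i<L - 1. free_N (mult_hd ((free_t ^^ (L - i)) f))) + free_N (mult_hd (free_t f))"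
    by (simp add: hb_def bar_eq[OF f(1)] Ntpow[OF m L])
  also have "(\<Sum>i<L - 1. free_N (mult_hd ((free_t ^^ (L - i)) f))) + free_N (mult_hd (free_t f))
      = (\<Sum>i<L. free_N (mult_hd ((free_t ^^ (L - i)) f)))"
  proof -
    obtain k where "L = Suc k" using f(2) gr0_conv_Suc by blast
    then show ?thesis by simp
  qed
  also have "\<dots> = (\<Sum>i<L. free_N (mult_hd ((free_t ^^ Suc i) f)))"
    by (rule sum.reindex_bij_witness[of _ "\<lambda>i. L - Suc i" "\<lambda>i. L - Suc i"]) (auto simp: Suc_diff_Suc)
  also have "\<dots> = free_N (mult_hd (free_t (free_N f)))" by (simp add: N_eq[OF f(1)])
  also have "\<dots> = free_N (mult_hd (free_N f))" by (simp add: tN[OF f])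
  also have "\<dots> = bar (free_N f)"
    unfolding bar_eq[OF N_hom[OF f]] tpowN[OF f] N_eq[OF mh_hom[OF N_hom[OF f]]] ..
  finally show ?thesis ..
qed

end

locale partial_category = partial_mult pmult field_type
  for pmult :: "'p \<Rightarrow> 'p \<Rightarrow> 'p option" and field_type :: "'k::field itself" +
  fixes idl :: "'p \<Rightarrow> 'p"
  assumes assoc: "Option.bind (pmult p q) (\<lambda>u. pmult u r) = Option.bind (pmult q r) (pmult p)"
    and idl_left: "pmult (idl p) p = Some p"
    and idl_mult: "pmult p q = Some u \<Longrightarrow> idl u = idl p"
begin

lemma bar_lm: "bar (lmult p f) = lmult p (bar f)"
proof (rule lin_eqI[of "\<lambda>f. bar (lmult p f)" "\<lambda>f. lmult p (bar f)" UNIV])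
  fix l
  show "bar (lmult p (\<delta> l)) = lmult p (bar (\<delta> l))"
  proof (cases l rule: bar_list.cases)
    case (1 q r l')
    show ?thesis
      using assoc[of p q r] by (cases "pmult p q"; cases "pmult q r") (simp_all add: 1 lm_pre)
  next
    case ("2_2" v)
    then show ?thesis by (cases "pmult p v") simp_all
  qed simp
qed (auto intro!: lin_intros)

lemma bar_bar: "bar (bar f) = 0"
proof (rule lin_eqI[of "\<lambda>f. bar (bar f)" "\<lambda>f. 0" UNIV])
  fix l show "bar (bar (\<delta> l)) = 0"
  proof (induction l rule: bar_list.induct)
    case (1 p q r)
    have pre: "bar (pre p f) = lmult p f - pre p (bar f)" if "f \<in> homog (Suc n)" for f n
      by (rule homog_eqI[OF _ _ _ that]) (auto intro!: lin_intros simp: length_Suc_conv)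
    show ?case
    proof (cases r)
      case Nil
      then show ?thesis by (cases "pmult p q") simp_all
    next
      case (Cons r1 r')
      have "bar_list (q # r) \<in> homog (Suc (length r'))" using bar_hom[of "\<delta> (q # r)" "Suc (length r)"] Cons by simp
      moreover have "bar (delta_opt (pmult p q) [] r) = lmult p (bar_list (q # r))"
        using bar_lm[of p "\<delta> (q # r)"] by simp
      ultimately show ?thesis using 1 pre by simp
    qed
  qed auto
qed (auto intro!: lin_intros)

lemma bar_rm: "bar (rmult q f) = rmult q (bar f)"
proof (rule lin_eqI[of "\<lambda>f. bar (rmult q f)" "\<lambda>f. rmult q (bar f)" UNIV])
  fix l show "bar (rmult q (\<delta> l)) = rmult q (bar (\<delta> l))"
  proof (induction l rule: bar_list.induct)
    case (1 p p' r)
    show ?case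
    proof (cases r rule: rev_cases)
      case Nil
      show ?thesis
        using rm_delta(1)[of q "[p]" p'] rm_delta(1)[of q "[]"] Nil assoc[of p p' q]
        by (cases "pmult p p'"; cases "pmult p' q") simp_all
    next
      case (snoc r' x)
      have "bar_list (p' # r) \<in> homog (Suc (length r'))" using bar_hom[of "\<delta> (p' # r)" "Suc (length r)"] snoc by simp
      then have 2: "rmult q (pre p (bar_list (p' # r))) = pre p (bar (rmult q (\<delta> (p' # r))))"
        using rm_pre[of "bar_list (p' # r)" "Suc (length r')" q p] 1 by simp
      have 3: "rmult q (delta_opt (pmult p p') [] r) = delta_opt (pmult p p') [] (butlast r @ [u])" if "pmult x q = Some u" for u
        using rm_delta(1)[of q "v # r'" x for v] that snoc by (cases "pmult p p'") simp_all
      have 4: "rmult q (delta_opt (pmult p p') [] r) = 0" if "pmult x q = None"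
        using rm_delta(1)[of q "v # r'" x for v] that snoc by (cases "pmult p p'") simp_all
      have "rmult q (\<delta> (p # p' # r)) = delta_opt (pmult x q) (p # p' # r') []" "rmult q (\<delta> (p' # r)) = delta_opt (pmult x q) (p' # r') []"
        using rm_delta(1)[of q "p # p' # r'" x] rm_delta(1)[of q "p' # r'" x] snoc by simp_all
      then show ?thesis using 2 3 4 snoc by (cases "pmult x q") simp_all
    qed
  next
    case ("2_2" v)
    then show ?case using rm_delta(1)[of q "[]" v] by (cases "pmult v q") simp_all
  qed auto
qed (auto intro!: lin_intros)

lemma hb_single: "hb (\<delta> [p]) = 0"
  by (simp add: hb_def t_delta mult_hd_def)

lemma hb_hb_snoc: assumes "w \<noteq> []" shows "hb (hb (\<delta> (w @ [q]))) = 0"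
proof (cases w rule: rev_cases)
  case (snoc w' q')
  show ?thesis
  proof (cases w')
    case Nil
    have "hb (delta_opt u [] []) = 0" for u
      by (cases u) (simp_all add: hb_single)
    then show ?thesis
      using snoc Nil hb_snoc[of w q] rm_delta(1)[of q "[]" q'] by simp
  next
    case (Cons p m)
    let ?s = "(- 1) ^ length w' :: 'k"
    \<comment> \<open>The face that merges \<open>q'\<close>, \<open>q\<close> and the first letter.
      It occurs in \<open>T2\<close> and in \<open>T3\<close>, with the same value by associativity,
      and these enter the sum with opposite signs.\<close>
    define X where "X = (case pmult q' q of None \<Rightarrow> 0 | Some u \<Rightarrow> lmult u (\<delta> w'))"
    have ss: "?s * ?s = 1" by (simp add: power_mult_distrib[symmetric])
    have bw: "bar (\<delta> w) \<in> homog (Suc (length m))"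
      using bar_hom[of "\<delta> w" "length w"] snoc Cons by simp
    have T1: "hb (suf q (bar (\<delta> w))) = - fscale ?s (rmult q (bar (\<delta> w))) + fscale ?s (lmult q (bar (\<delta> w)))"
      using hb_suf[OF bw] bar_bar[of "\<delta> w"] Cons by simp
    have T2: "hb (rmult q (\<delta> w)) = rmult q (bar (\<delta> w)) + fscale ?s X"
    proof -
      have rmult: "rmult q (\<delta> w) = delta_opt (pmult q' q) w' []" using snoc by simp
      have "hb (delta_opt u w' []) = bar (delta_opt u w' []) + fscale ?s (case u of None \<Rightarrow> 0 | Some u \<Rightarrow> lmult u (\<delta> w'))" for u
        using hb_snoc[of w'] bar_snoc[of w'] Cons by (cases u) simp_all
      then show ?thesis unfolding bar_rm[symmetric] rmult X_def by simp
    qed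
    have T3: "hb (lmult q (\<delta> w)) = lmult q (bar (\<delta> w)) + fscale ?s X"
    proof -
      have lmw: "lmult q (\<delta> w) = delta_opt (pmult q p) [] (m @ [q'])" using snoc Cons by simp
      have "hb (delta_opt u [] (m @ [q'])) = bar (delta_opt u [] (m @ [q'])) + fscale ?s (lmult q' (delta_opt u [] m))" for u
        using hb_snoc[of "v # m" q' for v] bar_snoc[of "v # m" q' for v] Cons by (cases u) simp_all
      moreover have "lmult q' (delta_opt (pmult q p) [] m) = X"
        using assoc[of q' q p] unfolding X_def Cons by (cases "pmult q' q"; cases "pmult q p") simp_all
      ultimately show ?thesis unfolding bar_lm[symmetric] lmw by simp
    qed
    have "hb (\<delta> (w @ [q])) = suf q (bar (\<delta> w)) + fscale ?s (rmult q (\<delta> w)) - fscale ?s (lmult q (\<delta> w))"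
      using hb_snoc[OF assms] snoc by simp
    then show ?thesis by (simp add: T1 T2 T3 free_vs.scale_right_distrib ss del: bar_delta)
  qed
qed (use assms in simp)

lemma hb_hb: assumes "f \<in> homog L" "0 < L" shows "hb (hb f) = 0"
proof (rule homog_eqI[OF _ _ _ assms(1)])
  fix l :: "'p list" assume l: "length l = L"
  show "hb (hb (\<delta> l)) = 0"
  proof (cases l rule: rev_cases)
    case (snoc w q)
    show ?thesis
    proof (cases "w = []")
      case True
      then show ?thesis using snoc by (simp add: hb_single)
    qed (use snoc hb_hb_snoc in simp)
  qed (use l assms(2) in simp)
qed (intro lin_intros)+

text \<open>The extra degeneracy. It stands in for prefixing the unit, a sum of vertices, of which
  only the left unit of the first letter contributes to a cyclically composable word.\<close>

definition sK :: "('p list \<Rightarrow>\<^sub>0 'k) \<Rightarrow> ('p list \<Rightarrow>\<^sub>0 'k)" where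
  "sK = lin_ext (\<lambda>l. \<delta> (idl (hd l) # l))"

definition BK :: "('p list \<Rightarrow>\<^sub>0 'k) \<Rightarrow> ('p list \<Rightarrow>\<^sub>0 'k)" where
  "BK f = (let g = sK (free_N f) in g - free_t g)"

lemma lin_s: "lin sK" unfolding sK_def by (rule lin_lin_ext)
lemmas [lin_intros] = lin_comp[OF lin_s]
lemmas s_simps [simp] = lin_simps[OF lin_s]
lemma s_delta [simp]: "sK (\<delta> l) = \<delta> (idl (hd l) # l)" by (simp add: sK_def)

lemma lin_BK: "lin BK"
  unfolding BK_def[abs_def] Let_def by (intro lin_intros)
lemmas [lin_intros] = lin_comp[OF lin_BK]
lemmas BK_simps [simp] = lin_simps[OF lin_BK]

lemma s_hom: "f \<in> homog L \<Longrightarrow> sK f \<in> homog (Suc L)"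
  by (rule homog_lin[OF lin_s, of L]) auto

lemma s_pre: "sK (pre p f) = pre (idl p) (pre p f)"
  by (rule lin_eqI[of "\<lambda>f. sK (pre p f)" "\<lambda>f. pre (idl p) (pre p f)" UNIV]) (auto intro!: lin_intros)

text \<open>The extra degeneracy contracts the bar complex: the first face undoes it, and by
  \<open>idl_mult\<close> it passes all the other faces.\<close>

lemma bar_s: assumes "f \<in> homog L" "0 < L" shows "bar (sK f) + sK (bar f) = f"
proof (rule homog_eqI[OF _ _ _ assms(1)])
  fix l :: "'p list" assume l: "length l = L"
  show "bar (sK (\<delta> l)) + sK (bar (\<delta> l)) = \<delta> l"
  proof (cases l rule: bar_list.cases)
    case (1 p q r)
    have "sK (delta_opt (pmult p q) [] r) = pre (idl p) (delta_opt (pmult p q) [] r)" by (cases "pmult p q") (auto simp: idl_mult)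
    then show ?thesis using 1 by (simp add: idl_left s_pre)
  qed (use l assms(2) in \<open>simp_all add: idl_left\<close>)
qed (intro lin_intros)+

lemma BK_BK: assumes "f \<in> homog L" "0 < L" shows "BK (BK f) = 0"
proof -
  have "sK (free_N f) \<in> homog (Suc L)" using N_hom s_hom assms by blast
  then have "free_N (BK f) = 0" unfolding BK_def Let_def by (simp add: Nt)
  then show ?thesis unfolding BK_def[of "BK f"] Let_def by simp
qed

text \<open>The computation \<open>b (1 - t) s N = (1 - t) b' s N = (1 - t) (N - s b' N) = - (1 - t)
  s N b\<close>, where \<open>(1 - t) N = 0\<close>.\<close>

lemma hb_BK: assumes f: "f \<in> homog L" "0 < L" shows "hb (BK f) + BK (hb f) = 0"
proof -
  have g: "sK (free_N f) \<in> homog (Suc L)" using N_hom s_hom f by blast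
  have "bar (sK (free_N f)) = free_N f - sK (free_N (hb f))"
    using bar_s[OF N_hom[OF f] f(2)] bar_N[OF f] by (simp add: algebra_simps)
  then have "hb (BK f) = (free_N f - free_t (free_N f)) - (sK (free_N (hb f)) - free_t (sK (free_N (hb f))))"
    unfolding BK_def[of f] Let_def using hb_t[OF g] by simp
  then show ?thesis using tN[OF f] by (simp add: BK_def Let_def)
qed

end

section \<open>Words that can occur in the values of the operators\<close>

context partial_mult
begin

definition faces :: "'p list \<Rightarrow> 'p list set" where
  "faces l = {xs @ u # ys |xs p q ys u. l = xs @ p # q # ys \<and> pmult p q = Some u}
     \<union> {u # m |p m q u. l = p # m @ [q] \<and> pmult q p = Some u}"

lemma keys_barb:
  "Poly_Mapping.keys (bar_list l) \<subseteq> {xs @ u # ys |xs p q ys u. l = xs @ p # q # ys \<and> pmult p q = Some u}"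
proof (induction l rule: bar_list.induct)
  case (1 p q r)
  have "Poly_Mapping.keys (pre p (bar_list (q # r))) \<subseteq>
      {xs @ u # ys |xs p' q' ys u. p # q # r = xs @ p' # q' # ys \<and> pmult p' q' = Some u}"
  proof (rule keys_lin_subset[OF lin_pre _ 1])
    fix l assume "l \<in> {xs @ u # ys |xs p q' ys u. q # r = xs @ p # q' # ys \<and> pmult p q' = Some u}"
    then obtain xs p' q' ys u where "l = xs @ u # ys" "q # r = xs @ p' # q' # ys" "pmult p' q' = Some u" by blast
    then show "Poly_Mapping.keys (pre p (\<delta> l)) \<subseteq>
        {xs @ u # ys |xs p' q' ys u. p # q # r = xs @ p' # q' # ys \<and> pmult p' q' = Some u}"
      by simp (metis append_Cons)
  qed
  moreover have "Poly_Mapping.keys (delta_opt (pmult p q) [] r :: 'p list \<Rightarrow>\<^sub>0 'k) \<subseteq>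
      {xs @ u # ys |xs p' q' ys u. p # q # r = xs @ p' # q' # ys \<and> pmult p' q' = Some u}"
    by (cases "pmult p q") (simp_all, metis append_Nil)
  ultimately show ?case using keys_diff[of "delta_opt (pmult p q) [] r :: 'p list \<Rightarrow>\<^sub>0 'k" "pre p (bar_list (q # r))"] by simp blast
qed auto

lemma keys_hb: "Poly_Mapping.keys (hb (\<delta> l)) \<subseteq> faces l"
proof (cases "\<exists>p m q. l = p # m @ [q]")
  case True
  then obtain p m q where l: "l = p # m @ [q]" by blast
  have "Poly_Mapping.keys (mult_hd (free_t (\<delta> l)) :: 'p list \<Rightarrow>\<^sub>0 'k) \<subseteq> {u # m |u. pmult q p = Some u}"
    using l by (cases "pmult q p") (auto simp: t_delta in_keys_iff lookup_single when_def split: if_splits)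
  then show ?thesis
    unfolding hb_def faces_def using keys_barb[of l] keys_add[of "bar (\<delta> l)" "mult_hd (free_t (\<delta> l)) :: 'p list \<Rightarrow>\<^sub>0 'k"] l
    by (simp, blast)
next
  case False
  then have "l = [] \<or> (\<exists>p. l = [p])" by (metis list.exhaust rev_exhaust)
  then show ?thesis by (auto simp: hb_def t_delta mult_hd_def)
qed

lemma hb_closed:
  assumes "\<And>l. l \<in> S \<Longrightarrow> faces l \<subseteq> S'" "Poly_Mapping.keys f \<subseteq> S"
  shows "Poly_Mapping.keys (hb f) \<subseteq> S'"
  using keys_lin_subset[OF lin_hb _ assms(2), of S'] keys_hb assms(1) by blast

end

lemma t_closed:
  assumes "\<And>l. l \<in> S \<Longrightarrow> rrot l \<in> S" "Poly_Mapping.keys f \<subseteq> S"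
  shows "Poly_Mapping.keys (free_t f) \<subseteq> S"
proof (rule keys_lin_subset[OF lin_t _ assms(2)])
  fix l assume "l \<in> S"
  have "Poly_Mapping.keys (free_t (\<delta> l) :: 'a list \<Rightarrow>\<^sub>0 'b) \<subseteq> {rrot l}"
    by (auto simp: t_delta in_keys_iff lookup_single when_def split: if_splits)
  then show "Poly_Mapping.keys (free_t (\<delta> l) :: 'a list \<Rightarrow>\<^sub>0 'b) \<subseteq> S" using assms(1)[OF \<open>l \<in> S\<close>] by blast
qed

lemma N_closed:
  assumes "\<And>l. l \<in> S \<Longrightarrow> rrot l \<in> S" "Poly_Mapping.keys f \<subseteq> S"
  shows "Poly_Mapping.keys (free_N f) \<subseteq> S"
proof (rule keys_lin_subset[OF lin_N _ assms(2)])
  fix l assume l: "l \<in> S"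
  have "Poly_Mapping.keys ((free_t ^^ i) (\<delta> l)) \<subseteq> S" for i
    by (induction i) (use l in simp, simp add: t_closed[OF assms(1)])
  then have "free_N (\<delta> l) \<in> {f. Poly_Mapping.keys f \<subseteq> S}"
    unfolding free_N_def lin_ext_delta by (intro free_vs.subspace_sum[OF subspace_keys]) auto
  then show "Poly_Mapping.keys (free_N (\<delta> l)) \<subseteq> S" by simp
qed

context partial_category
begin

lemma BK_closed:
  assumes "\<And>l. l \<in> S \<Longrightarrow> rrot l \<in> S" "\<And>l. l \<in> S' \<Longrightarrow> rrot l \<in> S'" "\<And>l. l \<in> S \<Longrightarrow> idl (hd l) # l \<in> S'"
    and "Poly_Mapping.keys f \<subseteq> S"
  shows "Poly_Mapping.keys (BK f) \<subseteq> S'"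
proof -
  have "Poly_Mapping.keys (sK (free_N f)) \<subseteq> S'"
    by (rule keys_lin_subset[OF lin_s _ N_closed[OF assms(1,4)]]) (use assms(3) in auto)
  then show ?thesis
    using t_closed[OF assms(2), of "sK (free_N f)"] keys_diff[of "sK (free_N f)" "free_t (sK (free_N f))"]
    unfolding BK_def Let_def by blast
qed

end

section \<open>Cyclic paths in a quadratic monomial algebra\<close>

abbreviation (input) src :: "('v, 'e) path \<Rightarrow> 'v" where "src p \<equiv> fst p"
abbreviation (input) tgt :: "('v, 'e) path \<Rightarrow> 'v" where "tgt p \<equiv> snd (snd p)"
abbreviation (input) arrs :: "('v, 'e) path \<Rightarrow> 'e list" where "arrs p \<equiv> fst (snd p)"

locale quadratic_quiver = wf_digraph Q for Q :: "('v, 'e) pre_digraph" +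
  fixes rel :: "'e \<Rightarrow> 'e \<Rightarrow> bool" and field_type :: "'k::field itself"
begin

definition forbids :: "('v, 'e) path \<Rightarrow> ('v, 'e) path \<Rightarrow> bool" where
  "forbids p q \<longleftrightarrow> arrs p \<noteq> [] \<and> arrs q \<noteq> [] \<and> rel (last (arrs p)) (hd (arrs q))"

text \<open>The multiplication table of the quotient algebra in the basis of paths without a
  forbidden pair. As relations have length two, a product of such paths can vanish only through
  mismatched endpoints or at the seam.\<close>

definition pmult :: "('v, 'e) path \<Rightarrow> ('v, 'e) path \<Rightarrow> ('v, 'e) path option" where
  "pmult p q = (if tgt p = src q \<and> \<not> forbids p q then Some (src p, arrs p @ arrs q, tgt q) else None)"

definition idl :: "('v, 'e) path \<Rightarrow> ('v, 'e) path" where "idl p = (src p, [], src p)"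

sublocale partial_category pmult field_type idl
proof unfold_locales
  fix p q r :: "('v, 'e) path" and u
  show "Option.bind (pmult p q) (\<lambda>u. pmult u r) = Option.bind (pmult q r) (pmult p)"
    \<comment> \<open>When \<open>q\<close> has no arrows, both sides test the seam between
      \<open>p\<close> and \<open>r\<close>; otherwise the two seams are tested
      independently.\<close>
    by (cases "arrs q = []") (auto simp: pmult_def forbids_def)
  show "pmult (idl p) p = Some p" by (simp add: pmult_def forbids_def idl_def)
  show "pmult p q = Some u \<Longrightarrow> idl u = idl p" by (auto simp: pmult_def idl_def split: if_splits)
qed

definition good :: "('v, 'e) path \<Rightarrow> bool" where
  "good p \<longleftrightarrow> p \<in> paths Q \<and> successively (\<lambda>e f. \<not> rel e f) (arrs p)"

text \<open>Appending the head adds the seam between the last letter and the first; for a single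
  letter it says that the path is closed.\<close>

definition cell :: "('v, 'e) path list \<Rightarrow> bool" where
  "cell l \<longleftrightarrow> l \<noteq> [] \<and> (\<forall>p\<in>set l. good p) \<and> successively (\<lambda>p q. tgt p = src q) (l @ [hd l])"

definition K :: "int \<Rightarrow> (('v, 'e) path list \<Rightarrow>\<^sub>0 'k) set" where
  "K n = {f. Poly_Mapping.keys f \<subseteq> {l. cell l \<and> int (length l) = n + 1}}"

lemma pm_Some: "pmult p q = Some u \<longleftrightarrow> tgt p = src q \<and> \<not> forbids p q \<and> u = (src p, arrs p @ arrs q, tgt q)"
  by (auto simp: pmult_def)

lemma good_pm: assumes "good p" "good q" "pmult p q = Some u" shows "good u"
proof -
  have "awalk (src p) (arrs p) (tgt p)" "awalk (src q) (arrs q) (tgt q)"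
    using assms by (auto simp: good_def paths_def split_beta)
  then have "awalk (src p) (arrs p @ arrs q) (tgt q)" using assms(3) awalk_appendI by (auto simp: pm_Some)
  then show ?thesis using assms by (auto simp: good_def paths_def pm_Some successively_append_iff forbids_def)
qed

lemma good_idl: "good p \<Longrightarrow> good (idl p)"
  by (auto simp: good_def paths_def idl_def split_beta awalk_Nil_iff awalk_hd_in_verts)

lemma cell_rr: "cell l \<Longrightarrow> cell (rrot l)"
  by (cases l rule: rev_exhaust) (auto simp: cell_def successively_append_iff successively_Cons hd_append
      split: if_splits)

lemma cell_idl: "cell l \<Longrightarrow> cell (idl (hd l) # l)"
proof (induction l rule: rev_induct)
  case (snoc p l)
  then show ?case
    by (cases l) (auto simp: cell_def successively_append_iff successively_Cons good_idl idl_def hd_append split: if_splits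
        dest: good_idl)
qed (simp add: cell_def)

lemma cell_length: "cell l \<Longrightarrow> 0 < length l"
  by (auto simp: cell_def)

lemma cell_faces: assumes "cell l" "l' \<in> faces l" shows "cell l'"
proof -
  consider (inner) xs p q ys u where "l' = xs @ u # ys" "l = xs @ p # q # ys" "pmult p q = Some u"
    | (last) p m q u where "l' = u # m" "l = p # m @ [q]" "pmult q p = Some u"
    using assms(2) by (auto simp: faces_def)
  then show ?thesis
  proof cases
    case inner
    have "good u" using good_pm[OF _ _ inner(3)] assms(1) inner(2) by (auto simp: cell_def)
    then show ?thesis using assms(1) inner
      by (cases xs) (auto simp: cell_def successively_append_iff successively_Cons pm_Some hd_append split: if_splits)
  next
    case last
    have "good u" using good_pm[OF _ _ last(3)] assms(1) last(2) by (auto simp: cell_def)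
    then show ?thesis using assms(1) last
      by (cases m) (auto simp: cell_def successively_append_iff successively_Cons pm_Some hd_append split: if_splits)
  qed
qed

lemma length_faces: "l' \<in> faces l \<Longrightarrow> Suc (length l') = length l"
  by (auto simp: faces_def)

lemma subspace_K: "free_vs.subspace (K n)"
  unfolding K_def by (rule subspace_keys)

lemma K_neg: assumes "n < 0" shows "K n = {0}"
proof -
  have "\<not> (cell l \<and> int (length l) = n + 1)" for l using assms cell_length[of l] by (auto simp del: length_greater_0_conv)
  then have e: "{l. cell l \<and> int (length l) = n + 1} = {}" by blast
  show ?thesis unfolding K_def e by simp
qed

lemma K_hom: "f \<in> K n \<Longrightarrow> f \<in> homog (nat (n + 1))"
  by (auto simp: K_def homog_def)

lemma hb_K: "f \<in> K n \<Longrightarrow> hb f \<in> K (n - 1)"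
  unfolding K_def mem_Collect_eq
  by (erule hb_closed[rotated]) (use cell_faces length_faces in fastforce)

lemma BK_K: "f \<in> K n \<Longrightarrow> BK f \<in> K (n + 1)"
proof -
  have rrot: "cell (rrot l) \<and> int (length (rrot l)) = k" if "cell l \<and> int (length l) = k" for l k
    using that cell_rr[of l] length_rr[of l] cell_length[of l] by auto
  have "cell (idl (hd l) # l) \<and> int (length (idl (hd l) # l)) = n + 1 + 1" if "cell l \<and> int (length l) = n + 1" for l
    using that cell_idl[of l] by simp
  moreover assume "f \<in> K n"
  ultimately show ?thesis
    unfolding K_def mem_Collect_eq by (intro BK_closed[of "{l. cell l \<and> int (length l) = n + 1}"]) (use rrot in blast)+
qed

lemma mixed: "mixed_complex fscale K hb BK"
proof
  fix x n assume x: "x \<in> K n"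
  have "x = 0 \<or> x \<in> homog (nat (n + 1)) \<and> 0 < nat (n + 1)"
    using x K_neg[of n] K_hom[OF x] by (cases "n < 0") auto
  then show "hb (hb x) = 0" "BK (BK x) = 0" "hb (BK x) + BK (hb x) = 0"
    using hb_hb BK_BK hb_BK by auto
qed (use hb_K BK_K subspace_K K_neg in \<open>simp_all add: free_vs.scale_right_distrib\<close>)

text \<open>
  Faces, cyclic rotations and the insertion of vertices change the concatenated word of arrows
  only by a rotation, so \<open>cell_type\<close> splits \<open>K\<close> into mixed subcomplexes.  If every cyclically
  adjacent pair of arrows is forbidden, good paths have length at most one, so that there is no
  chain in degrees below \<open>cell_type\<close> and no nondegenerate one in degrees above \<open>cell_type + 1\<close>.
\<close>

definition word :: "('v, 'e) path list \<Rightarrow> 'e list" where "word l = concat (map arrs l)"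

definition all_rel :: "'e list \<Rightarrow> bool" where
  "all_rel w \<longleftrightarrow> w \<noteq> [] \<and> successively rel (w @ [hd w])"

text \<open>Words that are not forbidden all around share type 0 with the words of a single loop
  whose square is a relation. Both kinds have no homology above degree 1, so they need not be
  separated.\<close>

definition cell_type :: "('v, 'e) path list \<Rightarrow> nat" where
  "cell_type l = (if all_rel (word l) then length (word l) - 1 else 0)"

lemma all_rel_rotate: "all_rel (u @ v) \<longleftrightarrow> all_rel (v @ u)"
  by (cases "u = []"; cases "v = []") (auto simp: all_rel_def successively_append_iff successively_Cons)

lemma wd_faces: assumes "l' \<in> faces l" shows "\<exists>u v. word l = u @ v \<and> word l' = v @ u"
proof -
  consider (inner) xs p q ys u where "l' = xs @ u # ys" "l = xs @ p # q # ys" "pmult p q = Some u"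
    | (last) p m q u where "l' = u # m" "l = p # m @ [q]" "pmult q p = Some u"
    using assms by (auto simp: faces_def)
  then show ?thesis
  proof cases
    case inner
    then have "word l = [] @ word l'" "word l' = word l' @ []" by (auto simp: word_def pm_Some)
    then show ?thesis by metis
  next
    case last
    then have "word l = (arrs p @ word m) @ arrs q" "word l' = arrs q @ (arrs p @ word m)" by (auto simp: word_def pm_Some)
    then show ?thesis by metis
  qed
qed

lemma wd_rr: "l \<noteq> [] \<Longrightarrow> \<exists>u v. word l = u @ v \<and> word (rrot l) = v @ u"
  by (cases l rule: rev_exhaust) (auto simp: word_def)

lemma ty_wd: "\<exists>u v. word l = u @ v \<and> word l' = v @ u \<Longrightarrow> all_rel (word l') = all_rel (word l) \<and> cell_type l' = cell_type l"
  unfolding cell_type_def using all_rel_rotate by (metis length_append add.commute)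

lemma ty_idl: "cell_type (idl p # l) = cell_type l" by (simp add: cell_type_def word_def idl_def)

definition P :: "nat \<Rightarrow> (('v, 'e) path list \<Rightarrow>\<^sub>0 'k) \<Rightarrow> (('v, 'e) path list \<Rightarrow>\<^sub>0 'k)" where
  "P m = lin_ext (\<lambda>l. if cell_type l = m then \<delta> l else 0)"

lemma lin_P: "lin (P m)" unfolding P_def by (rule lin_lin_ext)
lemmas [lin_intros] = lin_comp[OF lin_P]
lemmas P_simps [simp] = lin_simps[OF lin_P]
lemma P_delta: "P m (\<delta> l) = (if cell_type l = m then \<delta> l else 0)" by (simp add: P_def)

lemma P_const: "Poly_Mapping.keys f \<subseteq> {l. cell_type l = k} \<Longrightarrow> P m f = (if k = m then f else 0)"
  using lin_eqI[OF lin_P lin_ident, of "{l. cell_type l = k}" m f] lin_eqI[OF lin_P lin_const0, of "{l. cell_type l = k}" m f]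
  by (auto simp: P_delta)

lemma P_K: "f \<in> K n \<Longrightarrow> P m f \<in> K n"
  unfolding K_def mem_Collect_eq by (erule keys_lin_subset[OF lin_P, rotated]) (auto simp: P_delta)

lemma keys_P: "Poly_Mapping.keys (P m f) \<subseteq> {l. cell_type l = m}"
  by (rule keys_lin_subset[OF lin_P, of UNIV]) (auto simp: P_delta)

lemma P_hb: "P m (hb f) = hb (P m f)"
proof (rule lin_eqI[of "\<lambda>f. P m (hb f)" "\<lambda>f. hb (P m f)" UNIV])
  fix l
  have "Poly_Mapping.keys (hb (\<delta> l)) \<subseteq> {l'. cell_type l' = cell_type l}"
    using keys_hb[of l] wd_faces ty_wd by blast
  from P_const[OF this] show "P m (hb (\<delta> l)) = hb (P m (\<delta> l))" by (simp add: P_delta)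
qed (auto intro!: lin_intros)

lemma P_BK: "f \<in> K n \<Longrightarrow> P m (BK f) = BK (P m f)"
proof (rule lin_eqI[of "\<lambda>f. P m (BK f)" "\<lambda>f. BK (P m f)" "{l. l \<noteq> []}"])
  fix l :: "('v, 'e) path list" assume "l \<in> {l. l \<noteq> []}"
  then have "Poly_Mapping.keys (BK (\<delta> l)) \<subseteq> {l'. l' \<noteq> [] \<and> cell_type l' = cell_type l}"
    by (intro BK_closed[of "{l'. l' \<noteq> [] \<and> cell_type l' = cell_type l}" "{l'. l' \<noteq> [] \<and> cell_type l' = cell_type l}"])
      (auto simp: ty_idl dest: ty_wd[OF wd_rr])
  then have "Poly_Mapping.keys (BK (\<delta> l)) \<subseteq> {l'. cell_type l' = cell_type l}" by blast
  from P_const[OF this] show "P m (BK (\<delta> l)) = BK (P m (\<delta> l))" by (simp add: P_delta)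
qed (auto intro!: lin_intros simp: K_def cell_def)

lemma sum_P: "finite T \<Longrightarrow> cell_type ` Poly_Mapping.keys f \<subseteq> T \<Longrightarrow> f = (\<Sum>m\<in>T. P m f)"
proof -
  assume T: "finite T" "cell_type ` Poly_Mapping.keys f \<subseteq> T"
  have "(\<lambda>f. f) f = (\<lambda>f. \<Sum>m\<in>T. P m f) f"
    by (rule lin_eqI[of "\<lambda>f. f" "\<lambda>f. \<Sum>m\<in>T. P m f" "{l. cell_type l \<in> T}"])
      (use T in \<open>auto intro!: lin_intros simp: P_delta\<close>)
  then show ?thesis by simp
qed

end

lemma lin_uminus [lin_intros]: "lin f \<Longrightarrow> lin (\<lambda>x. - f x)"
  by (rule linI) (simp_all add: lin_simps)

context partial_mult
begin

lemma bar_pre: "f \<in> homog (Suc n) \<Longrightarrow> bar (pre p f) = lmult p f - pre p (bar f)"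
  by (rule homog_eqI[of "\<lambda>f. bar (pre p f)" "\<lambda>f. lmult p f - pre p (bar f)"])
    (auto intro!: lin_intros simp: length_Suc_conv)

lemma mh_t_pre_suf:
  assumes "f \<in> homog n"
  shows "mult_hd (free_t (pre p (suf q f))) = fscale ((- 1) ^ Suc n) (case pmult q p of None \<Rightarrow> 0 | Some u \<Rightarrow> pre u f)"
proof (rule homog_eqI[OF _ _ _ assms])
  fix l :: "'p list" assume "length l = n"
  then show "mult_hd (free_t (pre p (suf q (\<delta> l)))) = fscale ((- 1) ^ Suc n) (case pmult q p of None \<Rightarrow> 0 | Some u \<Rightarrow> pre u (\<delta> l))"
    by (cases "pmult q p") (simp_all add: t_delta)
next
  show "lin (\<lambda>f. fscale ((- 1) ^ Suc n) (case pmult q p of None \<Rightarrow> 0 | Some u \<Rightarrow> pre u f))"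
    by (cases "pmult q p") (auto intro!: lin_intros)
qed (intro lin_intros)

end

context quadratic_quiver
begin

subsection \<open>Degenerate chains\<close>

lemma good_vertex: "good p \<Longrightarrow> arrs p = [] \<Longrightarrow> tgt p = src p"
  by (auto simp: good_def paths_def split_beta awalk_Nil_iff)

lemma pm_vertex_right: "good q \<Longrightarrow> arrs q = [] \<Longrightarrow> tgt p = src q \<Longrightarrow> pmult p q = Some p"
  using good_vertex[of q] by (auto simp: pmult_def forbids_def prod_eq_iff)

lemma pm_vertex_left: "good p \<Longrightarrow> arrs p = [] \<Longrightarrow> tgt p = src q \<Longrightarrow> pmult p q = Some q"
  using good_vertex[of p] by (auto simp: pmult_def forbids_def prod_eq_iff)

text \<open>
  Up to sign, doubling the first vertex among the letters after the head contracts the chains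
  which contain such a vertex.
\<close>

fun dup :: "('v, 'e) path list \<Rightarrow> (('v, 'e) path list \<Rightarrow>\<^sub>0 'k)" where
  "dup [] = 0"
| "dup (q # r) = (if arrs q = [] then \<delta> (q # q # r) else - pre q (dup r))"

definition hD :: "(('v, 'e) path list \<Rightarrow>\<^sub>0 'k) \<Rightarrow> (('v, 'e) path list \<Rightarrow>\<^sub>0 'k)" where
  "hD = lin_ext (\<lambda>l. case l of [] \<Rightarrow> 0 | p # r \<Rightarrow> pre p (dup r))"

lemma lin_hD: "lin hD" unfolding hD_def by (rule lin_lin_ext)
lemmas [lin_intros] = lin_comp[OF lin_hD]
lemmas hD_simps [simp] = lin_simps[OF lin_hD]
lemma hD_delta [simp]: "hD (\<delta> (p # r)) = pre p (dup r)" "hD (\<delta> []) = 0" by (simp_all add: hD_def)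

lemma dup_hom: "dup l \<in> homog (Suc (length l))"
proof (induction l)
  case (Cons q r)
  then show ?case
    using free_vs.subspace_neg[OF subspace_homog pre_hom[OF Cons, of q]] by simp
qed simp

lemma dup_no_vertex: "\<forall>p\<in>set l. arrs p \<noteq> [] \<Longrightarrow> dup l = 0"
  by (induction l) auto

lemma dup_snoc: "dup (m @ [q]) = (if \<exists>p\<in>set m. arrs p = [] then suf q (dup m)
    else if arrs q = [] then fscale ((- 1) ^ length m) (\<delta> (m @ [q, q])) else 0)"
  by (induction m) (auto simp: suf_pre)

lemma hD_pre_vertex: "arrs q = [] \<Longrightarrow> hD (pre p (pre q f)) = pre p (pre q (pre q f))"
  by (rule lin_eqI[of "\<lambda>f. hD (pre p (pre q f))" "\<lambda>f. pre p (pre q (pre q f))" UNIV]) (auto intro!: lin_intros)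

lemma hD_pre: "Poly_Mapping.keys f \<subseteq> {q # r |q r. arrs q \<noteq> []} \<Longrightarrow> hD (pre p f) = - pre p (hD f)"
  by (rule lin_eqI[of "\<lambda>f. hD (pre p f)" "\<lambda>f. 0 - pre p (hD f)" "{q # r |q r. arrs q \<noteq> []}", simplified])
    (auto intro!: lin_intros lin_minus[OF lin_const0, simplified])

lemma keys_barb_head:
  "arrs q \<noteq> [] \<Longrightarrow> Poly_Mapping.keys (bar_list (q # r)) \<subseteq> {q # r |q r. arrs q \<noteq> []}"
proof -
  assume q: "arrs q \<noteq> []"
  have "Poly_Mapping.keys (bar_list (q # r)) \<subseteq> {xs @ u # ys |xs p p' ys u. q # r = xs @ p # p' # ys \<and> pmult p p' = Some u}"
    by (rule keys_barb)
  also have "\<dots> \<subseteq> {q # r |q r. arrs q \<noteq> []}"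
  proof
    fix l assume "l \<in> {xs @ u # ys |xs p p' ys u. q # r = xs @ p # p' # ys \<and> pmult p p' = Some u}"
    then obtain xs p p' ys u where "l = xs @ u # ys" "q # r = xs @ p # p' # ys" "pmult p p' = Some u" by blast
    then show "l \<in> {q # r |q r. arrs q \<noteq> []}" using q by (cases xs; cases q) (auto simp: pm_Some)
  qed
  finally show ?thesis .
qed

text \<open>The faces that touch a doubled vertex all return the word, with alternating signs.
  Between two neighbours there are three of them, which leave one copy; in last place there are only
  two, which cancel. Hence the \<open>butlast\<close>.\<close>

lemma bar_hD:
  "successively (\<lambda>p q. tgt p = src q) l \<Longrightarrow> \<forall>p\<in>set l. good p \<Longrightarrow>
    bar (hD (\<delta> l)) + hD (bar (\<delta> l)) = (if \<exists>p\<in>set (butlast (tl l)). arrs p = [] then \<delta> l else 0)"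
proof (induction l rule: bar_list.induct)
  case (1 p q r)
  then have pq: "tgt p = src q" "good q" by auto
  show ?case
  proof (cases "arrs q = []")
    case True
    have pmult: "pmult p q = Some p" "pmult q q = Some q"
      using pm_vertex_right[OF pq(2) True] pq good_vertex[OF pq(2) True] by auto
    show ?thesis
    proof (cases r)
      case Nil
      then show ?thesis using True pmult by simp
    next
      case (Cons r1 r')
      have "pmult q r1 = Some r1" using pm_vertex_left[OF pq(2) True] 1(2) Cons by auto
      then have "bar_list (q # r) = \<delta> r - pre q (bar_list r)" using Cons by simp
      then show ?thesis using True pmult Cons by (simp add: hD_pre_vertex)
    qed
  next
    case False
    have f: "hD (\<delta> (q # r)) \<in> homog (Suc (Suc (length r)))" using pre_hom[OF dup_hom] by simp
    have "bar (hD (\<delta> (p # q # r))) = pre p (bar (hD (\<delta> (q # r)))) - lmult p (hD (\<delta> (q # r)))"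
      using False bar_pre[OF f, of p] by simp
    moreover have "lmult p (hD (\<delta> (q # r))) = hD (delta_opt (pmult p q) [] r)"
      by (cases "pmult p q") (simp_all add: lm_pre)
    moreover have "hD (bar (\<delta> (p # q # r))) = hD (delta_opt (pmult p q) [] r) + pre p (hD (bar (\<delta> (q # r))))"
      using hD_pre[OF keys_barb_head[OF False]] by simp
    ultimately have "bar (hD (\<delta> (p # q # r))) + hD (bar (\<delta> (p # q # r)))
        = pre p (bar (hD (\<delta> (q # r))) + hD (bar (\<delta> (q # r))))"
      by (simp del: bar_delta hD_delta)
    also have "\<dots> = pre p (if \<exists>p\<in>set (butlast (tl (q # r))). arrs p = [] then \<delta> (q # r) else 0)"
      using 1 by simp
    also have "\<dots> = (if \<exists>p\<in>set (butlast (tl (p # q # r))). arrs p = [] then \<delta> (p # q # r) else 0)"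
      using False by auto
    finally show ?thesis .
  qed
qed auto

definition nd :: "('v, 'e) path list \<Rightarrow> bool" where "nd l \<longleftrightarrow> (\<forall>p\<in>set (tl l). arrs p \<noteq> [])"

text \<open>The cyclic face supplies the case missing from \<open>bar_hD\<close>, in which the only
  vertex behind the head is the last letter.\<close>

lemma hb_hD: assumes l: "cell l" shows "hb (hD (\<delta> l)) + hD (hb (\<delta> l)) = (if nd l then 0 else \<delta> l)"
proof (cases "\<exists>p m q. l = p # m @ [q]")
  case False
  then obtain p where "l = [p]" using l by (metis cell_def list.exhaust rev_exhaust)
  then show ?thesis by (simp add: hb_single nd_def)
next
  case True
  then obtain p m q where lmult: "l = p # m @ [q]" by blast
  have good: "\<forall>p\<in>set l. good p" and qp: "tgt q = src p" and chain: "successively (\<lambda>p q. tgt p = src q) l"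
    using l unfolding cell_def lmult by (auto simp: successively_append_iff successively_Cons hd_append split: if_splits)
  have t: "mult_hd (free_t (\<delta> l)) = fscale ((- 1) ^ Suc (length m)) (delta_opt (pmult q p) [] m)"
    using mh_t_pre_suf[of "\<delta> m" "length m" p q] lmult by (cases "pmult q p") simp_all
  have "mult_hd (free_t (hD (\<delta> l))) + hD (mult_hd (free_t (\<delta> l)))
      = (if (\<forall>p\<in>set m. arrs p \<noteq> []) \<and> arrs q = [] then \<delta> l else 0)"
  proof (cases "\<exists>p\<in>set m. arrs p = []")
    case True
    then have "mult_hd (free_t (hD (\<delta> l))) = fscale ((- 1) ^ Suc (Suc (length m))) (case pmult q p of None \<Rightarrow> 0 | Some u \<Rightarrow> pre u (dup m))"
      using mh_t_pre_suf[OF dup_hom[of m], of p q] lmult dup_snoc[of m q] by simp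
    then show ?thesis using True unfolding t by (cases "pmult q p") auto
  next
    case no: False
    then have "hD (mult_hd (free_t (\<delta> l))) = 0"
      unfolding t using dup_no_vertex[of m] by (cases "pmult q p") auto
    moreover have "mult_hd (free_t (hD (\<delta> l))) = \<delta> l" if "arrs q = []"
    proof -
      have "pmult q p = Some p" using pm_vertex_left[of q p] good lmult that qp by auto
      moreover have "hD (\<delta> l) = fscale ((- 1) ^ length m) (pre p (suf q (\<delta> (m @ [q]))))"
        using lmult dup_snoc[of m q] no that by simp
      ultimately have "mult_hd (free_t (hD (\<delta> l))) = fscale ((- 1) ^ length m) (fscale ((- 1) ^ Suc (Suc (length m))) (\<delta> l))"
        using mh_t_pre_suf[of "\<delta> (m @ [q])" "Suc (length m)" p q] lmult by (simp del: pre_delta suf_delta) simp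
      then show ?thesis by (simp add: power_mult_distrib[symmetric])
    qed
    moreover have "hD (\<delta> l) = 0" if "arrs q \<noteq> []" using lmult dup_snoc[of m q] no that by simp
    ultimately show ?thesis using no by auto
  qed
  then show ?thesis
    using bar_hD[OF chain good] lmult unfolding hb_def nd_def
    by (auto simp: algebra_simps simp del: hD_delta bar_delta split: if_splits)
qed

lemma cell_dup: "cell (xs @ q # ys) \<Longrightarrow> arrs q = [] \<Longrightarrow> cell (xs @ q # q # ys)"
  using good_vertex[of q] by (cases xs) (auto simp: cell_def successively_append_iff successively_Cons hd_append
      split: if_splits)

lemma keys_dup: "Poly_Mapping.keys (dup l) \<subseteq> {xs @ q # q # ys |xs q ys. l = xs @ q # ys \<and> arrs q = []}"
proof (induction l)
  case (Cons p r)
  have "Poly_Mapping.keys (pre p (dup r)) \<subseteq> {xs @ q # q # ys |xs q ys. p # r = xs @ q # ys \<and> arrs q = []}"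
  proof (rule keys_lin_subset[OF lin_pre _ Cons])
    fix l assume "l \<in> {xs @ q # q # ys |xs q ys. r = xs @ q # ys \<and> arrs q = []}"
    then obtain xs q ys where "l = xs @ q # q # ys" "r = xs @ q # ys" "arrs q = []" by blast
    then have "p # l \<in> {xs @ q # q # ys |xs q ys. p # r = xs @ q # ys \<and> arrs q = []}"
      by (intro CollectI exI[of _ "p # xs"] exI[of _ q] exI[of _ ys]) auto
    then show "Poly_Mapping.keys (pre p (\<delta> l)) \<subseteq> {xs @ q # q # ys |xs q ys. p # r = xs @ q # ys \<and> arrs q = []}"
      unfolding pre_delta by (auto simp del: mem_Collect_eq)
  qed
  moreover have "p # p # r \<in> {xs @ q # q # ys |xs q ys. p # r = xs @ q # ys \<and> arrs q = []}" if "arrs p = []"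
    using that by (intro CollectI exI[of _ "[]"] exI[of _ p] exI[of _ r]) auto
  ultimately show ?case by (simp del: mem_Collect_eq)
qed simp

lemma hD_K: "f \<in> K n \<Longrightarrow> hD f \<in> K (n + 1)"
  unfolding K_def mem_Collect_eq
proof (erule keys_lin_subset[OF lin_hD, rotated])
  fix l assume l: "l \<in> {l. cell l \<and> int (length l) = n + 1}"
  then obtain p r where pr: "l = p # r" by (auto simp: cell_def neq_Nil_conv)
  have "Poly_Mapping.keys (hD (\<delta> l)) \<subseteq> {p # l' |l'. l' \<in> {xs @ q # q # ys |xs q ys. r = xs @ q # ys \<and> arrs q = []}}"
    unfolding pr hD_delta by (rule keys_lin_subset[OF lin_pre _ keys_dup]) auto
  also have "\<dots> \<subseteq> {l. cell l \<and> int (length l) = n + 1 + 1}"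
    using l cell_dup[of "p # xs" for xs] pr by fastforce
  finally show "Poly_Mapping.keys (hD (\<delta> l)) \<subseteq> {l. cell l \<and> int (length l) = n + 1 + 1}" .
qed

text \<open>By the homotopy identity a cycle differs from its nondegenerate part by the boundary of
  \<open>hD f\<close>. The bound on the support ensures that no new types of words appear.\<close>

lemma nondegenerate_representative:
  assumes f: "f \<in> K n" "hb f = 0"
  shows "\<exists>u\<in>K (n + 1). f - hb u \<in> K n \<and> Poly_Mapping.keys (f - hb u) \<subseteq> {l. nd l \<and> l \<in> Poly_Mapping.keys f}"
proof
  define R :: "(('v, 'e) path list \<Rightarrow>\<^sub>0 'k) \<Rightarrow> _" where "R = lin_ext (\<lambda>l. if nd l then \<delta> l else 0)"
  have R: "lin R" unfolding R_def by (rule lin_lin_ext)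
  have eq: "f - (hb (hD f) + hD (hb f)) = R f"
  proof (rule lin_eqI[of "\<lambda>f. f - (hb (hD f) + hD (hb f))" R "{l. cell l}"])
    show "\<delta> l - (hb (hD (\<delta> l)) + hD (hb (\<delta> l))) = R (\<delta> l)" if "l \<in> {l. cell l}" for l
      using hb_hD[of l] that by (auto simp: R_def simp del: hD_delta)
  qed (use f R in \<open>auto intro!: lin_intros simp: K_def\<close>)
  show "hD f \<in> K (n + 1)" by (rule hD_K[OF f(1)])
  have "Poly_Mapping.keys (R f) \<subseteq> {l. nd l \<and> l \<in> Poly_Mapping.keys f}"
    by (rule keys_lin_subset[OF R _ order_refl]) (auto simp: R_def)
  moreover have "f - hb (hD f) \<in> K n"
    using hb_K[OF hD_K[OF f(1)]] free_vs.subspace_diff[OF subspace_K f(1)] by simp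
  ultimately show "f - hb (hD f) \<in> K n \<and> Poly_Mapping.keys (f - hb (hD f)) \<subseteq> {l. nd l \<and> l \<in> Poly_Mapping.keys f}"
    using eq f(2) by simp
qed

subsection \<open>Nondegenerate chains\<close>

text \<open>The factorisations of a path with arrows as \<open>init p\<close> times
  \<open>lst p\<close> and as \<open>fstp p\<close> times \<open>rest p\<close> split off its last
  and its first arrow.\<close>

definition init :: "('v, 'e) path \<Rightarrow> ('v, 'e) path" where
  "init p = (src p, butlast (arrs p), tail Q (last (arrs p)))"
definition lst :: "('v, 'e) path \<Rightarrow> ('v, 'e) path" where
  "lst p = (tail Q (last (arrs p)), [last (arrs p)], tgt p)"
definition fstp :: "('v, 'e) path \<Rightarrow> ('v, 'e) path" where
  "fstp p = (src p, [hd (arrs p)], head Q (hd (arrs p)))"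
definition rest :: "('v, 'e) path \<Rightarrow> ('v, 'e) path" where
  "rest p = (head Q (hd (arrs p)), tl (arrs p), tgt p)"

lemma good_lst:
  assumes "good p" "arrs p \<noteq> []"
  shows "good (init p)" "good (lst p)" "pmult (init p) (lst p) = Some p"
proof -
  obtain es e where e: "arrs p = es @ [e]" using assms(2) by (metis rev_exhaust)
  have w: "awalk (src p) (es @ [e]) (tgt p)" using assms e by (auto simp: good_def paths_def split_beta)
  then have "awalk (src p) es (tail Q e)" "awalk (tail Q e) [e] (tgt p)"
    by (auto simp: awalk_append_iff awalk_Cons_iff)
  then show "good (init p)" "good (lst p)" "pmult (init p) (lst p) = Some p"
    using assms e by (auto simp: good_def paths_def init_def lst_def successively_append_iff pm_Some forbids_def prod_eq_iff)
qed

lemma good_fst: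
  assumes "good p" "arrs p \<noteq> []"
  shows "good (fstp p)" "good (rest p)" "pmult (fstp p) (rest p) = Some p"
proof -
  obtain es e where e: "arrs p = e # es" using assms(2) by (metis list.exhaust)
  have w: "awalk (src p) (e # es) (tgt p)" using assms e by (auto simp: good_def paths_def split_beta)
  then have "awalk (src p) [e] (head Q e)" "awalk (head Q e) es (tgt p)"
    by (auto simp: awalk_Cons_iff awalk_Nil_iff)
  then show "good (fstp p)" "good (rest p)" "pmult (fstp p) (rest p) = Some p"
    using assms e by (auto simp: good_def paths_def fstp_def rest_def successively_Cons pm_Some forbids_def prod_eq_iff)
qed

lemma init_pm: "good p \<Longrightarrow> length (arrs x) = 1 \<Longrightarrow> good x \<Longrightarrow> pmult p x = Some v \<Longrightarrow> init v = p \<and> lst v = x"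
  by (cases "arrs x") (auto simp: pm_Some init_def lst_def good_def paths_def awalk_Cons_iff awalk_Nil_iff prod_eq_iff split_beta)

lemma fst_pm: "length (arrs x) = 1 \<Longrightarrow> good x \<Longrightarrow> pmult x p = Some v \<Longrightarrow> fstp v = x \<and> rest v = p"
  by (cases "arrs x") (auto simp: pm_Some fstp_def rest_def good_def paths_def awalk_Cons_iff awalk_Nil_iff prod_eq_iff split_beta)

lemma cell_split:
  assumes "cell (xs @ u # ys)" "good p" "good q" "pmult p q = Some u" shows "cell (xs @ p # q # ys)"
proof -
  have "src u = src p" "tgt u = tgt q" "tgt p = src q" using assms(4) by (auto simp: pm_Some)
  then show ?thesis using assms(1-3)
    by (cases xs) (auto simp: cell_def successively_append_iff successively_Cons hd_append split: if_splits)
qed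

lemma wd_split: "pmult p q = Some u \<Longrightarrow> word (xs @ p # q # ys) = word (xs @ u # ys)"
  by (auto simp: word_def pm_Some)

section \<open>The complex of nondegenerate words that are not forbidden all around\<close>

definition C :: "nat \<Rightarrow> ('v, 'e) path list set" where
  "C n = {l. cell l \<and> nd l \<and> \<not> all_rel (word l) \<and> length l = Suc n}"

lemma C_split_first:
  assumes "u # ys \<in> C n" "good p" "good q" "pmult p q = Some u" "arrs q \<noteq> []"
  shows "p # q # ys \<in> C (Suc n)"
  using assms cell_split[of "[]" u ys p q] wd_split[of p q u "[]" ys] by (auto simp: C_def nd_def)

lemma C_split_second:
  assumes "a # u # ys \<in> C n" "good p" "good q" "pmult p q = Some u" "arrs p \<noteq> []" "arrs q \<noteq> []"
  shows "a # p # q # ys \<in> C (Suc n)"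
  using assms cell_split[of "[a]" u ys p q] wd_split[of p q u "[a]" ys] by (auto simp: C_def nd_def)

text \<open>Only the head may be a vertex, and a product with a letter that has arrows has arrows.
  So faces of nondegenerate words are nondegenerate, and these words span a subcomplex; no quotient
  by degenerate chains is taken.\<close>

lemma C_faces: assumes "l \<in> C (Suc n)" "l' \<in> faces l" shows "l' \<in> C n"
proof -
  have "nd l'"
  proof -
    consider (inner) xs p q ys u where "l' = xs @ u # ys" "l = xs @ p # q # ys" "pmult p q = Some u"
      | (last) p m q u where "l' = u # m" "l = p # m @ [q]" "pmult q p = Some u"
      using assms(2) by (auto simp: faces_def)
    then show ?thesis
    proof cases
      case inner
      then show ?thesis using assms(1) by (cases xs) (auto simp: C_def nd_def pm_Some)
    qed (use assms(1) in \<open>auto simp: C_def nd_def\<close>)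
  qed
  then show ?thesis
    using assms cell_faces[OF _ assms(2)] length_faces[OF assms(2)] ty_wd[OF wd_faces[OF assms(2)]] by (auto simp: C_def)
qed

abbreviation sp :: "('v, 'e) path list set \<Rightarrow> (('v, 'e) path list \<Rightarrow>\<^sub>0 'k) set" where
  "sp S \<equiv> {f. Poly_Mapping.keys f \<subseteq> S}"

lemma hb_C: "f \<in> sp (C (Suc n)) \<Longrightarrow> hb f \<in> sp (C n)"
  unfolding mem_Collect_eq by (erule hb_closed[rotated]) (use C_faces in blast)

text \<open>On nondegenerate cells these are the words that \<open>hN\<close> produces and also
  those on which it vanishes. As in a discrete Morse matching, \<open>hN\<close> pairs each
  remaining word of positive degree in \<open>C\<close> with one of them a degree higher.\<close>

definition Dn :: "('v, 'e) path list set" where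
  "Dn = {a # x # r |a x r. \<not> forbids a x \<and> length (arrs x) = 1}"

lemma Dn_iff: "a # x # r \<in> Dn \<longleftrightarrow> \<not> forbids a x \<and> length (arrs x) = 1"
  by (auto simp: Dn_def simp del: split_paired_Ex)

lemma rl_pm_left: "pmult a x = Some v \<Longrightarrow> arrs x \<noteq> [] \<Longrightarrow> forbids v b = forbids x b"
  and rl_pm_right: "pmult x b = Some w \<Longrightarrow> arrs x \<noteq> [] \<Longrightarrow> forbids a w = forbids a x"
  by (auto simp: pm_Some forbids_def)

text \<open>
  Splitting a letter off \<open>a\<close>, or off \<open>b\<close>, inverts the corresponding face up to terms that are
  closer to the span of \<open>Dn\<close>.
\<close>

definition hN :: "(('v, 'e) path list \<Rightarrow>\<^sub>0 'k) \<Rightarrow> (('v, 'e) path list \<Rightarrow>\<^sub>0 'k)" where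
  "hN = lin_ext (\<lambda>l. case l of
      a # b # r \<Rightarrow> if forbids a b then \<delta> (init a # lst a # b # r)
        else if 2 \<le> length (arrs b) then - \<delta> (a # fstp b # rest b # r) else 0
    | _ \<Rightarrow> 0)"

lemma lin_hN: "lin hN" unfolding hN_def by (rule lin_lin_ext)
lemmas [lin_intros] = lin_comp[OF lin_hN]
lemmas hN_simps [simp] = lin_simps[OF lin_hN]
lemma hN_delta: "hN (\<delta> (a # b # r)) = (if forbids a b then \<delta> (init a # lst a # b # r)
    else if 2 \<le> length (arrs b) then - \<delta> (a # fstp b # rest b # r) else 0)"
  by (simp add: hN_def)

lemma hN_Dn: "\<not> forbids a x \<Longrightarrow> length (arrs x) = 1 \<Longrightarrow> hN (pre a (pre x f)) = 0"
  by (rule lin_eqI[of "\<lambda>f. hN (pre a (pre x f))" "\<lambda>f. 0" UNIV]) (auto intro!: lin_intros simp: hN_delta)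

lemma keys_pre2: "Poly_Mapping.keys (pre a (pre x f)) \<subseteq> {a # x # r |r. True}"
proof -
  have "lin (\<lambda>f. pre a (pre x f))" by (intro lin_intros)
  from keys_lin_subset[OF this, of UNIV "{a # x # r |r. True}" f] show ?thesis by simp
qed

text \<open>
  A cell all of whose rotations are tight has a word all of whose adjacent pairs are forbidden.
  In the remaining cells the recursions below rotate until they reach a rotation that is not tight.
\<close>

definition tight :: "('v, 'e) path list \<Rightarrow> bool" where
  "tight l \<longleftrightarrow> length (arrs (hd l)) = 1 \<and> forbids (last l) (hd l)"

lemma not_gd_rotation: assumes "l \<noteq> []" "\<not> all_rel (word l)" shows "\<exists>k. \<not> tight (((\<lambda>l. rrot l) ^^ k) l)"
proof (rule ccontr)
  assume "\<not> ?thesis"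
  then have all: "tight (((\<lambda>l. rrot l) ^^ k) l)" for k by blast
  let ?n = "length l"
  have n: "0 < ?n" using assms(1) by simp
  have g: "tight (rotate i l)" if "i \<le> ?n" for i
    using all[of "?n - i"] rrpow_eq_rotate[OF assms(1) that] by simp
  \<comment> \<open>Tightness of the rotation by \<open>Suc i\<close> is a statement about the
    letters \<open>i\<close> and \<open>Suc i\<close> of \<open>l\<close>, the latter taken modulo
    the length.\<close>
  have nxt: "length (arrs (l ! (Suc i mod ?n))) = 1 \<and> forbids (l ! i) (l ! (Suc i mod ?n))" if "i < ?n" for i
  proof -
    have "hd (rotate (Suc i) l) = l ! (Suc i mod ?n)"
      using hd_rotate_conv_nth[OF assms(1), of "Suc i"] .
    moreover have "last (rotate (Suc i) l) = l ! i"
    proof -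
      have "last (rotate (Suc i) l) = rotate (Suc i) l ! (?n - 1)"
        using assms(1) by (metis last_conv_nth length_rotate rotate_is_Nil_conv)
      also have "\<dots> = l ! ((Suc i + (?n - 1)) mod ?n)" using n by (intro nth_rotate) simp
      also have "Suc i + (?n - 1) = i + ?n" using n by arith
      also have "(i + ?n) mod ?n = i" using that by simp
      finally show ?thesis .
    qed
    ultimately show ?thesis using g[of "Suc i"] that by (simp add: tight_def)
  qed
  have one: "length (arrs (l ! i)) = 1" if "i < ?n" for i
  proof (cases i)
    case 0
    then show ?thesis using nxt[of "?n - 1"] n by simp
  next
    case (Suc j)
    then show ?thesis using nxt[of j] that by simp
  qed
  have word: "word l = map (\<lambda>p. hd (arrs p)) l"
  proof -
    have "map arrs l = map (\<lambda>p. [hd (arrs p)]) l"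
    proof (rule map_cong[OF refl])
      fix p assume "p \<in> set l"
      then have "length (arrs p) = 1" using one by (metis in_set_conv_nth)
      then show "arrs p = [hd (arrs p)]" by (cases "arrs p") auto
    qed
    then have "word l = concat (map (\<lambda>p. [hd (arrs p)]) l)" unfolding word_def by (simp only:)
    also have "\<dots> = map (\<lambda>p. hd (arrs p)) l" by (induction l) auto
    finally show ?thesis .
  qed
  have rel: "rel (hd (arrs (l ! i))) (hd (arrs (l ! (Suc i mod ?n))))" if "i < ?n" for i
  proof -
    have "last (arrs (l ! i)) = hd (arrs (l ! i))" using one[OF that] by (cases "arrs (l ! i)") auto
    then show ?thesis using nxt[OF that] by (simp add: forbids_def)
  qed
  have "successively rel (word l @ [hd (word l)])"
    unfolding successively_conv_nth
  proof (intro allI impI)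
    fix i assume i: "Suc i < length (word l @ [hd (word l)])"
    then have "i < ?n" by (simp add: word)
    then show "rel ((word l @ [hd (word l)]) ! i) ((word l @ [hd (word l)]) ! Suc i)"
      using rel[of i] assms(1) by (cases "Suc i = ?n") (auto simp: word nth_append hd_conv_nth)
  qed
  then show False using assms word by (simp add: all_rel_def)
qed

lemma hb_three:
  "hb (\<delta> (a # b # c # m @ [z])) = delta_opt (pmult a b) [] (c # m @ [z]) - pre a (delta_opt (pmult b c) [] (m @ [z]))
    + pre a (pre b (bar_list (c # m @ [z]))) + fscale ((- 1) ^ (length m + 3)) (delta_opt (pmult z a) [] (b # c # m))"
  by (simp add: hb_def t_delta numeral_3_eq_3)

lemma hb_two:
  "hb (\<delta> (a # b # m @ [z])) = delta_opt (pmult a b) [] (m @ [z]) - pre a (bar_list (b # m @ [z]))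
    + fscale ((- 1) ^ (length m + 2)) (delta_opt (pmult z a) [] (b # m))"
  by (simp add: hb_def t_delta)

lemma C_Cons: "a # b # r \<in> C n \<Longrightarrow> good a \<and> good b \<and> tgt a = src b \<and> arrs b \<noteq> [] \<and> n = Suc (length r)"
  by (auto simp: C_def cell_def nd_def)

lemma pm_not_rl: "pmult p q = Some u \<Longrightarrow> \<not> forbids p q" by (simp add: pm_Some)

text \<open>
  If the last face of a split cell starts with a forbidden product, then the split off part was
  a vertex, so that the face is the cyclic rotation of the original cell.
\<close>

lemma pm_rl_vertex:
  assumes "pmult z a = Some u" "forbids u x" "\<not> forbids a x" "good a" shows "arrs a = [] \<and> u = z"
proof -
  have "arrs a = []"
  proof (rule ccontr)
    assume "arrs a \<noteq> []"
    then have "forbids a x" using assms(1,2) by (auto simp: pm_Some forbids_def)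
    then show False using assms(3) by simp
  qed
  then show ?thesis using assms(1) good_vertex[OF assms(4)] by (simp add: pm_Some prod_eq_iff)
qed

text \<open>
  Modulo boundaries every chain is equivalent to one supported on \<open>Dn\<close>.  On chains supported on
  \<open>Dn\<close> the operator \<open>1 - hN hb\<close> is nilpotent, so that there are no nonzero cycles among them.
\<close>

definition G :: "nat \<Rightarrow> (('v, 'e) path list \<Rightarrow>\<^sub>0 'k) set" where
  "G n = {hb u + d |u d. u \<in> sp (C (Suc n)) \<and> d \<in> sp (C n \<inter> Dn)}"

lemma subspace_G: "free_vs.subspace (G n)"
proof -
  have "free_vs.subspace {d + hb u |d u. d \<in> sp (C n \<inter> Dn) \<and> u \<in> sp (C (Suc n))}"
    by (rule subspace_image_sum[OF lin_hb subspace_keys subspace_keys])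
  moreover have "{d + hb u |d u. d \<in> sp (C n \<inter> Dn) \<and> u \<in> sp (C (Suc n))} = G n"
    unfolding G_def by (auto simp: add.commute)
  ultimately show ?thesis by simp
qed

lemma G_boundary: "u \<in> sp (C (Suc n)) \<Longrightarrow> hb u \<in> G n"
  and G_Dn: "d \<in> sp (C n \<inter> Dn) \<Longrightarrow> d \<in> G n"
proof -
  show "u \<in> sp (C (Suc n)) \<Longrightarrow> hb u \<in> G n"
    unfolding G_def by (rule CollectI, rule exI[of _ u], rule exI[of _ 0]) simp
  show "d \<in> sp (C n \<inter> Dn) \<Longrightarrow> d \<in> G n"
    unfolding G_def by (rule CollectI, rule exI[of _ 0], rule exI[of _ d]) simp
qed

lemma dl_sp: "(\<And>v. u = Some v \<Longrightarrow> l @ v # r \<in> S) \<Longrightarrow> delta_opt u l r \<in> sp S"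
  by (cases u) auto

lemma face_first: "pmult a b = Some u \<Longrightarrow> u # r \<in> faces (a # b # r)"
  unfolding faces_def by (metis (mono_tags, lifting) UnI1 append_Nil mem_Collect_eq)

lemma face_last: "pmult z a = Some u \<Longrightarrow> u # m \<in> faces (a # m @ [z])"
  unfolding faces_def by blast

lemma C_form: assumes "l \<in> C n" "2 \<le> n" shows "\<exists>a b m z. l = a # b # m @ [z]"
proof -
  have l: "3 \<le> length l" using assms by (simp add: C_def)
  show ?thesis
  proof (cases l rule: bar_list.cases)
    case (1 a b r)
    then have "r \<noteq> []" using l by auto
    then obtain m z where "r = m @ [z]" by (metis rev_exhaust)
    then show ?thesis using 1 by blast
  qed (use l in auto)
qed

text \<open>In the boundary of the word with \<open>a\<close> split as \<open>a' x\<close>, the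
  first face returns the given word and the inner ones keep \<open>a' # x\<close> in front, so they
  lie in \<open>Dn\<close>. Only the cyclic face changes the head. If it leaves \<open>Dn\<close>,
  then \<open>a'\<close> is a vertex and this face is the given word rotated by one letter.\<close>

lemma U1_step:
  assumes l: "a # b # m @ [z] \<in> C n" and forbids: "forbids a b"
  shows "\<delta> (a # b # m @ [z]) \<in> G n \<or> tight (a # b # m @ [z]) \<and>
    (forbids z a \<and> (z # a # b # m \<in> C n) \<and> (\<delta> (z # a # b # m) \<in> G n \<longrightarrow> \<delta> (a # b # m @ [z]) \<in> G n))"
proof -
  define a' x where "a' = init a" and "x = lst a"
  have ne: "arrs a \<noteq> []" using forbids by (simp add: forbids_def)
  have ga: "good a" using C_Cons[OF l] by simp
  have sp: "good a'" "good x" "pmult a' x = Some a" using good_lst[OF ga ne] by (auto simp: a'_def x_def)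
  have x1: "length (arrs x) = 1" by (simp add: x_def lst_def)
  then have xne: "arrs x \<noteq> []" by auto
  have l2: "a' # x # b # m @ [z] \<in> C (Suc n)" using C_split_first[OF l sp(1,2,3) xne] .
  have "pmult x b = None" using forbids by (simp add: x_def lst_def pmult_def forbids_def)
  then have eq: "hb (\<delta> (a' # x # b # m @ [z])) = \<delta> (a # b # m @ [z]) + pre a' (pre x (bar_list (b # m @ [z])))
      + fscale ((- 1) ^ (length m + 3)) (delta_opt (pmult z a') [] (x # b # m))"
    using hb_three[of a' x b m z] sp(3) by simp
  define d where "d = (fscale ((- 1) ^ (length m + 3)) (delta_opt (pmult z a') [] (x # b # m)) :: ('v, 'e) path list \<Rightarrow>\<^sub>0 'k)"
  have lastC: "u # x # b # m \<in> C n" if "pmult z a' = Some u" for u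
    using C_faces[OF l2] face_last[OF that, of "x # b # m"] by simp
  have d: "d \<in> sp (C n)"
    unfolding d_def by (rule free_vs.subspace_scale[OF subspace_keys], rule dl_sp) (use lastC in auto)
  have hbl2: "hb (\<delta> (a' # x # b # m @ [z])) \<in> sp (C n)" by (rule hb_C) (use l2 in simp)
  have "pre a' (pre x (bar_list (b # m @ [z]))) = hb (\<delta> (a' # x # b # m @ [z])) - \<delta> (a # b # m @ [z]) - d"
    unfolding eq d_def by simp
  also have "\<dots> \<in> sp (C n)"
    using free_vs.subspace_diff[OF subspace_keys free_vs.subspace_diff[OF subspace_keys hbl2] d] l by simp
  finally have Y: "pre a' (pre x (bar_list (b # m @ [z]))) \<in> sp (C n)" .
  have a'x: "\<not> forbids a' x" using pm_not_rl[OF sp(3)] .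
  have YD: "pre a' (pre x (bar_list (b # m @ [z]))) \<in> sp (C n \<inter> Dn)"
  proof -
    have "{a' # x # r |r. True} \<subseteq> Dn" using a'x x1 Dn_iff by blast
    then show ?thesis using Y keys_pre2[of a' x "bar_list (b # m @ [z])"] by blast
  qed
  have dl_eq: "\<delta> (a # b # m @ [z]) = hb (\<delta> (a' # x # b # m @ [z])) - pre a' (pre x (bar_list (b # m @ [z]))) - d"
    unfolding eq d_def by simp
  have res: "\<delta> (a # b # m @ [z]) \<in> G n" if "d \<in> G n"
    unfolding dl_eq using that G_boundary[of "\<delta> (a' # x # b # m @ [z])" n] l2 G_Dn[OF YD]
      free_vs.subspace_diff[OF subspace_G] by auto
  show ?thesis
  proof (cases "\<exists>u. pmult z a' = Some u \<and> forbids u x")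
    case False
    have "d \<in> sp (C n \<inter> Dn)"
      unfolding d_def by (rule free_vs.subspace_scale[OF subspace_keys], rule dl_sp)
        (use lastC False x1 in \<open>auto simp: Dn_iff\<close>)
    then show ?thesis using res G_Dn by blast
  next
    case True
    then obtain u where u: "pmult z a' = Some u" "forbids u x" by blast
    have v: "arrs a' = []" "u = z" using pm_rl_vertex[OF u a'x sp(1)] by auto
    have xa: "x = a" using pm_vertex_left[OF sp(1) v(1), of x] sp(3) by (auto simp: pm_Some prod_eq_iff)
    have "\<delta> (z # a # b # m) \<in> G n \<Longrightarrow> d \<in> G n"
      unfolding d_def u(1) dl_simps using v xa free_vs.subspace_scale[OF subspace_G] by simp
    then show ?thesis using lastC[OF u(1)] v xa u(2) x1 res by (auto simp: tight_def)
  qed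
qed

text \<open>\<open>k\<close> counts the rotations that remain until one is not tight; every tight
  step uses up one of them.\<close>

lemma U1_G:
  assumes "\<not> tight (((\<lambda>l. rrot l) ^^ k) l)" "l \<in> C n" "forbids (l ! 0) (l ! 1)" "2 \<le> n"
  shows "\<delta> l \<in> G n"
  using assms
proof (induction k arbitrary: l)
  case 0
  obtain a b m z where l: "l = a # b # m @ [z]"
    using C_form[OF 0(2,4)] by blast
  then show ?case using U1_step[of a b m z n] 0 by auto
next
  case (Suc k)
  obtain a b m z where l: "l = a # b # m @ [z]"
    using C_form[OF Suc.prems(2,4)] by blast
  have r: "rrot l = z # a # b # m" using l by simp
  have k: "\<not> tight (((\<lambda>l. rrot l) ^^ k) (z # a # b # m))"
    using Suc.prems(1) unfolding funpow_Suc_right comp_def r by simp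
  show ?case using U1_step[of a b m z n] Suc.IH[OF k] Suc.prems l by auto
qed

text \<open>Now the first arrow of \<open>b\<close> is split off, and the word returns as the second
  face. The first face has a shorter second letter, the inner ones lie in \<open>Dn\<close>, and the
  cyclic face either lies in \<open>Dn\<close> or begins with a forbidden pair and is covered by
  \<open>U1\<close>.\<close>

lemma U2_step:
  assumes l: "a # b # m @ [z] \<in> C n" and forbids: "\<not> forbids a b" and b2: "2 \<le> length (arrs b)"
    and U1: "\<And>l. l \<in> C n \<Longrightarrow> forbids (l ! 0) (l ! 1) \<Longrightarrow> \<delta> l \<in> G n"
    and IH: "\<And>a' b'. a' # b' # m @ [z] \<in> C n \<Longrightarrow> \<not> forbids a' b' \<Longrightarrow> length (arrs b') < length (arrs b) \<Longrightarrow>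
      \<delta> (a' # b' # m @ [z]) \<in> G n"
  shows "\<delta> (a # b # m @ [z]) \<in> G n"
proof -
  define x y where "x = fstp b" and "y = rest b"
  have gb: "good a" "good b" "arrs b \<noteq> []" "tgt a = src b" using C_Cons[OF l] by auto
  have sp: "good x" "good y" "pmult x y = Some b" using good_fst[OF gb(2,3)] by (auto simp: x_def y_def)
  have x1: "length (arrs x) = 1" by (simp add: x_def fstp_def)
  have y1: "length (arrs y) < length (arrs b)" "arrs y \<noteq> []" using b2 by (cases "arrs b"; auto simp: y_def rest_def)+
  have l2: "a # x # y # m @ [z] \<in> C (Suc n)" using C_split_second[OF l sp(1,2,3) _ y1(2)] x1 by (cases "arrs x") auto
  have ax: "\<not> forbids a x" using forbids gb by (auto simp: forbids_def x_def fstp_def)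
  then obtain v where v: "pmult a x = Some v" using gb(4) by (auto simp: pmult_def x_def fstp_def)
  have "arrs x \<noteq> []" using x1 by auto
  then have vy: "\<not> forbids v y" using rl_pm_left[OF v] pm_not_rl[OF sp(3)] by simp
  have eq: "hb (\<delta> (a # x # y # m @ [z])) = \<delta> (v # y # m @ [z]) - \<delta> (a # b # m @ [z]) + pre a (pre x (bar_list (y # m @ [z])))
      + fscale ((- 1) ^ (length m + 3)) (delta_opt (pmult z a) [] (x # y # m))"
    using hb_three[of a x y m z] sp(3) v by simp
  define d where "d = (fscale ((- 1) ^ (length m + 3)) (delta_opt (pmult z a) [] (x # y # m)) :: ('v, 'e) path list \<Rightarrow>\<^sub>0 'k)"
  have lastC: "u # x # y # m \<in> C n" if "pmult z a = Some u" for u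
    using C_faces[OF l2] face_last[OF that, of "x # y # m"] by simp
  have vC: "v # y # m @ [z] \<in> C n" using C_faces[OF l2 face_first[OF v]] .
  have d: "d \<in> sp (C n)"
    unfolding d_def by (rule free_vs.subspace_scale[OF subspace_keys], rule dl_sp) (use lastC in auto)
  have hbl2: "hb (\<delta> (a # x # y # m @ [z])) \<in> sp (C n)" by (rule hb_C) (use l2 in simp)
  have "pre a (pre x (bar_list (y # m @ [z]))) = hb (\<delta> (a # x # y # m @ [z])) - \<delta> (v # y # m @ [z]) + \<delta> (a # b # m @ [z]) - d"
    unfolding eq d_def by simp
  also have "\<dots> \<in> sp (C n)"
    using free_vs.subspace_diff[OF subspace_keys free_vs.subspace_add[OF subspace_keys free_vs.subspace_diff[OF subspace_keys hbl2]] d]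
      l vC by simp
  finally have Y: "pre a (pre x (bar_list (y # m @ [z]))) \<in> sp (C n)" .
  have YD: "pre a (pre x (bar_list (y # m @ [z]))) \<in> G n"
  proof (rule G_Dn)
    have "{a # x # r |r. True} \<subseteq> Dn" using ax x1 Dn_iff by blast
    then show "pre a (pre x (bar_list (y # m @ [z]))) \<in> sp (C n \<inter> Dn)"
      using Y keys_pre2[of a x "bar_list (y # m @ [z])"] by blast
  qed
  have dG: "d \<in> G n"
  proof -
    have "delta_opt (pmult z a) [] (x # y # m) \<in> G n"
    proof (cases "pmult z a")
      case None
      then show ?thesis using free_vs.subspace_0[OF subspace_G] by simp
    next
      case (Some u)
      show ?thesis
      proof (cases "forbids u x")
        case True
        then show ?thesis using U1[OF lastC[OF Some]] Some by simp
      next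
        case False
        then show ?thesis using lastC[OF Some] x1 Some by (intro G_Dn) (auto simp: Dn_iff)
      qed
    qed
    then show ?thesis unfolding d_def by (rule free_vs.subspace_scale[OF subspace_G])
  qed
  have "\<delta> (a # b # m @ [z]) = \<delta> (v # y # m @ [z]) - hb (\<delta> (a # x # y # m @ [z])) + pre a (pre x (bar_list (y # m @ [z]))) + d"
    unfolding eq d_def by simp
  also have "\<dots> \<in> G n"
    using IH[OF vC vy y1(1)] G_boundary[of "\<delta> (a # x # y # m @ [z])" n] l2 YD dG
      free_vs.subspace_diff[OF subspace_G] free_vs.subspace_add[OF subspace_G] by auto
  finally show ?thesis .
qed

text \<open>Words beginning with a forbidden pair are treated first, because the cyclic faces in
  \<open>U2_step\<close> may produce them.\<close>

lemma C_G: assumes n: "2 \<le> n" and l: "l \<in> C n" shows "\<delta> l \<in> G n"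
proof -
  have U1: "\<delta> l \<in> G n" if "l \<in> C n" "forbids (l ! 0) (l ! 1)" for l
  proof -
    have "l \<noteq> []" "\<not> all_rel (word l)" using that by (auto simp: C_def)
    then obtain k where "\<not> tight (((\<lambda>l. rrot l) ^^ k) l)" using not_gd_rotation by blast
    then show ?thesis using U1_G that n by blast
  qed
  have U2: "\<delta> (a # b # m @ [z]) \<in> G n" if "a # b # m @ [z] \<in> C n" "\<not> forbids a b" for a b m z
    using that
  proof (induction "length (arrs b)" arbitrary: a b rule: less_induct)
    case less
    show ?case
    proof (cases "2 \<le> length (arrs b)")
      case True
      then show ?thesis using U2_step[OF less.prems True U1] less.hyps by blast
    next
      case False
      moreover have "0 < length (arrs b)" using C_Cons[OF less.prems(1)] by simp
      ultimately have "length (arrs b) = 1" by linarith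
      then show ?thesis using less.prems by (intro G_Dn) (auto simp: Dn_iff)
    qed
  qed
  obtain a b m z where "l = a # b # m @ [z]" using C_form[OF l n] by blast
  then show ?thesis using U1[of l] U2[of a b m z] l by (cases "forbids a b") auto
qed

section \<open>Nilpotency on the span of the split words\<close>

definition Nop :: "(('v, 'e) path list \<Rightarrow>\<^sub>0 'k) \<Rightarrow> (('v, 'e) path list \<Rightarrow>\<^sub>0 'k)" where
  "Nop f = f - hN (hb f)"

lemma lin_Nop: "lin Nop" unfolding Nop_def[abs_def] by (intro lin_intros)
lemmas Noppow_simps [simp] = lin_simps[OF lin_funpow[OF lin_Nop]]

definition Nilp :: "(('v, 'e) path list \<Rightarrow>\<^sub>0 'k) set" where "Nilp = {f. \<exists>k. (Nop ^^ k) f = 0}"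

lemma subspace_Nil: "free_vs.subspace Nilp"
proof (rule free_vs.subspaceI)
  show "0 \<in> Nilp" by (auto simp: Nilp_def)
next
  fix x y assume "x \<in> Nilp" "y \<in> Nilp"
  then obtain k j where kj: "(Nop ^^ k) x = 0" "(Nop ^^ j) y = 0" by (auto simp: Nilp_def)
  have "(Nop ^^ (k + j)) x = 0" using kj(1) by (subst add.commute) (simp add: funpow_add)
  moreover have "(Nop ^^ (k + j)) y = 0" using kj(2) by (simp add: funpow_add)
  ultimately have "(Nop ^^ (k + j)) (x + y) = 0" by simp
  then show "x + y \<in> Nilp" unfolding Nilp_def by blast
next
  fix c x assume "x \<in> Nilp"
  then obtain k where "(Nop ^^ k) x = 0" by (auto simp: Nilp_def)
  then have "(Nop ^^ k) (fscale c x) = 0" by simp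
  then show "fscale c x \<in> Nilp" unfolding Nilp_def by blast
qed

lemma Nil_step: "Nop x \<in> Nilp \<Longrightarrow> x \<in> Nilp"
proof -
  assume "Nop x \<in> Nilp"
  then obtain k where "(Nop ^^ k) (Nop x) = 0" by (auto simp: Nilp_def)
  then have "(Nop ^^ Suc k) x = 0" by (simp only: funpow_Suc_right comp_def)
  then show "x \<in> Nilp" unfolding Nilp_def by blast
qed

text \<open>With a single arrow in second place, the cyclic face is killed by \<open>hN\<close>
  unless it begins with a forbidden pair, which happens only when the head was a vertex.\<close>

lemma hN_last:
  assumes C: "a # x # m @ [z] \<in> C n" and ax: "\<not> forbids a x" and x1: "length (arrs x) = 1"
  shows "hN (delta_opt (pmult z a) [] (x # m)) = (if arrs a = [] \<and> forbids z x then \<delta> (init z # lst z # x # m) else 0)"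
proof (cases "pmult z a")
  case None
  have "tgt z = src a" "good a" "good z" using C by (auto simp: C_def cell_def successively_append_iff successively_Cons hd_append split: if_splits)
  then have "arrs a \<noteq> []" using None by (auto simp: pmult_def forbids_def split: if_splits)
  then show ?thesis using None by simp
next
  case (Some u)
  have ga: "good a" using C_Cons[OF C] by simp
  show ?thesis
  proof (cases "forbids u x")
    case True
    then have "arrs a = []" "u = z" using pm_rl_vertex[OF Some True ax ga] by auto
    then show ?thesis using Some True by (simp add: hN_delta)
  next
    case False
    have "\<not> (arrs a = [] \<and> forbids z x)" using False Some by (auto simp: pm_Some forbids_def)
    then show ?thesis using Some False x1 by (auto simp: hN_delta)
  qed
qed

text \<open>The cyclic face absorbs the vertex in front, and splitting \<open>z\<close> gives back
  the lost letter; so the degree is unchanged and \<open>Nop\<close> can be iterated.\<close>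

lemma lastsplit_C:
  assumes C: "a # x # m @ [z] \<in> C n" and n: "2 \<le> n" and a: "arrs a = []" and zx: "forbids z x"
  shows "init z # lst z # x # m \<in> C n" "forbids (lst z) x"
proof -
  have "tgt z = src a" "good a" "good z" using C by (auto simp: C_def cell_def successively_append_iff successively_Cons hd_append split: if_splits)
  then have "pmult z a = Some z" using pm_vertex_right a by simp
  moreover obtain k where "n = Suc k" using n by (cases n) auto
  ultimately have "z # x # m \<in> C k" using C_faces[of _ k] face_last[of z a z "x # m"] C by simp
  moreover have "arrs z \<noteq> []" using zx by (simp add: forbids_def)
  moreover have "arrs (lst z) \<noteq> []" by (simp add: lst_def)
  ultimately show "init z # lst z # x # m \<in> C n"
    using C_split_first good_lst[OF \<open>good z\<close>] \<open>n = Suc k\<close> by blast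
  show "forbids (lst z) x" using zx by (simp add: forbids_def lst_def)
qed

text \<open>The first face \<open>v # b # m'\<close> begins with a forbidden pair, so
  \<open>hN\<close> splits it back into the given word and cancels it; only the cyclic face can
  leave a remainder.\<close>

lemma Nop_D1:
  assumes C: "a # x # b # m' \<in> C n" and m: "b # m' = m @ [z]" and ax: "\<not> forbids a x" and x1: "length (arrs x) = 1" and xb: "forbids x b"
  shows "Nop (\<delta> (a # x # b # m')) = (if arrs a = [] \<and> forbids z x
    then - fscale ((- 1) ^ (length m + 2)) (\<delta> (init z # lst z # x # m)) else 0)"
proof -
  have g: "good a" "good x" "tgt a = src x" using C_Cons[OF C] by auto
  then obtain v where v: "pmult a x = Some v" using ax by (auto simp: pmult_def)
  have iv: "init v = a" "lst v = x" using init_pm[OF g(1) x1 g(2) v] by auto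
  have "arrs x \<noteq> []" using x1 by auto
  then have vb: "forbids v b" using xb rl_pm_left[OF v] by simp
  have "pmult x b = None" using xb by (simp add: pmult_def)
  then have "hb (\<delta> (a # x # b # m')) = \<delta> (v # b # m') + pre a (pre x (bar_list (b # m')))
      + fscale ((- 1) ^ (length m + 2)) (delta_opt (pmult z a) [] (x # m))"
    using hb_two[of a x m z, folded m] v by simp
  moreover have "hN (delta_opt (pmult z a) [] (x # m)) = (if arrs a = [] \<and> forbids z x then \<delta> (init z # lst z # x # m) else 0)"
    by (rule hN_last[OF C[unfolded m] ax x1])
  ultimately show ?thesis by (simp add: Nop_def hN_delta hN_Dn[OF ax x1] iv vb)
qed

text \<open>Here it is the second face that \<open>hN\<close> splits back into the given word, the
  two minus signs cancelling. The first face contributes a word with a shorter third letter.\<close>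

lemma Nop_D2:
  assumes C: "a # x # b # m' \<in> C n" and m: "b # m' = m @ [z]" and ax: "\<not> forbids a x" and x1: "length (arrs x) = 1"
    and xb: "\<not> forbids x b" and v: "pmult a x = Some v"
  shows "Nop (\<delta> (a # x # b # m')) = (if 2 \<le> length (arrs b) then \<delta> (v # fstp b # rest b # m') else 0)
    - (if arrs a = [] \<and> forbids z x then fscale ((- 1) ^ (length m + 2)) (\<delta> (init z # lst z # x # m)) else 0)"
proof -
  have g: "good a" "good x" "tgt a = src x" using C_Cons[OF C] by auto
  have gb: "tgt x = src b" "arrs b \<noteq> []" using C by (auto simp: C_def cell_def nd_def)
  then obtain w where w: "pmult x b = Some w" using xb by (auto simp: pmult_def)
  have fw: "fstp w = x" "rest w = b" using fst_pm[OF x1 g(2) w] by auto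
  have xne: "arrs x \<noteq> []" using x1 by auto
  then have aw: "\<not> forbids a w" using ax rl_pm_right[OF w] by simp
  have w2: "2 \<le> length (arrs w)" using w x1 gb(2) by (cases "arrs b") (auto simp: pm_Some)
  have vb: "\<not> forbids v b" using xb rl_pm_left[OF v xne] by simp
  have "hb (\<delta> (a # x # b # m')) = \<delta> (v # b # m') - \<delta> (a # w # m') + pre a (pre x (bar_list (b # m')))
      + fscale ((- 1) ^ (length m + 2)) (delta_opt (pmult z a) [] (x # m))"
    using hb_two[of a x m z, folded m] v w by simp
  moreover have "hN (delta_opt (pmult z a) [] (x # m)) = (if arrs a = [] \<and> forbids z x then \<delta> (init z # lst z # x # m) else 0)"
    by (rule hN_last[OF C[unfolded m] ax x1])
  ultimately show ?thesis by (simp add: Nop_def hN_delta hN_Dn[OF ax x1] fw aw vb w2)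
qed

text \<open>A head with arrows is killed in one step. With a vertex as head, the remainder arises
  from the rotated tail: either its new head has arrows, or one rotation has been used up.\<close>

lemma D1_Nil:
  assumes n: "2 \<le> n"
  shows "a # x # b # m' \<in> C n \<Longrightarrow> \<not> forbids a x \<Longrightarrow> length (arrs x) = 1 \<Longrightarrow> forbids x b \<Longrightarrow>
    arrs a \<noteq> [] \<or> \<not> tight (((\<lambda>l. rrot l) ^^ k) (x # b # m')) \<Longrightarrow> \<delta> (a # x # b # m') \<in> Nilp"
proof (induction k arbitrary: a x b m')
  case (0 a x b m')
  obtain m z where m: "b # m' = m @ [z]" by (metis rev_exhaust list.distinct(1))
  then have "last (b # m') = z" by (metis last_snoc)
  then have "\<not> (arrs a = [] \<and> forbids z x)" using 0 by (auto simp: tight_def)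
  then have "Nop (\<delta> (a # x # b # m')) = 0" using Nop_D1[OF 0(1) m 0(2-4)] by auto
  then show ?case using Nil_step free_vs.subspace_0[OF subspace_Nil] by simp
next
  case (Suc k a x b m')
  obtain m z where m: "b # m' = m @ [z]" by (metis rev_exhaust list.distinct(1))
  show ?case
  proof (cases "arrs a = [] \<and> forbids z x")
    case False
    then have "Nop (\<delta> (a # x # b # m')) = 0" using Nop_D1[OF Suc(2) m Suc(3-5)] by auto
    then show ?thesis using Nil_step free_vs.subspace_0[OF subspace_Nil] by simp
  next
    case True
    have C: "a # x # m @ [z] \<in> C n" using Suc(2) m by simp
    have C': "init z # lst z # x # m \<in> C n" "forbids (lst z) x" using lastsplit_C[OF C n] True by auto
    have gz: "good z" "arrs z \<noteq> []" using C True by (auto simp: C_def cell_def forbids_def)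
    have "arrs (init z) \<noteq> [] \<or> \<not> tight (((\<lambda>l. rrot l) ^^ k) (lst z # x # m))"
    proof (rule disjCI)
      assume "\<not> \<not> tight (((\<lambda>l. rrot l) ^^ k) (lst z # x # m))"
      moreover have "rrot (x # b # m') = z # x # m" using m by (simp add: last_snoc)
      then have "\<not> tight (((\<lambda>l. rrot l) ^^ k) (z # x # m))"
        using Suc.prems(5) True unfolding funpow_Suc_right comp_def by simp
      ultimately have "lst z \<noteq> z" by auto
      then show "arrs (init z) \<noteq> []"
        using good_lst[OF gz] pm_vertex_left[of "init z" "lst z"] by (auto simp: pm_Some)
    qed
    then have "\<delta> (init z # lst z # x # m) \<in> Nilp"
      using Suc.IH[OF C'(1) _ _ C'(2)] pm_not_rl[OF good_lst(3)[OF gz]] by (simp add: lst_def)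
    then have "Nop (\<delta> (a # x # b # m')) \<in> Nilp"
      using Nop_D1[OF Suc(2) m Suc(3-5)] True free_vs.subspace_neg[OF subspace_Nil] free_vs.subspace_scale[OF subspace_Nil] by auto
    then show ?thesis by (rule Nil_step)
  qed
qed

lemma D1_Nil':
  assumes n: "2 \<le> n" and C: "a # x # b # m' \<in> C n" and "\<not> forbids a x" "length (arrs x) = 1" "forbids x b"
  shows "\<delta> (a # x # b # m') \<in> Nilp"
proof (cases "arrs a = []")
  case True
  then have "word (x # b # m') = word (a # x # b # m')" by (simp add: word_def)
  then have "\<not> all_rel (word (x # b # m'))" using C by (simp add: C_def)
  then obtain k where "\<not> tight (((\<lambda>l. rrot l) ^^ k) (x # b # m'))" using not_gd_rotation by blast
  then show ?thesis using D1_Nil[OF assms] by blast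
qed (use D1_Nil[OF assms] in blast)

text \<open>Induction on the length of the third letter: the first face makes it shorter, and the
  remainder of the cyclic face is a word as in \<open>D1_Nil'\<close>.\<close>

lemma D2_Nil:
  assumes n: "2 \<le> n"
  shows "a # x # b # m' \<in> C n \<Longrightarrow> \<not> forbids a x \<Longrightarrow> length (arrs x) = 1 \<Longrightarrow> \<not> forbids x b \<Longrightarrow> \<delta> (a # x # b # m') \<in> Nilp"
proof (induction "length (arrs b)" arbitrary: a x b rule: less_induct)
  case less
  obtain m z where m: "b # m' = m @ [z]" by (metis rev_exhaust list.distinct(1))
  have g: "good a" "good x" "tgt a = src x" using C_Cons[OF less.prems(1)] by auto
  have gb: "good b" "tgt x = src b" "arrs b \<noteq> []" using less.prems(1) by (auto simp: C_def cell_def nd_def)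
  obtain v where v: "pmult a x = Some v" using g less.prems(2) by (auto simp: pmult_def)
  have 1: "\<delta> (v # fstp b # rest b # m') \<in> Nilp" if b2: "2 \<le> length (arrs b)"
  proof -
    have sp: "good (fstp b)" "good (rest b)" "pmult (fstp b) (rest b) = Some b" using good_fst[OF gb(1,3)] by auto
    have ne: "arrs (fstp b) \<noteq> []" "arrs (rest b) \<noteq> []" "length (arrs (rest b)) < length (arrs b)"
      using b2 by (cases "arrs b"; auto simp: fstp_def rest_def)+
    obtain k where k: "n = Suc k" using n by (cases n) auto
    have "v # b # m' \<in> C k" using C_faces[OF _ face_first[OF v]] less.prems(1) k by blast
    then have "v # fstp b # rest b # m' \<in> C n" using C_split_second[OF _ sp ne(1,2)] k by blast
    moreover have "arrs x \<noteq> []" using less.prems(3) by auto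
    then have "forbids v (fstp b) \<longleftrightarrow> forbids x (fstp b)" by (rule rl_pm_left[OF v])
    moreover have "forbids x (fstp b) \<longleftrightarrow> forbids x b" using gb by (auto simp: forbids_def fstp_def)
    ultimately have "\<not> forbids v (fstp b)" using less.prems(4) by blast
    then show ?thesis using less.hyps[OF ne(3)] pm_not_rl[OF sp(3)] \<open>v # fstp b # rest b # m' \<in> C n\<close>
      by (simp add: fstp_def)
  qed
  have 2: "\<delta> (init z # lst z # x # m) \<in> Nilp" if "arrs a = []" "forbids z x"
  proof -
    have C: "a # x # m @ [z] \<in> C n" using less.prems(1) m by simp
    have gz: "good z" "arrs z \<noteq> []" using C that by (auto simp: C_def cell_def forbids_def)
    show ?thesis
      using D1_Nil'[OF n lastsplit_C(1)[OF C n that] _ _ lastsplit_C(2)[OF C n that]]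
        pm_not_rl[OF good_lst(3)[OF gz]] by (simp add: lst_def)
  qed
  have "Nop (\<delta> (a # x # b # m')) \<in> Nilp"
    unfolding Nop_D2[OF less.prems(1) m less.prems(2-4) v]
    using 1 2 free_vs.subspace_0[OF subspace_Nil]
    by (intro free_vs.subspace_diff[OF subspace_Nil]) (auto intro: free_vs.subspace_scale[OF subspace_Nil])
  then show ?case by (rule Nil_step)
qed

lemma Dn_Nil: assumes n: "2 \<le> n" and l: "l \<in> C n \<inter> Dn" shows "\<delta> l \<in> Nilp"
proof -
  obtain a x r where r: "l = a # x # r" "\<not> forbids a x" "length (arrs x) = 1" using l unfolding Dn_def by blast
  then obtain b m' where "r = b # m'" using l n by (cases r) (auto simp: C_def)
  then show ?thesis using D1_Nil'[OF n, of a x b m'] D2_Nil[OF n, of a x b m'] r l by blast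
qed

lemma sp_subset: "free_vs.subspace V \<Longrightarrow> (\<And>l. l \<in> S \<Longrightarrow> \<delta> l \<in> V) \<Longrightarrow> f \<in> sp S \<Longrightarrow> f \<in> V"
  unfolding mem_Collect_eq
  by (rotate_tac 2, induction rule: span_of_deltas_induct)
    (auto intro: free_vs.subspace_0 free_vs.subspace_add free_vs.subspace_scale)

text \<open>\<open>Nop\<close> fixes every cycle, while some power of it annihilates
  \<open>d\<close>.\<close>

lemma Dn_cycle_zero: assumes n: "2 \<le> n" and d: "d \<in> sp (C n \<inter> Dn)" "hb d = 0" shows "d = 0"
proof -
  have "d \<in> Nilp" by (rule sp_subset[OF subspace_Nil Dn_Nil[OF n] d(1)])
  then obtain k where k: "(Nop ^^ k) d = 0" by (auto simp: Nilp_def)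
  have "(Nop ^^ k) d = d" by (induction k) (simp_all add: Nop_def d(2))
  then show ?thesis using k by simp
qed

lemma C_exact: assumes n: "2 \<le> n" and f: "f \<in> sp (C n)" "hb f = 0" shows "\<exists>u\<in>sp (C (Suc n)). hb u = f"
proof -
  have "f \<in> G n" by (rule sp_subset[OF subspace_G C_G[OF n] f(1)])
  then obtain u d where ud: "f = hb u + d" "u \<in> sp (C (Suc n))" "d \<in> sp (C n \<inter> Dn)" by (auto simp: G_def)
  have "u \<in> homog (Suc (Suc n))" using ud(2) by (auto simp: C_def homog_def)
  then have "hb d = 0" using f(2) ud(1) hb_hb[of u "Suc (Suc n)"] by simp
  then have "d = 0" using Dn_cycle_zero[OF n ud(3)] by simp
  then show ?thesis using ud by auto
qed

subsection \<open>The lifting property\<close>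

lemma length_wd: "length (word l) = (\<Sum>p\<leftarrow>l. length (arrs p))"
  by (simp add: word_def length_concat comp_def)

text \<open>In a nondegenerate word every letter but the head has an arrow. A word forbidden all
  around, of type \<open>m\<close>, has \<open>m + 1\<close> arrows, hence at most
  \<open>m + 2\<close> letters, too few for degree \<open>m + 2\<close>. So the nondegenerate
  representative is supported on \<open>C\<close>.\<close>

lemma exact_above:
  assumes f: "f \<in> K n" "Poly_Mapping.keys f \<subseteq> {l. cell_type l = m}" "hb f = 0" and n: "int m + 2 \<le> n"
  shows "\<exists>u\<in>K (n + 1). hb u = f"
proof -
  obtain u where u: "u \<in> K (n + 1)" "f - hb u \<in> K n"
      "Poly_Mapping.keys (f - hb u) \<subseteq> {l. nd l \<and> l \<in> Poly_Mapping.keys f}"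
    using nondegenerate_representative[OF f(1,3)] by blast
  have "l \<in> C (nat n)" if "l \<in> Poly_Mapping.keys (f - hb u)" for l
  proof -
    have l: "cell l" "int (length l) = n + 1" "nd l" "cell_type l = m" using that u f(2) by (auto simp: K_def)
    have "\<not> all_rel (word l)"
    proof
      assume a: "all_rel (word l)"
      obtain p r where pr: "l = p # r" using l(1) by (auto simp: cell_def neq_Nil_conv)
      have "length r \<le> (\<Sum>p\<leftarrow>r. length (arrs p))"
      proof -
        have "\<forall>p\<in>set r. 1 \<le> length (arrs p)" using l(3) pr by (auto simp: nd_def Suc_le_eq)
        then show ?thesis by (induction r) auto
      qed
      then have "length r \<le> length (word l)" by (simp add: length_wd pr)
      moreover have "m = length (word l) - 1" "word l \<noteq> []" using l(4) a by (auto simp: cell_type_def all_rel_def)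
      ultimately show False using l(2) pr n by (cases "word l") auto
    qed
    then show ?thesis using l by (simp add: C_def nat_eq_iff2) (use l(2) n in linarith)
  qed
  then have "f - hb u \<in> sp (C (nat n))" by blast
  moreover have "hb (f - hb u) = 0"
    using f(3) hb_hb[OF K_hom[OF u(1)]] n by simp
  moreover have "2 \<le> nat n" using n by simp
  ultimately obtain v where v: "v \<in> sp (C (Suc (nat n)))" "hb v = f - hb u" using C_exact by blast
  have "v \<in> K (n + 1)" using v(1) n by (auto simp: C_def K_def)
  then have "u + v \<in> K (n + 1)" using free_vs.subspace_add[OF subspace_K u(1)] by blast
  moreover have "hb (u + v) = f" using v(2) by simp
  ultimately show ?thesis by blast
qed

lemma vanish_below:
  assumes f: "f \<in> K n" "Poly_Mapping.keys f \<subseteq> {l. cell_type l = m}" and n: "n < int m"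
  shows "f = 0"
proof -
  have False if "l \<in> Poly_Mapping.keys f" for l
  proof -
    have l: "cell l" "int (length l) = n + 1" "cell_type l = m" using that f by (auto simp: K_def)
    show False
    proof (cases "all_rel (word l)")
      case False
      then show ?thesis using l n by (simp add: cell_type_def) (use cell_length[OF l(1)] in linarith)
    next
      case True
      have "length (arrs p) \<le> 1" if p: "p \<in> set l" for p
      proof (rule ccontr)
        assume "\<not> length (arrs p) \<le> 1"
        then obtain e e' es where e: "arrs p = e # e' # es" by (cases "arrs p"; cases "List.tl (arrs p)") auto
        obtain xs ys where "l = xs @ p # ys" using p by (metis split_list)
        then have "word l = word xs @ arrs p @ word ys" by (simp add: word_def)
        moreover have "successively rel (word l)" using True by (simp add: all_rel_def successively_append_iff)
        ultimately have "successively rel (arrs p)" by (simp only: successively_append_iff)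
        then have "rel e e'" by (simp add: e)
        moreover have "good p" using l(1) p by (simp add: cell_def)
        ultimately show False by (simp add: good_def e)
      qed
      then have "(\<Sum>p\<leftarrow>l. length (arrs p)) \<le> length l" by (induction l) force+
      then have "length (word l) \<le> length l" by (simp add: length_wd)
      moreover have "m = length (word l) - 1" using l(3) True by (simp add: cell_type_def)
      ultimately show ?thesis using l(2) n cell_length[OF l(1)] by linarith
    qed
  qed
  then have "Poly_Mapping.keys f = {}" by blast
  then show ?thesis by simp
qed

definition lifts :: "int \<Rightarrow> (('v, 'e) path list \<Rightarrow>\<^sub>0 'k) \<Rightarrow> (nat \<Rightarrow> ('v, 'e) path list \<Rightarrow>\<^sub>0 'k) \<Rightarrow> bool" where
  "lifts n x z \<longleftrightarrow> z 0 = x \<and> (\<forall>i. z i \<in> K (n + 2 * int i) \<and> BK (z i) + hb (z (Suc i)) = 0)"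

lemma keys_BK: "f \<in> K n \<Longrightarrow> Poly_Mapping.keys f \<subseteq> {l. cell_type l = m} \<Longrightarrow> Poly_Mapping.keys (BK f) \<subseteq> {l. cell_type l = m}"
proof -
  assume f: "f \<in> K n" "Poly_Mapping.keys f \<subseteq> {l. cell_type l = m}"
  have "P m f = f" using P_const[OF f(2)] by simp
  then have "P m (BK f) = BK f" using P_BK[OF f(1)] by simp
  then show ?thesis using keys_P by metis
qed

lemma K_facts:
  assumes "x \<in> K n" shows "hb (BK x) + BK (hb x) = 0" "BK (BK x) = 0" "hb (hb x) = 0"
  using mixed_complex.bB[OF mixed assms] mixed_complex.BB[OF mixed assms] mixed_complex.bb[OF mixed assms] by auto

text \<open>Below degree \<open>m\<close> there are no chains. From degree \<open>m + 2\<close> on,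
  \<open>x\<close> is the boundary of some \<open>u\<close>, and \<open>BK u\<close> ends the
  sequence because \<open>BK\<close> squares to zero. In the two degrees between, \<open>BK\<close>
  of each further term is a cycle of degree at least \<open>m + 3\<close>, so exactness yields the
  next one.\<close>

lemma lift_homogeneous:
  assumes x: "x \<in> K n" "Poly_Mapping.keys x \<subseteq> {l. cell_type l = m}" "hb x = 0"
    and y: "y \<in> K (n + 2)" "Poly_Mapping.keys y \<subseteq> {l. cell_type l = m}" "BK x + hb y = 0"
  shows "\<exists>z. lifts n x z"
proof -
  have zero: "0 \<in> K k" for k using free_vs.subspace_0[OF subspace_K] .
  consider "n < int m" | "int m + 2 \<le> n" | "int m \<le> n" "n \<le> int m + 1" by linarith
  then show ?thesis
  proof cases
    case 1
    then have "x = 0" using vanish_below x by blast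
    then have "lifts n x (\<lambda>_. 0)" by (simp add: lifts_def zero)
    then show ?thesis by blast
  next
    case 2
    then obtain u where u: "u \<in> K (n + 1)" "hb u = x" using exact_above x by blast
    have Bu: "BK u \<in> K (n + 2)" using BK_K[OF u(1)] by (simp add: add.assoc)
    define z where "z = (\<lambda>i::nat. if i = 0 then x else if i = 1 then BK u else 0)"
    have "z i \<in> K (n + 2 * int i) \<and> BK (z i) + hb (z (Suc i)) = 0" for i
      using K_facts(1,2)[OF u(1)] u(2) x(1) Bu zero by (auto simp: z_def add.commute)
    then have "lifts n x z" by (simp add: lifts_def z_def)
    then show ?thesis by blast
  next
    case 3
    have "\<exists>z. \<forall>i. (z i \<in> K (n + 2 + 2 * int i) \<and> Poly_Mapping.keys (z i) \<subseteq> {l. cell_type l = m} \<and> hb (BK (z i)) = 0 \<and> (i = 0 \<longrightarrow> z i = y))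
        \<and> BK (z i) + hb (z (Suc i)) = 0"
    proof (rule dependent_nat_choice)
      have "hb (BK y) = - BK (hb y)" using K_facts(1)[OF y(1)] by (simp add: eq_neg_iff_add_eq_0)
      also have "hb y = - BK x" using y(3) by (simp add: eq_neg_iff_add_eq_0 add.commute)
      finally have "hb (BK y) = 0" using K_facts(2)[OF x(1)] by simp
      then show "\<exists>z. z \<in> K (n + 2 + 2 * int 0) \<and> Poly_Mapping.keys z \<subseteq> {l. cell_type l = m} \<and> hb (BK z) = 0 \<and> ((0::nat) = 0 \<longrightarrow> z = y)"
        using y by auto
    next
      fix z i assume z: "z \<in> K (n + 2 + 2 * int i) \<and> Poly_Mapping.keys z \<subseteq> {l. cell_type l = m} \<and> hb (BK z) = 0 \<and> (i = 0 \<longrightarrow> z = y)"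
      have "int m + 2 \<le> n + 2 + 2 * int i + 1" using 3 by simp
      then obtain u where u: "u \<in> K (n + 2 + 2 * int i + 1 + 1)" "hb u = BK z"
        using exact_above[OF BK_K keys_BK] z by blast
      \<comment> \<open>\<open>exact_above\<close> gives no control over the type of
        \<open>u\<close>; projecting restores it, and the boundary is unaffected because it already
        has type \<open>m\<close>.\<close>
      define w where "w = P m (- u)"
      have e: "n + 2 + 2 * int i + 1 + 1 = n + 2 + 2 * int (Suc i)" by simp
      have w: "w \<in> K (n + 2 + 2 * int (Suc i))" unfolding w_def e[symmetric]
        by (rule P_K, rule free_vs.subspace_neg[OF subspace_K u(1)])
      have "hb w = P m (hb (- u))" by (simp only: w_def P_hb)
      also have "\<dots> = - P m (BK z)" using u(2) by simp
      also have "P m (BK z) = BK z" using P_const[OF keys_BK, of z "n + 2 + 2 * int i" m m] z by simp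
      finally have hbw: "hb w = - BK z" .
      then have "hb (BK w) = 0" using K_facts(1)[OF w] K_facts(2)[of z "n + 2 + 2 * int i"] z by simp
      then show "\<exists>w. (w \<in> K (n + 2 + 2 * int (Suc i)) \<and> Poly_Mapping.keys w \<subseteq> {l. cell_type l = m} \<and> hb (BK w) = 0 \<and>
          (Suc i = 0 \<longrightarrow> w = y)) \<and> BK z + hb w = 0"
        using w hbw keys_P[of m "- u"] by (intro exI[of _ w]) (auto simp: w_def simp del: P_simps)
    qed
    then obtain z where z: "\<And>i. z i \<in> K (n + 2 + 2 * int i)" "z 0 = y" "\<And>i. BK (z i) + hb (z (Suc i)) = 0" by blast
    define z' where "z' = (\<lambda>i. case i of 0 \<Rightarrow> x | Suc j \<Rightarrow> z j)"
    have "z' i \<in> K (n + 2 * int i)" for i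
    proof (cases i)
      case (Suc j)
      have "n + 2 + 2 * int j = n + 2 * int i" "z' i = z j" using Suc by (simp_all add: z'_def)
      then show ?thesis using z(1)[of j] by (simp only:)
    qed (simp add: z'_def x(1))
    moreover have "BK (z' i) + hb (z' (Suc i)) = 0" for i
      using y(3) z(2,3) by (cases i) (auto simp: z'_def)
    ultimately have "lifts n x z'" by (simp add: lifts_def z'_def)
    then show ?thesis by blast
  qed
qed

text \<open>The operators respect types, so the finitely many components of \<open>x\<close> can be
  lifted separately.\<close>

lemma lift:
  assumes x: "x \<in> K n" "hb x = 0" and y: "y \<in> K (n + 2)" "BK x + hb y = 0"
  shows "\<exists>z. z 0 = x \<and> (\<forall>i. z i \<in> K (n + 2 * int i) \<and> BK (z i) + hb (z (Suc i)) = 0)"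
proof -
  have "\<exists>z. lifts n (P m x) z" for m
  proof (rule lift_homogeneous[where m = m and y = "P m y"])
    show "hb (P m x) = 0" using P_hb[of m x] x(2) by simp
    have "BK (P m x) + hb (P m y) = P m (BK x + hb y)" using P_hb P_BK[OF x(1)] by simp
    then show "BK (P m x) + hb (P m y) = 0" using y(2) by simp
  qed (use P_K x y keys_P in auto)
  then obtain z where z: "\<And>m. lifts n (P m x) (z m)" by metis
  let ?T = "cell_type ` Poly_Mapping.keys x"
  define w where "w i = (\<Sum>m\<in>?T. z m i)" for i
  have "w 0 = x" using sum_P[of ?T x] z by (simp add: w_def lifts_def)
  moreover have "w i \<in> K (n + 2 * int i)" for i
    unfolding w_def by (rule free_vs.subspace_sum[OF subspace_K]) (use z in \<open>simp add: lifts_def\<close>)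
  moreover have "BK (w i) + hb (w (Suc i)) = 0" for i
    using z by (simp add: w_def lifts_def sum.distrib[symmetric])
  ultimately show ?thesis by blast
qed

lemma lifting_mixed: "lifting_mixed_complex fscale K hb BK"
  using mixed lift by (simp add: lifting_mixed_complex_def lifting_mixed_complex_axioms_def)

end

section \<open>Hochschild chains in terms of a basis of paths\<close>

lemma lin_lin_ext_comp: "lin h \<Longrightarrow> h (lin_ext g f) = lin_ext (\<lambda>x. h (g x)) f"
  by (simp add: lin_ext_def lin_simps)

lemma lin_ext_diff_fun: "lin_ext (\<lambda>x. g x - h x) f = lin_ext g f - lin_ext h f"
  by (simp add: lin_ext_def free_vs.scale_right_diff_distrib sum_subtractf)

lemma lin_ext_add_fun: "lin_ext (\<lambda>x. g x + h x) f = lin_ext g f + lin_ext h f"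
  by (simp add: lin_ext_def free_vs.scale_right_distrib sum.distrib)

lemma lin_ext_scale_fun: "lin_ext (\<lambda>x. fscale c (g x)) f = fscale c (lin_ext g f)"
  by (simp add: lin_ext_def free_vs.scale_sum_right mult.commute)

lemma lin_ext_zero_fun: "lin_ext (\<lambda>x. 0) f = 0"
  by (simp add: lin_ext_def)

lemma lin_ext_swap: "lin_ext (\<lambda>x. lin_ext (g x) v) u = lin_ext (\<lambda>y. lin_ext (\<lambda>x. g x y) u) v"
  unfolding lin_ext_def free_vs.scale_sum_right by (subst sum.swap) (simp add: mult.commute)

lemma lin_ext_cong: "(\<And>x. x \<in> Poly_Mapping.keys f \<Longrightarrow> g x = h x) \<Longrightarrow> lin_ext g f = lin_ext h f"
  by (simp add: lin_ext_def)

lemma lin_ext_cong_mod: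
  assumes "free_vs.subspace T" "\<And>x. x \<in> Poly_Mapping.keys f \<Longrightarrow> g x - h x \<in> T"
  shows "lin_ext g f - lin_ext h f \<in> T"
  unfolding lin_ext_diff_fun[symmetric] unfolding lin_ext_def
  by (intro free_vs.subspace_sum[OF assms(1)] free_vs.subspace_scale[OF assms(1)] assms(2))

lemma presents_free_space: "presents fscale (free_space X) {f. Poly_Mapping.keys f \<subseteq> X} {0} (\<lambda>x. x)"
  unfolding presents_def using free_vs.vector_space_axioms subspace_keys[of X]
  by (auto simp: free_space_def)

lemma presents_compose:
  assumes M: "presents s M Y W f" and \<psi>: "Vector_Spaces.linear s' s \<psi>" "\<psi> ` Y' \<subseteq> Y" and Y': "module.subspace s' Y'"
    and inj: "\<And>y. y \<in> Y' \<Longrightarrow> \<psi> y \<in> W \<Longrightarrow> y = 0" and surj: "\<And>x. x \<in> Y \<Longrightarrow> \<exists>y\<in>Y'. x - \<psi> y \<in> W"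
  shows "presents s' M Y' {0} (\<lambda>y. f (\<psi> y))"
proof -
  interpret \<psi>: Vector_Spaces.linear s' s \<psi> by fact
  have 0: "0 \<in> W" "0 \<in> Y'" using presents_subspace[OF M] Y' \<psi>.vs1.subspace_0 \<psi>.vs2.subspace_0 by auto
  have "f ` Y \<subseteq> (\<lambda>y. f (\<psi> y)) ` Y'"
  proof
    fix a assume "a \<in> f ` Y"
    then obtain x where x: "x \<in> Y" "a = f x" by blast
    then obtain y where "y \<in> Y'" "x - \<psi> y \<in> W" using surj by blast
    then show "a \<in> (\<lambda>y. f (\<psi> y)) ` Y'" using x presents_eq_iff[OF M x(1), of "\<psi> y"] \<psi>(2) by auto
  qed
  then have "(\<lambda>y. f (\<psi> y)) ` Y' = carrier M" using \<psi>(2) presents_carrier[OF M] by auto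
  then show ?thesis
    unfolding presents_def using \<psi>.vs1.vector_space_axioms Y' 0 inj \<psi>(2)
    by (auto simp: \<psi>.add \<psi>.scale \<psi>.zero presents_add[OF M] presents_scale[OF M] presents_eq_zero[OF M]
        presents_zero[OF M] image_subset_iff)
qed

text \<open>
  \<open>c\<close> gives the coordinates of an element of \<open>A\<close> in the basis \<open>\<beta>\<close>, which is indexed by the paths
  without a forbidden pair.
\<close>

locale path_basis = quadratic_quiver Q rel field_type
  for Q :: "('v, 'e) pre_digraph" and rel :: "'e \<Rightarrow> 'e \<Rightarrow> bool" and field_type :: "'k::field itself" +
  fixes A :: "('k, 'a) module" and E :: "'a set"
    and c :: "'a \<Rightarrow> (('v, 'e) path \<Rightarrow>\<^sub>0 'k)" and \<beta> :: "('v, 'e) path \<Rightarrow> 'a"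
  assumes finite_verts: "finite (verts Q)"
    and add_closed: "x \<in> carrier A \<Longrightarrow> y \<in> carrier A \<Longrightarrow> x \<oplus>\<^bsub>A\<^esub> y \<in> carrier A"
    and c_add: "x \<in> carrier A \<Longrightarrow> y \<in> carrier A \<Longrightarrow> c (x \<oplus>\<^bsub>A\<^esub> y) = c x + c y"
    and smult_closed: "x \<in> carrier A \<Longrightarrow> r \<odot>\<^bsub>A\<^esub> x \<in> carrier A"
    and c_smult: "x \<in> carrier A \<Longrightarrow> c (r \<odot>\<^bsub>A\<^esub> x) = fscale r (c x)"
    and mult_closed: "x \<in> carrier A \<Longrightarrow> y \<in> carrier A \<Longrightarrow> x \<otimes>\<^bsub>A\<^esub> y \<in> carrier A"
    and c_mult: "x \<in> carrier A \<Longrightarrow> y \<in> carrier A \<Longrightarrow>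
      c (x \<otimes>\<^bsub>A\<^esub> y) = lin_ext (\<lambda>p. lin_ext (\<lambda>q. case pmult p q of None \<Rightarrow> 0 | Some u \<Rightarrow> \<delta> u) (c y)) (c x)"
    and one_closed: "\<one>\<^bsub>A\<^esub> \<in> carrier A" and c_one: "c \<one>\<^bsub>A\<^esub> = (\<Sum>v\<in>verts Q. \<delta> (v, [], v))"
    and c_good: "x \<in> carrier A \<Longrightarrow> Poly_Mapping.keys (c x) \<subseteq> {p. good p}"
    and c_inj: "x \<in> carrier A \<Longrightarrow> y \<in> carrier A \<Longrightarrow> c x = c y \<Longrightarrow> x = y"
    and \<beta>_closed: "good p \<Longrightarrow> \<beta> p \<in> carrier A" and c_\<beta>: "good p \<Longrightarrow> c (\<beta> p) = \<delta> p"
    and E_eq: "E = {x \<in> carrier A. Poly_Mapping.keys (c x) \<subseteq> {(v, [], v) |v. v \<in> verts Q}}"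
begin

primrec M :: "'a list \<Rightarrow> (('v, 'e) path list \<Rightarrow>\<^sub>0 'k)" where
  "M [] = \<delta> []"
| "M (x # xs) = lin_ext (\<lambda>p. pre p (M xs)) (c x)"

definition expand :: "('a list \<Rightarrow>\<^sub>0 'k) \<Rightarrow> (('v, 'e) path list \<Rightarrow>\<^sub>0 'k)" where "expand = lin_ext M"

lemma lin_expand: "lin expand" unfolding expand_def by (rule lin_lin_ext)
lemmas [lin_intros] = lin_comp[OF lin_expand]
lemmas TT_simps [simp] = lin_simps[OF lin_expand]
lemma TT_delta [simp]: "expand (\<delta> xs) = M xs" by (simp add: expand_def)

lemma keys_M:
  "set xs \<subseteq> carrier A \<Longrightarrow> Poly_Mapping.keys (M xs) \<subseteq> {l. length l = length xs \<and> (\<forall>p\<in>set l. good p)}"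
proof (induction xs)
  case (Cons x xs)
  show ?case unfolding M.simps
  proof (rule keys_lin_subset[OF lin_lin_ext])
    show "Poly_Mapping.keys (c x) \<subseteq> {p. good p}" using c_good Cons by simp
    show "Poly_Mapping.keys (lin_ext (\<lambda>p. pre p (M xs)) (\<delta> p)) \<subseteq> {l. length l = length (x # xs) \<and> (\<forall>p\<in>set l. good p)}"
      if "p \<in> {p. good p}" for p
      unfolding lin_ext_delta by (rule keys_lin_subset[OF lin_pre _ Cons.IH]) (use that Cons.prems in auto)
  qed
qed simp

lemma M_homog: "set xs \<subseteq> carrier A \<Longrightarrow> M xs \<in> homog (length xs)"
  using keys_M by (auto simp: homog_def)

text \<open>The algebra itself is treated as a partial multiplication that is never
  \<open>None\<close>. Thus \<open>free_b\<close> becomes an instance of \<open>hb\<close>, and both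
  differentials can be compared by the same recursion.\<close>

definition pmA :: "'a \<Rightarrow> 'a \<Rightarrow> 'a option" where "pmA x y = Some (x \<otimes>\<^bsub>A\<^esub> y)"

interpretation AA: partial_mult pmA field_type .

lemma TT_pre: "expand (pre x f) = lin_ext (\<lambda>p. pre p (expand f)) (c x)"
proof (rule lin_eqI[of "\<lambda>f. expand (pre x f)" "\<lambda>f. lin_ext (\<lambda>p. pre p (expand f)) (c x)" UNIV])
  show "lin (\<lambda>f. lin_ext (\<lambda>p. pre p (expand f)) (c x))"
    by (rule linI) (simp_all add: lin_ext_add_fun lin_ext_scale_fun)
qed (auto intro!: lin_intros)

lemma M_mult:
  assumes "x \<in> carrier A" "y \<in> carrier A"
  shows "M (x \<otimes>\<^bsub>A\<^esub> y # r) = lin_ext (\<lambda>p. lin_ext (\<lambda>q. case pmult p q of None \<Rightarrow> 0 | Some u \<Rightarrow> pre u (M r)) (c y)) (c x)"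
proof -
  have "lin_ext (\<lambda>u. pre u (M r)) (case z of None \<Rightarrow> 0 | Some u \<Rightarrow> \<delta> u) = (case z of None \<Rightarrow> 0 | Some u \<Rightarrow> pre u (M r))" for z
    by (cases z) auto
  then show ?thesis by (simp add: c_mult[OF assms] lin_lin_ext_comp[OF lin_lin_ext])
qed

lemma TT_barb: "set xs \<subseteq> carrier A \<Longrightarrow> expand (AA.bar_list xs) = bar (M xs)"
proof (induction xs rule: AA.bar_list.induct)
  case (1 x y r)
  have F: "M (y # r) \<in> homog (Suc (length r))" using M_homog[of "y # r"] 1 by simp
  have "bar (M (x # y # r)) = lin_ext (\<lambda>p. lmult p (M (y # r)) - pre p (bar (M (y # r)))) (c x)"
    unfolding M.simps(2)[of x] lin_lin_ext_comp[OF lin_bar] bar_pre[OF F] ..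
  also have "\<dots> = lin_ext (\<lambda>p. lmult p (M (y # r))) (c x) - lin_ext (\<lambda>p. pre p (bar (M (y # r)))) (c x)"
    by (rule lin_ext_diff_fun)
  also have "lin_ext (\<lambda>p. lmult p (M (y # r))) (c x) = M (x \<otimes>\<^bsub>A\<^esub> y # r)"
  proof -
    have m: "M (x \<otimes>\<^bsub>A\<^esub> y # r) = lin_ext (\<lambda>p. lin_ext (\<lambda>q. case pmult p q of None \<Rightarrow> 0 | Some u \<Rightarrow> pre u (M r)) (c y)) (c x)"
      by (rule M_mult) (use 1 in auto)
    show ?thesis unfolding m M.simps(2)[of y] lin_lin_ext_comp[OF lin_lmult] lm_pre ..
  qed
  finally show ?case using 1 by (simp add: pmA_def[of x y] TT_pre)
next
  case ("2_2" x)
  have "bar (pre p (\<delta> [])) = 0" for p by simp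
  then show ?case by (simp add: lin_lin_ext_comp[OF lin_bar] lin_ext_zero_fun del: pre_delta)
qed simp

lemma TT_mh: "set xs \<subseteq> carrier A \<Longrightarrow> expand (AA.mult_hd (\<delta> xs)) = mult_hd (M xs)"
proof (cases xs rule: AA.bar_list.cases)
  case (1 x y r)
  assume "set xs \<subseteq> carrier A"
  moreover have "mult_hd (pre p (pre q f)) = (case pmult p q of None \<Rightarrow> 0 | Some u \<Rightarrow> pre u f)" for p q f
    by (rule lin_eqI[of "\<lambda>f. mult_hd (pre p (pre q f))" "\<lambda>f. case pmult p q of None \<Rightarrow> 0 | Some u \<Rightarrow> pre u f" UNIV];
      cases "pmult p q") (auto intro!: lin_intros)
  moreover have "M (x \<otimes>\<^bsub>A\<^esub> y # r) = lin_ext (\<lambda>p. lin_ext (\<lambda>q. case pmult p q of None \<Rightarrow> 0 | Some u \<Rightarrow> pre u (M r)) (c y)) (c x)"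
    by (rule M_mult) (use 1 calculation in auto)
  ultimately show ?thesis using 1
    by (simp add: pmA_def lin_lin_ext_comp[OF lin_mult_hd] lin_lin_ext_comp[OF lin_pre])
next
  case "2_1" then show ?thesis by (simp add: mult_hd_def AA.mult_hd_def)
next
  case ("2_2" x)
  have "mult_hd (\<delta> [p]) = 0" for p by (simp add: mult_hd_def)
  then show ?thesis using "2_2" by (simp add: AA.mult_hd_def lin_lin_ext_comp[OF lin_mult_hd] lin_ext_zero_fun)
qed

lemma M_snoc: "M (xs @ [x]) = lin_ext (\<lambda>p. suf p (M xs)) (c x)"
proof (induction xs)
  case (Cons y ys)
  then show ?case
    by (simp add: lin_lin_ext_comp[OF lin_pre] lin_lin_ext_comp[OF lin_suf] suf_pre) (rule lin_ext_swap)
qed simp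

lemma t_suf: "f \<in> homog n \<Longrightarrow> free_t (suf p f) = fscale ((- 1) ^ n) (pre p f)"
  by (rule homog_eqI[of "\<lambda>f. free_t (suf p f)" "\<lambda>f. fscale ((- 1) ^ n) (pre p f)"])
    (auto intro!: lin_intros simp: t_delta)

lemma TT_t: assumes "set xs \<subseteq> carrier A" "xs \<noteq> []" shows "expand (free_t (\<delta> xs)) = free_t (M xs)"
proof -
  obtain ys x where xs: "xs = ys @ [x]" using assms(2) by (metis rev_exhaust)
  then have "set ys \<subseteq> carrier A" using assms by auto
  then show ?thesis using xs
    by (simp add: t_delta M_snoc lin_lin_ext_comp[OF lin_t] t_suf[OF M_homog] lin_ext_scale_fun)
qed

definition tup :: "nat \<Rightarrow> 'a list set" where "tup L = {xs. length xs = L \<and> set xs \<subseteq> carrier A}"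

lemma tup_homog: "Poly_Mapping.keys f \<subseteq> tup L \<Longrightarrow> f \<in> homog L"
  by (auto simp: tup_def homog_def)

lemma tup_rr: "0 < L \<Longrightarrow> xs \<in> tup L \<Longrightarrow> rrot xs \<in> tup L"
  by (cases xs rule: rev_exhaust) (auto simp: tup_def)

lemma TT_t': "Poly_Mapping.keys f \<subseteq> tup L \<Longrightarrow> 0 < L \<Longrightarrow> expand (free_t f) = free_t (expand f)"
  by (rule lin_eqI[of "\<lambda>f. expand (free_t f)" "\<lambda>f. free_t (expand f)" "tup L"])
    (auto intro!: lin_intros simp: TT_t tup_def)

lemma TT_homog: "Poly_Mapping.keys f \<subseteq> tup L \<Longrightarrow> expand f \<in> homog L"
  unfolding homog_def mem_Collect_eq
  by (erule keys_lin_subset[OF lin_expand, rotated]) (use M_homog in \<open>auto simp: tup_def homog_def\<close>)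

lemma tpow_tup: "Poly_Mapping.keys f \<subseteq> tup L \<Longrightarrow> 0 < L \<Longrightarrow> Poly_Mapping.keys ((free_t ^^ i) f) \<subseteq> tup L"
  by (induction i) (simp_all add: t_closed[OF tup_rr])

lemma TT_N: assumes "Poly_Mapping.keys f \<subseteq> tup L" "0 < L" shows "expand (free_N f) = free_N (expand f)"
proof -
  have "expand ((free_t ^^ i) f) = (free_t ^^ i) (expand f)" for i
    by (induction i) (simp_all add: TT_t'[OF tpow_tup[OF assms] assms(2)])
  then show ?thesis by (simp add: N_eq[OF tup_homog[OF assms(1)]] N_eq[OF TT_homog[OF assms(1)]])
qed

lemma free_b_eq: "free_b A = AA.hb"
proof
  fix f :: "'a list \<Rightarrow>\<^sub>0 'k"
  have "lin (free_b A :: ('a list \<Rightarrow>\<^sub>0 'k) \<Rightarrow> _)" unfolding free_b_def by (rule lin_lin_ext)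
  then show "free_b A f = AA.hb f"
  proof (rule lin_eqI[OF _ AA.lin_hb, of _ UNIV])
    fix xs :: "'a list"
    have "AA.mult_hd (free_t (\<delta> xs)) = (if length xs \<ge> 2
        then Poly_Mapping.single ((last xs \<otimes>\<^bsub>A\<^esub> hd xs) # List.tl (butlast xs)) ((- 1) ^ (length xs - 1)) else 0 :: 'a list \<Rightarrow>\<^sub>0 'k)"
    proof (cases xs rule: AA.bar_list.cases)
      case (1 x y r)
      have "AA.mult_hd (free_t (\<delta> xs)) = fscale ((- 1) ^ (length xs - 1)) (\<delta> (last xs \<otimes>\<^bsub>A\<^esub> x # butlast (y # r)) :: 'a list \<Rightarrow>\<^sub>0 'k)"
        unfolding t_delta AA.mh_simps using 1 by (simp add: pmA_def)
      then show ?thesis using 1 unfolding single_eq_fscale[symmetric] by simp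
    qed (simp_all add: t_delta AA.mult_hd_def)
    moreover have "AA.bar_list xs = (\<Sum>i<length xs - 1. Poly_Mapping.single
        (take i xs @ [(xs ! i) \<otimes>\<^bsub>A\<^esub> (xs ! (i + 1))] @ drop (i + 2) xs) ((- 1) ^ i) :: 'a list \<Rightarrow>\<^sub>0 'k)"
      unfolding AA.barb_faces by (rule sum.cong) (simp_all add: pmA_def single_eq_fscale[symmetric])
    ultimately show "free_b A (\<delta> xs) = AA.hb (\<delta> xs)"
      unfolding free_b_def lin_ext_delta AA.hb_def AA.bar_delta by simp
  qed simp
qed

lemma TT_b: "Poly_Mapping.keys f \<subseteq> tup L \<Longrightarrow> 0 < L \<Longrightarrow> expand (free_b A f) = hb (expand f)"
  unfolding free_b_eq
proof (rule lin_eqI[of "\<lambda>f. expand (AA.hb f)" "\<lambda>f. hb (expand f)" "tup L"])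
  fix xs assume "xs \<in> tup L" "0 < L"
  then have xs: "set xs \<subseteq> carrier A" "xs \<noteq> []" "set (rrot xs) \<subseteq> carrier A"
    using tup_rr[of L xs] by (auto simp: tup_def)
  have "expand (AA.mult_hd (free_t (\<delta> xs))) = mult_hd (free_t (M xs))"
    unfolding TT_t[OF xs(1,2), symmetric] t_delta using TT_mh[OF xs(3)] by simp
  then show "expand (AA.hb (\<delta> xs)) = hb (expand (\<delta> xs))"
    unfolding AA.hb_def hb_def using TT_barb[OF xs(1)] by simp
qed (auto intro!: lin_intros lin_comp[OF AA.lin_hb])

section \<open>Projection to cyclically composable words\<close>

definition R :: "(('v, 'e) path list \<Rightarrow>\<^sub>0 'k) \<Rightarrow> (('v, 'e) path list \<Rightarrow>\<^sub>0 'k)" where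
  "R = lin_ext (\<lambda>l. if cell l then \<delta> l else 0)"

lemma lin_R: "lin R" unfolding R_def by (rule lin_lin_ext)
lemmas [lin_intros] = lin_comp[OF lin_R]
lemmas R_simps [simp] = lin_simps[OF lin_R]
lemma R_delta: "R (\<delta> l) = (if cell l then \<delta> l else 0)" by (simp add: R_def)

definition goods :: "nat \<Rightarrow> ('v, 'e) path list set" where "goods L = {l. length l = L \<and> (\<forall>p\<in>set l. good p)}"

lemma TT_goods: "Poly_Mapping.keys f \<subseteq> tup L \<Longrightarrow> Poly_Mapping.keys (expand f) \<subseteq> goods L"
  by (erule keys_lin_subset[OF lin_expand, rotated]) (use keys_M in \<open>auto simp: tup_def goods_def\<close>)

lemma R_zero: "Poly_Mapping.keys f \<subseteq> {l. \<not> cell l} \<Longrightarrow> R f = 0"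
  by (rule lin_eqI[OF lin_R lin_const0, of "{l. \<not> cell l}"]) (auto simp: R_delta)

lemma R_id: "Poly_Mapping.keys f \<subseteq> {l. cell l} \<Longrightarrow> R f = f"
  by (rule lin_eqI[OF lin_R lin_ident, of "{l. cell l}"]) (auto simp: R_delta)

text \<open>For \<open>R\<close> to commute with \<open>hb\<close>, a word that is no cell must not
  have a cell among its faces. A nonzero product shows that the seam it removes was
  composable.\<close>

lemma cell_of_face: assumes "l' \<in> faces l" "cell l'" "\<forall>p\<in>set l. good p" shows "cell l"
proof -
  consider (inner) xs p q ys u where "l' = xs @ u # ys" "l = xs @ p # q # ys" "pmult p q = Some u"
    | (last) p m q u where "l' = u # m" "l = p # m @ [q]" "pmult q p = Some u"
    using assms(1) by (auto simp: faces_def)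
  then show ?thesis
  proof cases
    case inner
    then show ?thesis using assms(2,3) cell_split[of xs u ys p q] by auto
  next
    case last
    then have "tgt q = src p" "src u = src q" "tgt u = tgt p" by (auto simp: pm_Some)
    then show ?thesis using assms(2,3) last(1,2)
      by (cases m) (auto simp: cell_def successively_append_iff successively_Cons hd_append split: if_splits)
  qed
qed

lemma R_hb: "Poly_Mapping.keys f \<subseteq> goods L \<Longrightarrow> R (hb f) = hb (R f)"
proof (rule lin_eqI[of "\<lambda>f. R (hb f)" "\<lambda>f. hb (R f)" "goods L"])
  fix l assume l: "l \<in> goods L"
  show "R (hb (\<delta> l)) = hb (R (\<delta> l))"
  proof (cases "cell l")
    case True
    then have "Poly_Mapping.keys (hb (\<delta> l)) \<subseteq> {l. cell l}" using keys_hb[of l] cell_faces by blast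
    then show ?thesis using R_id True by (simp add: R_delta)
  next
    case False
    then have "Poly_Mapping.keys (hb (\<delta> l)) \<subseteq> {l. \<not> cell l}"
      using keys_hb[of l] cell_of_face l by (auto simp: goods_def)
    then show ?thesis using R_zero False by (simp add: R_delta)
  qed
qed (auto intro!: lin_intros)

lemma cell_rr_iff: "l \<noteq> [] \<Longrightarrow> cell (rrot l) \<longleftrightarrow> cell l"
  by (cases l rule: rev_exhaust) (auto simp: cell_def successively_append_iff successively_Cons hd_append
      split: if_splits)

lemma R_t: "f \<in> homog L \<Longrightarrow> 0 < L \<Longrightarrow> R (free_t f) = free_t (R f)"
proof (rule homog_eqI[of "\<lambda>f. R (free_t f)" "\<lambda>f. free_t (R f)"])
  fix l :: "('v, 'e) path list" assume "0 < L" "length l = L"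
  then have "l \<noteq> []" by auto
  then show "R (free_t (\<delta> l)) = free_t (R (\<delta> l))"
    using cell_rr_iff[of l] by (cases "cell l") (simp_all add: t_delta R_delta)
qed (auto intro!: lin_intros)

lemma R_homog: "f \<in> homog L \<Longrightarrow> R f \<in> homog L"
  by (rule homog_lin[OF lin_R]) (auto simp: R_delta)

lemma R_N: assumes "f \<in> homog L" "0 < L" shows "R (free_N f) = free_N (R f)"
proof -
  have "R ((free_t ^^ i) f) = (free_t ^^ i) (R f)" for i
    by (induction i) (simp_all add: R_t[OF tpow_hom[OF assms] assms(2)])
  then show ?thesis by (simp add: N_eq[OF assms(1)] N_eq[OF R_homog[OF assms(1)]])
qed

text \<open>Of the vertices that make up the unit, only the source of the first letter can be
  prefixed so as to give a cell, and this is the choice made by \<open>sK\<close>.\<close>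

lemma R_s: "Poly_Mapping.keys f \<subseteq> goods L \<Longrightarrow> 0 < L \<Longrightarrow> R (\<Sum>v\<in>verts Q. pre (v, [], v) f) = sK (R f)"
proof (rule lin_eqI[of "\<lambda>f. R (\<Sum>v\<in>verts Q. pre (v, [], v) f)" "\<lambda>f. sK (R f)" "goods L"])
  fix l assume l: "l \<in> goods L" "0 < L"
  then obtain p r where pr: "l = p # r" by (cases l) (auto simp: goods_def)
  have gp: "good p" using l pr by (simp add: goods_def)
  then have v: "src p \<in> verts Q" by (auto simp: good_def paths_def split_beta awalk_hd_in_verts)
  have "cell ((v, [], v) # l) \<longleftrightarrow> v = src p \<and> cell l" if "v \<in> verts Q" for v
  proof
    assume "v = src p \<and> cell l"
    then show "cell ((v, [], v) # l)" using cell_idl[of l] pr by (simp add: idl_def)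
  next
    assume "cell ((v, [], v) # l)"
    then show "v = src p \<and> cell l" unfolding pr
      by (cases r rule: rev_exhaust) (auto simp: cell_def successively_append_iff successively_Cons hd_append
          split: if_splits)
  qed
  then have "R (\<delta> ((v, [], v) # l)) = (if v = src p then sK (R (\<delta> l)) else 0)" if "v \<in> verts Q" for v
    using that pr by (auto simp: R_delta idl_def)
  then have "R (\<Sum>v\<in>verts Q. pre (v, [], v) (\<delta> l)) = (\<Sum>v\<in>verts Q. if v = src p then sK (R (\<delta> l)) else 0)"
    by simp
  then show "R (\<Sum>v\<in>verts Q. pre (v, [], v) (\<delta> l)) = sK (R (\<delta> l))" using v finite_verts by simp
qed (auto intro!: lin_intros)

text \<open>
  Expanding all entries of a tuple in the basis and discarding the words of paths that do not
  compose cyclically identifies the tensors over \<open>E\<close> with \<open>K\<close>.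
\<close>

definition \<Phi> :: "('a list \<Rightarrow>\<^sub>0 'k) \<Rightarrow> (('v, 'e) path list \<Rightarrow>\<^sub>0 'k)" where "\<Phi> f = R (expand f)"

lemma lin_\<Phi>: "lin \<Phi>" unfolding \<Phi>_def[abs_def] by (intro lin_intros)
lemmas [lin_intros] = lin_comp[OF lin_\<Phi>]
lemmas \<Phi>_simps = lin_simps[OF lin_\<Phi>]

lemma \<Phi>_b: assumes "Poly_Mapping.keys f \<subseteq> tup L" "0 < L" shows "\<Phi> (free_b A f) = hb (\<Phi> f)"
  unfolding \<Phi>_def TT_b[OF assms] by (rule R_hb[OF TT_goods[OF assms(1)]])

lemma \<Phi>_B: assumes f: "Poly_Mapping.keys f \<subseteq> tup L" "0 < L" shows "\<Phi> (free_B A f) = BK (\<Phi> f)"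
proof -
  have lin_fs: "lin (free_s A :: ('a list \<Rightarrow>\<^sub>0 'k) \<Rightarrow> _)" unfolding free_s_def by (rule lin_lin_ext)
  have N: "Poly_Mapping.keys (free_N f) \<subseteq> tup L" by (rule N_closed[OF tup_rr f(1)]) (use f(2) in auto)
  have s: "Poly_Mapping.keys (free_s A (free_N f)) \<subseteq> tup (Suc L)"
    by (rule keys_lin_subset[OF lin_fs _ N]) (use one_closed in \<open>auto simp: free_s_def tup_def\<close>)
  have TTs: "expand (free_s A h) = (\<Sum>v\<in>verts Q. pre (v, [], v) (expand h))" for h
    by (rule lin_eqI[of "\<lambda>h. expand (free_s A h)" "\<lambda>h. \<Sum>v\<in>verts Q. pre (v, [], v) (expand h)" UNIV])
      (auto intro!: lin_intros lin_comp[OF lin_expand] lin_fs simp: free_s_def c_one)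
  have "\<Phi> (free_s A (free_N f)) = sK (R (expand (free_N f)))"
    unfolding \<Phi>_def TTs by (rule R_s[OF TT_goods[OF N] f(2)])
  also have "\<dots> = sK (free_N (\<Phi> f))"
    unfolding \<Phi>_def TT_N[OF f] R_N[OF TT_homog[OF f(1)] f(2)] ..
  finally have 1: "\<Phi> (free_s A (free_N f)) = sK (free_N (\<Phi> f))" .
  have "\<Phi> (free_t (free_s A (free_N f))) = free_t (\<Phi> (free_s A (free_N f)))"
    unfolding \<Phi>_def using TT_t'[OF s] R_t[OF TT_homog[OF s]] by simp
  then show ?thesis unfolding free_B_def BK_def Let_def \<Phi>_simps 1 by simp
qed

section \<open>Vanishing of the expansion on the tensor relations\<close>

lemma M_update_add: "i < length xs \<Longrightarrow> x \<in> carrier A \<Longrightarrow> y \<in> carrier A \<Longrightarrow>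
    M (xs[i := x \<oplus>\<^bsub>A\<^esub> y]) = M (xs[i := x]) + M (xs[i := y])"
proof (induction xs arbitrary: i)
  case (Cons z zs)
  then show ?case by (cases i) (simp_all add: c_add lin_ext_add_fun)
qed simp

lemma M_update_smult: "i < length xs \<Longrightarrow> x \<in> carrier A \<Longrightarrow> M (xs[i := r \<odot>\<^bsub>A\<^esub> x]) = fscale r (M (xs[i := x]))"
proof (induction xs arbitrary: i)
  case (Cons z zs)
  then show ?case by (cases i) (simp_all add: c_smult lin_ext_scale_fun)
qed simp

text \<open>Multiplication by an element of the vertex subalgebra is diagonal in the path basis: it
  scales each path by a coefficient attached to one of its ends. \<open>weight\<close> is the effect
  on one letter of an expanded tuple.\<close>

definition weight :: "nat \<Rightarrow> (('v, 'e) path \<Rightarrow> 'k) \<Rightarrow> (('v, 'e) path list \<Rightarrow>\<^sub>0 'k) \<Rightarrow> (('v, 'e) path list \<Rightarrow>\<^sub>0 'k)" where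
  "weight i w = lin_ext (\<lambda>l. fscale (w (l ! i)) (\<delta> l))"

lemma lin_weight: "lin (weight i w)" unfolding weight_def by (rule lin_lin_ext)
lemmas [lin_intros] = lin_comp[OF lin_weight]
lemma weight_delta: "weight i w (\<delta> l) = fscale (w (l ! i)) (\<delta> l)" by (simp add: weight_def)

lemma weight_pre: "weight 0 w (pre p f) = fscale (w p) (pre p f)" "weight (Suc i) w (pre p f) = pre p (weight i w f)"
proof -
  show "weight 0 w (pre p f) = fscale (w p) (pre p f)"
    by (rule lin_eqI[of "\<lambda>f. weight 0 w (pre p f)" "\<lambda>f. fscale (w p) (pre p f)" UNIV]) (auto intro!: lin_intros simp: weight_delta)
  show "weight (Suc i) w (pre p f) = pre p (weight i w f)"
    by (rule lin_eqI[of "\<lambda>f. weight (Suc i) w (pre p f)" "\<lambda>f. pre p (weight i w f)" UNIV]) (auto intro!: lin_intros simp: weight_delta)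
qed

lemma M_update_weight: "i < length xs \<Longrightarrow> c y = lin_ext (\<lambda>p. fscale (w p) (\<delta> p)) (c (xs ! i)) \<Longrightarrow> M (xs[i := y]) = weight i w (M xs)"
proof (induction xs arbitrary: i)
  case (Cons z zs)
  then show ?case
    by (cases i) (simp_all add: lin_lin_ext_comp[OF lin_lin_ext] lin_lin_ext_comp[OF lin_weight] weight_pre)
qed simp

lemma cell_adjacent: assumes "cell l" "i < length l" shows "tgt (l ! i) = src (l ! (Suc i mod length l))"
proof -
  have "\<forall>i. Suc i < length (l @ [hd l]) \<longrightarrow> tgt ((l @ [hd l]) ! i) = src ((l @ [hd l]) ! Suc i)"
    using assms(1) by (auto simp: cell_def successively_conv_nth)
  then have "tgt ((l @ [hd l]) ! i) = src ((l @ [hd l]) ! Suc i)" using assms(2) by simp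
  then show ?thesis using assms by (cases "Suc i = length l") (auto simp: nth_append hd_conv_nth cell_def)
qed

lemma cell_if_adjacent:
  assumes "l \<noteq> []" "\<forall>p\<in>set l. good p" "\<And>i. i < length l \<Longrightarrow> tgt (l ! i) = src (l ! (Suc i mod length l))"
  shows "cell l"
  unfolding cell_def successively_conv_nth
proof (intro conjI allI impI)
  fix i assume i: "Suc i < length (l @ [hd l])"
  then show "tgt ((l @ [hd l]) ! i) = src ((l @ [hd l]) ! Suc i)"
    using assms(3)[of i] assms(1) by (cases "Suc i = length l") (auto simp: nth_append hd_conv_nth)
qed (use assms in auto)

text \<open>On a cell the target of a letter is the source of the next one, so both scalings agree
  there, and \<open>R\<close> discards all other words. This yields the balancing relations over
  \<open>E\<close>.\<close>

lemma R_weight: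
  assumes "Poly_Mapping.keys f \<subseteq> goods L" "i < L"
  shows "R (weight i (\<lambda>p. h (tgt p)) f) = R (weight ((i + 1) mod L) (\<lambda>p. h (src p)) f)"
proof (rule lin_eqI[OF _ _ _ assms(1)])
  fix l assume "l \<in> goods L"
  then show "R (weight i (\<lambda>p. h (tgt p)) (\<delta> l)) = R (weight ((i + 1) mod L) (\<lambda>p. h (src p)) (\<delta> l))"
    using cell_adjacent[of l i] assms(2) by (cases "cell l") (auto simp: weight_delta R_delta goods_def)
qed (intro lin_intros)+

lemma lin_lookup: "lin (\<lambda>f. fscale (Poly_Mapping.lookup f y) d)"
  by (rule linI) (simp_all add: lookup_add free_vs.scale_left_distrib)

lemma c_mult_E:
  assumes x: "x \<in> carrier A" and e: "e \<in> E"
  shows "c (x \<otimes>\<^bsub>A\<^esub> e) = lin_ext (\<lambda>p. fscale (Poly_Mapping.lookup (c e) (tgt p, [], tgt p)) (\<delta> p)) (c x)" (is ?right)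
    and "c (e \<otimes>\<^bsub>A\<^esub> x) = lin_ext (\<lambda>p. fscale (Poly_Mapping.lookup (c e) (src p, [], src p)) (\<delta> p)) (c x)" (is ?left)
proof -
  have eA: "e \<in> carrier A" "Poly_Mapping.keys (c e) \<subseteq> {(v, [], v) |v. v \<in> verts Q}" using e E_eq by auto
  have "lin_ext (\<lambda>q. case pmult p q of None \<Rightarrow> 0 | Some u \<Rightarrow> \<delta> u) (c e) = fscale (Poly_Mapping.lookup (c e) (tgt p, [], tgt p)) (\<delta> p)" for p
  proof (rule lin_eqI[OF lin_lin_ext lin_lookup _ eA(2)])
    fix q :: "('v, 'e) path" assume "q \<in> {(v, [], v) |v. v \<in> verts Q}"
    then obtain v where q: "q = (v, [], v)" by blast
    show "lin_ext (\<lambda>q. case pmult p q of None \<Rightarrow> 0 | Some u \<Rightarrow> \<delta> u) (\<delta> q) = fscale (Poly_Mapping.lookup (\<delta> q) (tgt p, [], tgt p)) (\<delta> p)"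
      by (cases p) (auto simp: q pmult_def forbids_def lookup_single when_def)
  qed
  then show ?right by (simp add: c_mult[OF x eA(1)])
  have "lin_ext (\<lambda>q. case pmult q p of None \<Rightarrow> 0 | Some u \<Rightarrow> \<delta> u) (c e) = fscale (Poly_Mapping.lookup (c e) (src p, [], src p)) (\<delta> p)" for p
  proof (rule lin_eqI[OF lin_lin_ext lin_lookup _ eA(2)])
    fix q :: "('v, 'e) path" assume "q \<in> {(v, [], v) |v. v \<in> verts Q}"
    then obtain v where q: "q = (v, [], v)" by blast
    show "lin_ext (\<lambda>q. case pmult q p of None \<Rightarrow> 0 | Some u \<Rightarrow> \<delta> u) (\<delta> q) = fscale (Poly_Mapping.lookup (\<delta> q) (src p, [], src p)) (\<delta> p)"
      by (cases p) (auto simp: q pmult_def forbids_def lookup_single when_def)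
  qed
  then show ?left unfolding c_mult[OF eA(1) x] by (subst lin_ext_swap) simp
qed

lemma tuples_tup: "tuples A n = (if 0 \<le> n then tup (nat (n + 1)) else {})"
proof -
  have "0 \<le> n" if "xs \<noteq> []" "int (length xs) = n + 1" for xs :: "'a list" using that by (cases xs) auto
  then show ?thesis by (auto simp: tuples_def tup_def)
qed

lemma tuples_update: "xs \<in> tuples A n \<Longrightarrow> x \<in> carrier A \<Longrightarrow> xs[i := x] \<in> tuples A n"
  by (auto simp: tuples_def dest: subsetD[OF set_update_subset_insert])

lemma tuples_nth: "xs \<in> tuples A n \<Longrightarrow> i < length xs \<Longrightarrow> xs ! i \<in> carrier A"
  by (auto simp: tuples_def)

lemma relations_facts:
  assumes "r \<in> tensor_relations A E n" shows "\<Phi> r = 0" "Poly_Mapping.keys r \<subseteq> tuples A n"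
proof -
  have d: "Poly_Mapping.keys (x - y) \<subseteq> S" if "Poly_Mapping.keys x \<subseteq> S" "Poly_Mapping.keys y \<subseteq> S"
    for x y :: "'a list \<Rightarrow>\<^sub>0 'k" and S
    using free_vs.subspace_diff[OF subspace_keys, of x S y] that by simp
  have s: "Poly_Mapping.keys (fscale a x) \<subseteq> S" if "Poly_Mapping.keys x \<subseteq> S" for x :: "'a list \<Rightarrow>\<^sub>0 'k" and S a
    using free_vs.subspace_scale[OF subspace_keys, of x S a] that by simp
  consider (add) xs i x y where "r = \<delta> (xs[i := x \<oplus>\<^bsub>A\<^esub> y]) - \<delta> (xs[i := x]) - \<delta> (xs[i := y])"
      "xs \<in> tuples A n" "i < length xs" "x \<in> carrier A" "y \<in> carrier A"
    | (smult) xs i a x where "r = \<delta> (xs[i := a \<odot>\<^bsub>A\<^esub> x]) - fscale a (\<delta> (xs[i := x]))"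
      "xs \<in> tuples A n" "i < length xs" "x \<in> carrier A"
    | (bal) xs i e where "r = \<delta> (xs[i := (xs ! i) \<otimes>\<^bsub>A\<^esub> e]) - \<delta> (xs[(i + 1) mod length xs := e \<otimes>\<^bsub>A\<^esub> (xs ! ((i + 1) mod length xs))])"
      "xs \<in> tuples A n" "i < length xs" "e \<in> E"
    using assms unfolding tensor_relations_def by blast
  then have "\<Phi> r = 0 \<and> Poly_Mapping.keys r \<subseteq> tuples A n"
  proof cases
    case add
    then have "expand r = 0" by (simp add: M_update_add)
    then have "\<Phi> r = 0" by (simp add: \<Phi>_def)
    moreover have "Poly_Mapping.keys r \<subseteq> tuples A n"
      unfolding add(1) by (intro d) (use tuples_update[OF add(2)] add add_closed in auto)
    ultimately show ?thesis ..
  next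
    case smult
    then have "expand r = 0" by (simp add: M_update_smult)
    then have "\<Phi> r = 0" by (simp add: \<Phi>_def)
    moreover have "Poly_Mapping.keys r \<subseteq> tuples A n"
      unfolding smult(1) by (intro d s) (use tuples_update[OF smult(2)] smult smult_closed in auto)
    ultimately show ?thesis ..
  next
    case bal
    let ?j = "(i + 1) mod length xs"
    have "0 < length xs" using bal(3) by linarith
    then have j: "?j < length xs" by (rule mod_less_divisor)
    have xs: "set xs \<subseteq> carrier A" using bal(2) by (simp add: tuples_def)
    have in_A: "xs ! i \<in> carrier A" "xs ! ?j \<in> carrier A" "e \<in> carrier A"
      using tuples_nth[OF bal(2)] bal(3,4) j E_eq by auto
    have "Poly_Mapping.keys (M xs) \<subseteq> goods (length xs)" using keys_M[OF xs] by (simp add: goods_def)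
    then have "R (M (xs[i := (xs ! i) \<otimes>\<^bsub>A\<^esub> e])) = R (M (xs[?j := e \<otimes>\<^bsub>A\<^esub> (xs ! ?j)]))"
      unfolding M_update_weight[OF bal(3) c_mult_E(1)[OF in_A(1) bal(4)]]
        M_update_weight[OF j c_mult_E(2)[OF in_A(2) bal(4)]]
      using R_weight[of "M xs" "length xs" i "\<lambda>v. Poly_Mapping.lookup (c e) (v, [], v)"] bal(3) by simp
    then have "\<Phi> r = 0" unfolding bal(1) \<Phi>_def by simp
    moreover have "Poly_Mapping.keys r \<subseteq> tuples A n"
      unfolding bal(1) by (intro d) (use tuples_update[OF bal(2)] mult_closed in_A in auto)
    ultimately show ?thesis ..
  qed
  then show "\<Phi> r = 0" "Poly_Mapping.keys r \<subseteq> tuples A n" by auto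
qed

section \<open>The tensor relations as the kernel of the expansion\<close>

abbreviation T :: "int \<Rightarrow> ('a list \<Rightarrow>\<^sub>0 'k) set" where "T n \<equiv> tensor_kernel A E n"

abbreviation F :: "int \<Rightarrow> ('a list \<Rightarrow>\<^sub>0 'k) set" where "F n \<equiv> {f. Poly_Mapping.keys f \<subseteq> tuples A n}"

lemma subspace_T: "free_vs.subspace (T n)"
  unfolding tensor_kernel_def by (rule free_vs.subspace_span)

lemma T_F: "T n \<subseteq> F n"
  unfolding tensor_kernel_def by (rule free_vs.span_minimal[OF _ subspace_keys]) (use relations_facts(2) in blast)

lemma \<Phi>_T: "f \<in> T n \<Longrightarrow> \<Phi> f = 0"
proof -
  have "free_vs.subspace {f. \<Phi> f = 0}"
    by (rule free_vs.subspaceI) (auto simp: \<Phi>_simps)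
  then have "T n \<subseteq> {f. \<Phi> f = 0}"
    unfolding tensor_kernel_def by (rule free_vs.span_minimal[rotated]) (use relations_facts in auto)
  then show "f \<in> T n \<Longrightarrow> \<Phi> f = 0" by blast
qed

lemma T_add:
  assumes "us @ x # xs \<in> tuples A n" "x \<in> carrier A" "y \<in> carrier A"
  shows "\<delta> (us @ (x \<oplus>\<^bsub>A\<^esub> y) # xs) - \<delta> (us @ x # xs) - \<delta> (us @ y # xs) \<in> T n"
proof -
  let ?zs = "us @ x # xs" and ?i = "length us"
  have "\<delta> (?zs[?i := x \<oplus>\<^bsub>A\<^esub> y]) - \<delta> (?zs[?i := x]) - \<delta> (?zs[?i := y]) \<in> tensor_relations A E n"
    unfolding tensor_relations_def using assms by (intro UnI1 CollectI exI[of _ ?zs] exI[of _ ?i] exI[of _ x] exI[of _ y]) auto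
  then show ?thesis unfolding tensor_kernel_def list_update_length by (rule free_vs.span_base)
qed

lemma T_smult:
  assumes "us @ x # xs \<in> tuples A n" "x \<in> carrier A"
  shows "\<delta> (us @ (a \<odot>\<^bsub>A\<^esub> x) # xs) - fscale a (\<delta> (us @ x # xs)) \<in> T n"
proof -
  let ?zs = "us @ x # xs" and ?i = "length us"
  have "\<delta> (?zs[?i := a \<odot>\<^bsub>A\<^esub> x]) - fscale a (\<delta> (?zs[?i := x])) \<in> tensor_relations A E n"
    unfolding tensor_relations_def using assms by (intro UnI1 UnI2 CollectI exI[of _ ?zs] exI[of _ ?i] exI[of _ a] exI[of _ x]) auto
  then show ?thesis unfolding tensor_kernel_def list_update_length by (rule free_vs.span_base)
qed

lemma tuples_mid: "us @ x # xs \<in> tuples A n \<Longrightarrow> y \<in> carrier A \<Longrightarrow> us @ y # xs \<in> tuples A n"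
  by (auto simp: tuples_def)

lemma T_zero_entry:
  assumes "us @ x # xs \<in> tuples A n" "x \<in> carrier A" "c x = 0" shows "\<delta> (us @ x # xs) \<in> T n"
proof -
  have "0 \<odot>\<^bsub>A\<^esub> x = x" using assms smult_closed c_smult by (intro c_inj) auto
  then show ?thesis using T_smult[OF assms(1,2), of 0] by simp
qed

lemma T_expand:
  assumes xs: "us @ x # xs \<in> tuples A n" and x: "x \<in> carrier A"
  shows "\<delta> (us @ x # xs) - lin_ext (\<lambda>p. \<delta> (us @ \<beta> p # xs)) (c x) \<in> T n"
proof -
  \<comment> \<open>The induction runs over coordinate vectors, each realised by some element
    \<open>y\<close> of the algebra; injectivity of \<open>c\<close> then leads back to
    \<open>x\<close>.\<close>
  have "\<exists>y\<in>carrier A. c y = f \<and> \<delta> (us @ y # xs) - lin_ext (\<lambda>p. \<delta> (us @ \<beta> p # xs)) f \<in> T n"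
    if "Poly_Mapping.keys f \<subseteq> {p. good p}" for f
    using that
  proof (induction rule: span_of_deltas_induct)
    case zero
    have "0 \<odot>\<^bsub>A\<^esub> x \<in> carrier A" "c (0 \<odot>\<^bsub>A\<^esub> x) = 0" using smult_closed c_smult x by auto
    then show ?case using T_zero_entry[OF tuples_mid[OF xs]] by force
  next
    case (step p a f)
    then obtain y where y: "y \<in> carrier A" "c y = f" "\<delta> (us @ y # xs) - lin_ext (\<lambda>p. \<delta> (us @ \<beta> p # xs)) f \<in> T n" by blast
    have p: "\<beta> p \<in> carrier A" "c (\<beta> p) = \<delta> p" using \<beta>_closed c_\<beta> step by auto
    have ap: "a \<odot>\<^bsub>A\<^esub> \<beta> p \<in> carrier A" using smult_closed p by simp
    let ?y = "(a \<odot>\<^bsub>A\<^esub> \<beta> p) \<oplus>\<^bsub>A\<^esub> y"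
    have "(\<delta> (us @ ?y # xs) - \<delta> (us @ (a \<odot>\<^bsub>A\<^esub> \<beta> p) # xs) - \<delta> (us @ y # xs))
        + (\<delta> (us @ (a \<odot>\<^bsub>A\<^esub> \<beta> p) # xs) - fscale a (\<delta> (us @ \<beta> p # xs)))
        + (\<delta> (us @ y # xs) - lin_ext (\<lambda>p. \<delta> (us @ \<beta> p # xs)) f) \<in> T n"
      by (intro free_vs.subspace_add[OF subspace_T] y(3) T_add T_smult tuples_mid[OF xs] ap p y(1))
    moreover have "?y \<in> carrier A" "c ?y = fscale a (\<delta> p) + f"
      using add_closed[OF ap y(1)] c_add[OF ap y(1)] c_smult[OF p(1)] p y by auto
    ultimately show ?case by (intro bexI[of _ ?y]) (auto simp: algebra_simps)
  qed
  from this[OF c_good[OF x]] obtain y where "y \<in> carrier A" "c y = c x"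
      "\<delta> (us @ y # xs) - lin_ext (\<lambda>p. \<delta> (us @ \<beta> p # xs)) (c x) \<in> T n" by blast
  then show ?thesis using c_inj x by metis
qed

definition \<Psi> :: "(('v, 'e) path list \<Rightarrow>\<^sub>0 'k) \<Rightarrow> ('a list \<Rightarrow>\<^sub>0 'k)" where
  "\<Psi> = lin_ext (\<lambda>l. \<delta> (map \<beta> l))"

lemma lin_\<Psi>: "lin \<Psi>" unfolding \<Psi>_def by (rule lin_lin_ext)

text \<open>The prefix \<open>us\<close> collects the entries that have already been replaced by
  basis elements.\<close>

lemma T_expand_all:
  "us @ xs \<in> tuples A n \<Longrightarrow> \<delta> (us @ xs) - lin_ext (\<lambda>l. \<delta> (us @ map \<beta> l)) (M xs) \<in> T n"
proof (induction xs arbitrary: us)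
  case Nil
  then show ?case using free_vs.subspace_0[OF subspace_T] by simp
next
  case (Cons x xs)
  have x: "x \<in> carrier A" using Cons.prems by (auto simp: tuples_def)
  have 1: "\<delta> (us @ x # xs) - lin_ext (\<lambda>p. \<delta> (us @ \<beta> p # xs)) (c x) \<in> T n" by (rule T_expand[OF Cons.prems x])
  have 2: "lin_ext (\<lambda>p. \<delta> (us @ \<beta> p # xs)) (c x)
      - lin_ext (\<lambda>p. lin_ext (\<lambda>l. \<delta> (us @ \<beta> p # map \<beta> l)) (M xs)) (c x) \<in> T n"
  proof (rule lin_ext_cong_mod[OF subspace_T])
    fix p assume "p \<in> Poly_Mapping.keys (c x)"
    then have "\<beta> p \<in> carrier A" using c_good[OF x] \<beta>_closed by blast
    then have "(us @ [\<beta> p]) @ xs \<in> tuples A n" using tuples_mid[OF Cons.prems] by simp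
    from Cons.IH[OF this] show "\<delta> (us @ \<beta> p # xs) - lin_ext (\<lambda>l. \<delta> (us @ \<beta> p # map \<beta> l)) (M xs) \<in> T n" by simp
  qed
  have 3: "lin_ext (\<lambda>l. \<delta> (us @ map \<beta> l)) (M (x # xs)) = lin_ext (\<lambda>p. lin_ext (\<lambda>l. \<delta> (us @ \<beta> p # map \<beta> l)) (M xs)) (c x)"
    unfolding M.simps(2) lin_lin_ext_comp[OF lin_lin_ext] by (simp add: pre_def lin_lin_ext_comp[OF lin_lin_ext])
  show ?case unfolding 3 using free_vs.subspace_add[OF subspace_T 1 2] by simp
qed

text \<open>At a seam that does not compose, let \<open>e\<close> be the vertex at the target of the
  left letter. Right multiplication by \<open>e\<close> fixes that letter and left multiplication
  annihilates the next one, so balancing puts the tensor into the relations.\<close>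

lemma T_noncell:
  assumes l: "\<forall>p\<in>set l. good p" "l \<noteq> []" "int (length l) = n + 1" "\<not> cell l" shows "\<delta> (map \<beta> l) \<in> T n"
proof -
  obtain i where i: "i < length l" "tgt (l ! i) \<noteq> src (l ! (Suc i mod length l))"
    using cell_if_adjacent[OF l(2,1)] l(4) by blast
  let ?j = "(i + 1) mod length l" and ?xs = "map \<beta> l" and ?v = "tgt (l ! i)"
  have "0 < length l" using i(1) by linarith
  then have j: "?j < length l" by (rule mod_less_divisor)
  have g: "good (l ! i)" "good (l ! ?j)" using l(1) i j by auto
  then have "awalk (src (l ! i)) (arrs (l ! i)) ?v" by (auto simp: good_def paths_def split_beta)
  then have v: "?v \<in> verts Q" by (rule awalk_last_in_verts)
  have gv: "good (?v, [], ?v)" using v by (auto simp: good_def paths_def awalk_Nil_iff)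
  define e where "e = \<beta> (?v, [], ?v)"
  have e: "e \<in> carrier A" "c e = \<delta> (?v, [], ?v)" using \<beta>_closed[OF gv] c_\<beta>[OF gv] by (auto simp: e_def)
  have eE: "e \<in> E" unfolding E_eq using e v by auto
  have xs: "?xs \<in> tuples A n" using l \<beta>_closed by (auto simp: tuples_def)
  have bi: "\<beta> (l ! i) \<in> carrier A" "\<beta> (l ! ?j) \<in> carrier A" using \<beta>_closed g by auto
  have "\<beta> (l ! i) \<otimes>\<^bsub>A\<^esub> e = \<beta> (l ! i)"
    using c_mult_E(1)[OF bi(1) eE] c_\<beta>[OF g(1)] e(2) mult_closed[OF bi(1) e(1)] by (intro c_inj bi) auto
  then have u1: "?xs[i := (?xs ! i) \<otimes>\<^bsub>A\<^esub> e] = ?xs" using i(1) by (metis length_map list_update_id nth_map)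
  have z: "e \<otimes>\<^bsub>A\<^esub> (?xs ! ?j) \<in> carrier A" "c (e \<otimes>\<^bsub>A\<^esub> (?xs ! ?j)) = 0"
    using c_mult_E(2)[OF bi(2) eE] c_\<beta>[OF g(2)] e mult_closed[OF e(1) bi(2)] j i(2)
    by (auto simp: lookup_single when_def)
  have "?xs[?j := e \<otimes>\<^bsub>A\<^esub> (?xs ! ?j)] = take ?j ?xs @ (e \<otimes>\<^bsub>A\<^esub> (?xs ! ?j)) # drop (Suc ?j) ?xs"
    using j by (simp add: upd_conv_take_nth_drop)
  moreover have "?xs[?j := e \<otimes>\<^bsub>A\<^esub> (?xs ! ?j)] \<in> tuples A n" by (rule tuples_update[OF xs z(1)])
  ultimately have "\<delta> (?xs[?j := e \<otimes>\<^bsub>A\<^esub> (?xs ! ?j)]) \<in> T n" using T_zero_entry z by metis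
  moreover have "\<delta> (?xs[i := (?xs ! i) \<otimes>\<^bsub>A\<^esub> e]) - \<delta> (?xs[?j := e \<otimes>\<^bsub>A\<^esub> (?xs ! ?j)]) \<in> T n"
    unfolding tensor_kernel_def
    by (rule free_vs.span_base, unfold tensor_relations_def,
        intro UnI2 CollectI exI[of _ ?xs] exI[of _ i] exI[of _ ?j] exI[of _ e]) (use xs i eE in auto)
  ultimately have "\<delta> (?xs[i := (?xs ! i) \<otimes>\<^bsub>A\<^esub> e]) \<in> T n"
    using free_vs.subspace_add[OF subspace_T] by fastforce
  then show ?thesis unfolding u1 .
qed

text \<open>Modulo the relations every entry may be expanded in the basis, and the words that are no
  cells vanish.\<close>

lemma \<Psi>_\<Phi>: assumes f: "f \<in> F n" shows "f - \<Psi> (\<Phi> f) \<in> T n"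
proof -
  have lin: "lin (\<lambda>f. f - \<Psi> (\<Phi> f))" by (intro lin_intros lin_comp[OF lin_\<Psi>])
  have d: "\<delta> xs - \<Psi> (\<Phi> (\<delta> xs)) \<in> T n" if xs: "xs \<in> tuples A n" for xs
  proof -
    have "\<delta> xs - \<Psi> (M xs) \<in> T n" using T_expand_all[of "[]" xs n] xs by (simp add: \<Psi>_def)
    moreover have "\<Psi> (M xs) - \<Psi> (R (M xs)) \<in> T n"
    proof -
      have "set xs \<subseteq> carrier A" "int (length xs) = n + 1" "xs \<noteq> []" using xs by (auto simp: tuples_def)
      then have k: "Poly_Mapping.keys (M xs) \<subseteq> {l. int (length l) = n + 1 \<and> l \<noteq> [] \<and> (\<forall>p\<in>set l. good p)}"
        using keys_M[of xs] by auto
      have "\<Psi> (R g) = lin_ext (\<lambda>l. if cell l then \<delta> (map \<beta> l) else 0) g" for g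
        unfolding \<Psi>_def R_def lin_lin_ext_comp[OF lin_lin_ext] by (rule lin_ext_cong) simp
      then show ?thesis unfolding \<Psi>_def
        using k T_noncell free_vs.subspace_0[OF subspace_T] by (simp, intro lin_ext_cong_mod[OF subspace_T]) auto
    qed
    ultimately show ?thesis unfolding \<Phi>_def using free_vs.subspace_add[OF subspace_T] by fastforce
  qed
  have "Poly_Mapping.keys f \<subseteq> tuples A n" using f by simp
  then show ?thesis
  proof (induction rule: span_of_deltas_induct)
    case zero
    then show ?case using free_vs.subspace_0[OF subspace_T] by (simp add: \<Phi>_simps lin_zero[OF lin_\<Psi>])
  next
    case (step xs a f)
    then show ?case
      using free_vs.subspace_add[OF subspace_T free_vs.subspace_scale[OF subspace_T d]]
      by (simp only: lin_add[OF lin] lin_scale[OF lin])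
  qed
qed

lemma \<Phi>_\<Psi>: "f \<in> K n \<Longrightarrow> \<Phi> (\<Psi> f) = f"
proof (rule lin_eqI[of "\<lambda>f. \<Phi> (\<Psi> f)" "\<lambda>f. f" "{l. cell l}"])
  fix l assume l: "l \<in> {l. cell l}"
  have "M (map \<beta> l') = \<delta> l'" if "\<forall>p\<in>set l'. good p" for l' using that by (induction l') (simp_all add: c_\<beta>)
  then have "M (map \<beta> l) = \<delta> l" using l by (simp add: cell_def)
  then show "\<Phi> (\<Psi> (\<delta> l)) = \<delta> l" using l by (simp add: \<Phi>_def \<Psi>_def R_delta)
qed (auto intro!: lin_intros lin_comp[OF lin_\<Phi>] lin_\<Psi> simp: K_def)

lemma \<Psi>_F: "f \<in> K n \<Longrightarrow> \<Psi> f \<in> F n"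
  unfolding K_def mem_Collect_eq
  by (erule keys_lin_subset[OF lin_\<Psi>, rotated]) (use \<beta>_closed in \<open>auto simp: \<Psi>_def tuples_def cell_def\<close>)

lemma \<Phi>_K: assumes "f \<in> F n" shows "\<Phi> f \<in> K n"
proof (cases "0 \<le> n")
  case True
  then have "Poly_Mapping.keys f \<subseteq> tup (nat (n + 1))" using assms by (simp add: tuples_tup)
  from TT_goods[OF this] have "Poly_Mapping.keys (expand f) \<subseteq> goods (nat (n + 1))" .
  then show ?thesis unfolding K_def \<Phi>_def mem_Collect_eq
    by (rule keys_lin_subset[OF lin_R, rotated]) (use True in \<open>auto simp: R_delta goods_def\<close>)
next
  case False
  then have "f = 0" using assms by (simp add: tuples_tup)
  then show ?thesis using free_vs.subspace_0[OF subspace_K] by (simp add: \<Phi>_simps)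
qed

lemma T_iff: "f \<in> F n \<Longrightarrow> f \<in> T n \<longleftrightarrow> \<Phi> f = 0"
  using \<Phi>_T \<Psi>_\<Phi>[of f n] lin_zero[OF lin_\<Psi>] by auto

lemma free_b_F: "f \<in> F n \<Longrightarrow> free_b A f \<in> F (n - 1)"
  unfolding free_b_eq mem_Collect_eq
proof (erule AA.hb_closed[rotated])
  fix xs assume "xs \<in> tuples A n"
  then show "AA.faces xs \<subseteq> tuples A (n - 1)"
    using mult_closed by (auto simp: AA.faces_def tuples_def pmA_def)
qed

lemma free_B_F: assumes "f \<in> F n" shows "free_B A f \<in> F (n + 1)"
proof (cases "0 \<le> n")
  case True
  then have f: "Poly_Mapping.keys f \<subseteq> tup (nat (n + 1))" using assms by (simp add: tuples_tup)
  have lin_fs: "lin (free_s A :: ('a list \<Rightarrow>\<^sub>0 'k) \<Rightarrow> _)" unfolding free_s_def by (rule lin_lin_ext)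
  have N: "Poly_Mapping.keys (free_N f) \<subseteq> tup (nat (n + 1))" by (rule N_closed[OF tup_rr f]) (use True in auto)
  have s: "Poly_Mapping.keys (free_s A (free_N f)) \<subseteq> tup (Suc (nat (n + 1)))"
    by (rule keys_lin_subset[OF lin_fs _ N]) (use one_closed in \<open>auto simp: free_s_def tup_def\<close>)
  have "Poly_Mapping.keys (free_B A f) \<subseteq> tup (Suc (nat (n + 1)))"
    unfolding free_B_def Let_def
    using free_vs.subspace_diff[OF subspace_keys, of "free_s A (free_N f)" _ "free_t (free_s A (free_N f))"]
      s t_closed[OF tup_rr s] by auto
  moreover have "Suc (nat (n + 1)) = nat (n + 1 + 1)" using True by simp
  ultimately show ?thesis using True by (simp add: tuples_tup)
next
  case False
  then have "f = 0" using assms by (simp add: tuples_tup)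
  moreover have "free_s A 0 = (0 :: 'a list \<Rightarrow>\<^sub>0 'k)" unfolding free_s_def by simp
  ultimately show ?thesis by (simp add: free_B_def)
qed

lemma lin_free_b: "lin (free_b A)" unfolding free_b_def by (rule lin_lin_ext)

lemma lin_free_B: "lin (free_B A :: ('a list \<Rightarrow>\<^sub>0 'k) \<Rightarrow> _)"
proof -
  have "lin (free_s A :: ('a list \<Rightarrow>\<^sub>0 'k) \<Rightarrow> _)" unfolding free_s_def by (rule lin_lin_ext)
  from lin_comp[OF this] show ?thesis unfolding free_B_def[abs_def] Let_def by (auto intro!: lin_intros)
qed

lemma \<Phi>_b': "f \<in> F n \<Longrightarrow> \<Phi> (free_b A f) = hb (\<Phi> f)"
  and \<Phi>_B': "f \<in> F n \<Longrightarrow> \<Phi> (free_B A f) = BK (\<Phi> f)"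
proof -
  assume f: "f \<in> F n"
  have "\<Phi> (free_b A f) = hb (\<Phi> f) \<and> \<Phi> (free_B A f) = BK (\<Phi> f)"
  proof (cases "0 \<le> n")
    case True
    then show ?thesis using f \<Phi>_b[of f "nat (n + 1)"] \<Phi>_B[of f "nat (n + 1)"] by (simp add: tuples_tup)
  next
    case False
    then have "f = 0" using f by (simp add: tuples_tup)
    then show ?thesis by (simp add: lin_zero[OF lin_free_b] lin_zero[OF lin_free_B] \<Phi>_simps)
  qed
  then show "\<Phi> (free_b A f) = hb (\<Phi> f)" "\<Phi> (free_B A f) = BK (\<Phi> f)" by auto
qed

definition chain :: "int \<Rightarrow> (('v, 'e) path list \<Rightarrow>\<^sub>0 'k) \<Rightarrow> ('a list \<Rightarrow>\<^sub>0 'k) set" where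
  "chain n y = T n +>\<^bsub>free_space (tuples A n)\<^esub> \<Psi> y"

text \<open>Both \<open>u (\<Psi> y)\<close> and \<open>\<Psi> (w y)\<close> have the image
  \<open>w y\<close> under \<open>\<Phi>\<close>, whose kernel in degree \<open>n'\<close> is
  \<open>T n'\<close>; hence they represent the same chain.\<close>

lemma induced_chain:
  assumes u: "lin u" "\<And>f. f \<in> F n \<Longrightarrow> u f \<in> F n'" "\<And>f. f \<in> F n \<Longrightarrow> \<Phi> (u f) = w (\<Phi> f)"
    and w: "lin w" "\<And>f. f \<in> K n \<Longrightarrow> w f \<in> K n'" and y: "y \<in> K n"
  shows "induced_map (free_space (tuples A n')) (tensor_kernel A E n') u (chain n y) = chain n' (w y)"
proof -
  have zero: "{0} \<subseteq> T n" for n using free_vs.subspace_0[OF subspace_T] by simp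
  have uT: "u ` T n \<subseteq> T n'"
  proof (rule image_subsetI)
    fix f assume f: "f \<in> T n"
    have "f \<in> F n" using T_F f by blast
    show "u f \<in> T n'"
      unfolding T_iff[OF u(2)[OF \<open>f \<in> F n\<close>]] u(3)[OF \<open>f \<in> F n\<close>] \<Phi>_T[OF f] by (rule lin_zero[OF w(1)])
  qed
  have "induced_map (free_space (tuples A n')) ((\<lambda>x. x) ` T n') u ((\<lambda>x. x) ` T n +>\<^bsub>free_space (tuples A n)\<^esub> \<Psi> y)
      = (\<lambda>x. x) ` T n' +>\<^bsub>free_space (tuples A n')\<^esub> u (\<Psi> y)"
    by (rule induced_map_presented[OF presents_free_space subspace_T zero T_F presents_free_space subspace_T zero T_F u(1)])
      (use u(2) uT \<Psi>_F[OF y] in auto)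
  moreover have "(\<lambda>x. x) ` T n' +>\<^bsub>free_space (tuples A n')\<^esub> u (\<Psi> y) = (\<lambda>x. x) ` T n' +>\<^bsub>free_space (tuples A n')\<^esub> \<Psi> (w y)"
  proof (subst presents_coset_eq_iff[OF presents_free_space subspace_T zero T_F])
    show F: "u (\<Psi> y) \<in> F n'" "\<Psi> (w y) \<in> F n'" using u(2) w(2) \<Psi>_F y by blast+
    have "u (\<Psi> y) - \<Psi> (w y) \<in> F n'" using free_vs.subspace_diff[OF subspace_keys F] .
    moreover have "\<Phi> (u (\<Psi> y) - \<Psi> (w y)) = 0" using u(3)[OF \<Psi>_F[OF y]] \<Phi>_\<Psi>[OF y] \<Phi>_\<Psi>[OF w(2)[OF y]] by (simp add: \<Phi>_simps)
    ultimately show "u (\<Psi> y) - \<Psi> (w y) \<in> T n'" using T_iff by blast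
  qed
  ultimately show ?thesis by (simp add: chain_def)
qed

lemma presented: "presented_mixed_complex fscale K hb BK A E chain"
proof -
  have "presents fscale (hochschild_chains A E n) (K n) {0} (chain n)" for n
  proof -
    have zero: "{0} \<subseteq> T n" using free_vs.subspace_0[OF subspace_T] by simp
    have "presents fscale (hochschild_chains A E n) (F n) (T n) (\<lambda>x. T n +>\<^bsub>free_space (tuples A n)\<^esub> x)"
      unfolding hochschild_chains_def
      by (rule presents_quot[OF presents_free_space subspace_T zero T_F]) simp
    then have "presents fscale (hochschild_chains A E n) (K n) {0} (\<lambda>y. T n +>\<^bsub>free_space (tuples A n)\<^esub> \<Psi> y)"
    proof (rule presents_compose[OF _ lin_\<Psi> _ subspace_K])
      show "\<Psi> ` K n \<subseteq> F n" using \<Psi>_F by blast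
      show "y = 0" if "y \<in> K n" "\<Psi> y \<in> T n" for y using \<Phi>_T[OF that(2)] \<Phi>_\<Psi>[OF that(1)] by simp
      show "\<exists>y\<in>K n. x - \<Psi> y \<in> T n" if "x \<in> F n" for x using \<Psi>_\<Phi>[OF that] \<Phi>_K[OF that] by blast
    qed
    then show ?thesis by (simp add: chain_def[abs_def])
  qed
  moreover have "hochschild_b A E n (chain n x) = chain (n - 1) (hb x)" if "x \<in> K n" for x n
    unfolding hochschild_b_def
    by (rule induced_chain[OF lin_free_b _ _ lin_hb hb_K that]) (use free_b_F \<Phi>_b' in auto)
  moreover have "chain_B A E n (chain n x) = chain (n + 1) (BK x)" if "x \<in> K n" for x n
    unfolding chain_B_def
    by (rule induced_chain[OF lin_free_B _ _ lin_BK BK_K that]) (use free_B_F \<Phi>_B' in auto)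
  ultimately show ?thesis
    using lifting_mixed by (simp add: presented_mixed_complex_def presented_mixed_complex_axioms_def)
qed

end

section \<open>The path algebra and its monomial quotient\<close>

lemma path_mult_assoc:
  "lin_ext (\<lambda>u. path_mult u z) (path_mult x y) = lin_ext (path_mult x) (path_mult y z)"
  by (cases x; cases y; cases z) (auto simp: path_mult_def)

lemma path_algebra_simps [simp]:
  "carrier (path_algebra Q) = {f. Poly_Mapping.keys f \<subseteq> paths Q}"
  "f \<otimes>\<^bsub>path_algebra Q\<^esub> g = lin_ext (\<lambda>x. lin_ext (path_mult x) g) f"
  "\<one>\<^bsub>path_algebra Q\<^esub> = (\<Sum>v\<in>verts Q. \<delta> (v, [], v))"
  "\<zero>\<^bsub>path_algebra Q\<^esub> = 0"
  "f \<oplus>\<^bsub>path_algebra Q\<^esub> g = f + g"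
  "r \<odot>\<^bsub>path_algebra Q\<^esub> f = fscale r f"
  by (simp_all add: path_algebra_def)

context fin_digraph
begin

lemma path_mult_paths:
  assumes "x \<in> paths G" "y \<in> paths G" shows "Poly_Mapping.keys (path_mult x y :: _ \<Rightarrow>\<^sub>0 'k::field) \<subseteq> paths G"
proof -
  obtain u es v u' es' v' where "x = (u, es, v)" "y = (u', es', v')" by (cases x; cases y) auto
  then show ?thesis using assms awalk_appendI[of u es v es' v'] by (auto simp: paths_def path_mult_def)
qed

lemma path_algebra_mult_closed:
  assumes "Poly_Mapping.keys f \<subseteq> X" "Poly_Mapping.keys g \<subseteq> Y"
    and "\<And>x y. x \<in> X \<Longrightarrow> y \<in> Y \<Longrightarrow> Poly_Mapping.keys (path_mult x y :: _ \<Rightarrow>\<^sub>0 'k::field) \<subseteq> Z"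
  shows "Poly_Mapping.keys (lin_ext (\<lambda>x. lin_ext (path_mult x) g) f :: _ \<Rightarrow>\<^sub>0 'k) \<subseteq> Z"
proof (rule keys_lin_subset[OF lin_lin_ext _ assms(1)])
  fix x assume "x \<in> X"
  then show "Poly_Mapping.keys (lin_ext (\<lambda>x. lin_ext (path_mult x) g) (\<delta> x) :: _ \<Rightarrow>\<^sub>0 'k) \<subseteq> Z"
    unfolding lin_ext_delta by (intro keys_lin_subset[OF lin_lin_ext _ assms(2)]) (use assms(3) in auto)
qed

lemma vertex_paths: "v \<in> verts G \<Longrightarrow> (v, [], v) \<in> paths G"
  by (simp add: paths_def awalk_Nil_iff)

lemma ring_path_algebra: "ring (path_algebra G :: ('k::field, _) module)"
proof (rule ringI)
  have neg: "- x \<in> {f. Poly_Mapping.keys f \<subseteq> paths G}" if "Poly_Mapping.keys x \<subseteq> paths G" for x :: "_ \<Rightarrow>\<^sub>0 'k"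
    using free_vs.subspace_neg[OF subspace_keys, of x] that by simp
  show "abelian_group (path_algebra G :: ('k, _) module)"
  proof (rule abelian_groupI)
    fix x assume "x \<in> carrier (path_algebra G :: ('k, _) module)"
    then show "\<exists>y\<in>carrier (path_algebra G). y \<oplus>\<^bsub>path_algebra G\<^esub> x = \<zero>\<^bsub>path_algebra G\<^esub>"
      using neg[of x] by (intro bexI[of _ "- x"]) auto
  next
    fix x y assume "x \<in> carrier (path_algebra G :: ('k, _) module)" "y \<in> carrier (path_algebra G :: ('k, _) module)"
    then show "x \<oplus>\<^bsub>path_algebra G\<^esub> y \<in> carrier (path_algebra G)"
      using free_vs.subspace_add[OF subspace_keys, of x "paths G" y] by simp
  qed (simp_all add: add_ac)
  show "monoid (path_algebra G :: ('k, _) module)"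
  proof (rule monoidI)
    fix x y assume "x \<in> carrier (path_algebra G :: ('k, _) module)" "y \<in> carrier (path_algebra G :: ('k, _) module)"
    then show "x \<otimes>\<^bsub>path_algebra G\<^esub> y \<in> carrier (path_algebra G)"
      unfolding path_algebra_simps mem_Collect_eq by (rule path_algebra_mult_closed) (rule path_mult_paths)
  next
    show "\<one>\<^bsub>path_algebra G\<^esub> \<in> carrier (path_algebra G :: ('k, _) module)"
      unfolding path_algebra_simps by (rule free_vs.subspace_sum[OF subspace_keys]) (use vertex_paths in auto)
  next
    fix f g h :: "('a, 'b) path \<Rightarrow>\<^sub>0 'k"
    have "lin_ext (\<lambda>u. lin_ext (path_mult u) h) (path_mult x y) = lin_ext (path_mult x) (lin_ext (path_mult y) h)" for x y
      by (subst lin_ext_swap) (simp add: path_mult_assoc lin_lin_ext_comp[OF lin_lin_ext])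
    then show "(f \<otimes>\<^bsub>path_algebra G\<^esub> g) \<otimes>\<^bsub>path_algebra G\<^esub> h = f \<otimes>\<^bsub>path_algebra G\<^esub> (g \<otimes>\<^bsub>path_algebra G\<^esub> h)"
      by (simp add: lin_lin_ext_comp[OF lin_lin_ext])
  next
    fix f :: "('a, 'b) path \<Rightarrow>\<^sub>0 'k" assume f: "f \<in> carrier (path_algebra G)"
    have vs: "src p \<in> verts G" "tgt p \<in> verts G" if "p \<in> paths G" for p
      using that by (auto simp: paths_def split_beta awalk_hd_in_verts awalk_last_in_verts)
    have "lin (\<lambda>f :: ('a, 'b) path \<Rightarrow>\<^sub>0 'k. \<Sum>v\<in>verts G. lin_ext (path_mult (v, [], v)) f)" by (intro lin_intros)
    then have "(\<Sum>v\<in>verts G. lin_ext (path_mult (v, [], v)) f) = f"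
    proof (rule lin_eqI[OF _ lin_ident])
      fix p :: "('a, 'b) path" assume p: "p \<in> paths G"
      have "path_mult (v, [], v) p = (if v = src p then \<delta> p else (0 :: _ \<Rightarrow>\<^sub>0 'k))" for v
        by (cases p) (auto simp: path_mult_def)
      then show "(\<Sum>v\<in>verts G. lin_ext (path_mult (v, [], v)) (\<delta> p)) = (\<delta> p :: _ \<Rightarrow>\<^sub>0 'k)" using vs[OF p] by simp
    qed (use f in simp)
    then show "\<one>\<^bsub>path_algebra G\<^esub> \<otimes>\<^bsub>path_algebra G\<^esub> f = f" by simp
    have "lin_ext (\<lambda>x. \<Sum>v\<in>verts G. path_mult x (v, [], v)) f = f"
    proof (rule lin_eqI[OF lin_lin_ext lin_ident])
      fix p :: "('a, 'b) path" assume p: "p \<in> paths G"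
      have "path_mult p (v, [], v) = (if v = tgt p then \<delta> p else (0 :: _ \<Rightarrow>\<^sub>0 'k))" for v
        by (cases p) (auto simp: path_mult_def)
      then show "lin_ext (\<lambda>x. \<Sum>v\<in>verts G. path_mult x (v, [], v)) (\<delta> p) = (\<delta> p :: _ \<Rightarrow>\<^sub>0 'k)" using vs[OF p] by simp
    qed (use f in simp)
    then show "f \<otimes>\<^bsub>path_algebra G\<^esub> \<one>\<^bsub>path_algebra G\<^esub> = f" by simp
  qed
qed (simp_all add: lin_ext_add_fun)

end

locale quadratic_monomial = fin_digraph Q for Q :: "('v, 'e) pre_digraph" +
  fixes Rel :: "('v, 'e) path set" and rel :: "'e \<Rightarrow> 'e \<Rightarrow> bool" and field_type :: "'k::field itself"
  assumes Rel: "Rel \<subseteq> {x \<in> paths Q. path_length x = 2}"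
    and rel_def: "rel e f \<longleftrightarrow> (\<exists>u v. (u, [e, f], v) \<in> Rel)"
begin

sublocale qq: quadratic_quiver Q rel field_type by unfold_locales

abbreviation PA :: "('k, ('v, 'e) path \<Rightarrow>\<^sub>0 'k) module" where "PA \<equiv> path_algebra Q"

definition J :: "(('v, 'e) path \<Rightarrow>\<^sub>0 'k) set" where
  "J = {f. Poly_Mapping.keys f \<subseteq> {p \<in> paths Q. \<not> qq.good p}}"

lemma subspace_J: "free_vs.subspace J" unfolding J_def by (rule subspace_keys)

lemma J_PA: "J \<subseteq> carrier PA" by (auto simp: J_def)

lemma good_composite:
  assumes "p \<in> paths Q" "q \<in> paths Q" "tgt p = src q"
  shows "qq.good (src p, arrs p @ arrs q, tgt q) \<longleftrightarrow> qq.good p \<and> qq.good q \<and> \<not> qq.forbids p q"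
proof -
  have "(src p, arrs p @ arrs q, tgt q) \<in> paths Q"
    using assms awalk_appendI by (auto simp: paths_def split_beta)
  then show ?thesis using assms by (auto simp: qq.good_def successively_append_iff qq.forbids_def)
qed

lemma path_mult_eq: "path_mult p q = (if tgt p = src q then \<delta> (src p, arrs p @ arrs q, tgt q) else 0)"
  by (simp add: path_mult_def split_beta)

lemma ideal_J: "ideal J PA"
proof (rule idealI[OF ring_path_algebra])
  have bad: "Poly_Mapping.keys (path_mult x y :: _ \<Rightarrow>\<^sub>0 'k) \<subseteq> {p \<in> paths Q. \<not> qq.good p}"
    if "x \<in> paths Q" "y \<in> paths Q" "\<not> qq.good x \<or> \<not> qq.good y" for x y
    using path_mult_paths[OF that(1,2), where 'k = 'k] good_composite[OF that(1,2)] that(3)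
    by (auto simp: path_mult_eq)
  show "subgroup J (add_monoid PA)"
  proof
    show "J \<subseteq> carrier (add_monoid PA)" using J_PA by simp
    show "\<one>\<^bsub>add_monoid PA\<^esub> \<in> J" using free_vs.subspace_0[OF subspace_J] by simp
    show "x \<otimes>\<^bsub>add_monoid PA\<^esub> y \<in> J" if "x \<in> J" "y \<in> J" for x y
      using free_vs.subspace_add[OF subspace_J that] by simp
    fix x assume x: "x \<in> J"
    have "- x \<in> J" using free_vs.subspace_neg[OF subspace_J x] .
    moreover have "inv\<^bsub>add_monoid PA\<^esub> x = - x"
    proof (rule group.inv_equality)
      show "group (add_monoid PA)"
        using ring_path_algebra ring.is_abelian_group abelian_group.a_group by blast
    qed (use x calculation J_PA in auto)
    ultimately show "inv\<^bsub>add_monoid PA\<^esub> x \<in> J" by simp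
  qed
  fix a x assume a: "a \<in> J" "x \<in> carrier PA"
  then have k: "Poly_Mapping.keys a \<subseteq> {p \<in> paths Q. \<not> qq.good p}" "Poly_Mapping.keys x \<subseteq> paths Q" by (auto simp: J_def)
  show "x \<otimes>\<^bsub>PA\<^esub> a \<in> J"
    unfolding J_def path_algebra_simps mem_Collect_eq by (rule path_algebra_mult_closed[OF k(2,1)]) (use bad in auto)
  show "a \<otimes>\<^bsub>PA\<^esub> x \<in> J"
    unfolding J_def path_algebra_simps mem_Collect_eq by (rule path_algebra_mult_closed[OF k]) (use bad in auto)
qed

lemma rel_in_J: "x \<in> Rel \<Longrightarrow> \<delta> x \<in> J"
proof -
  assume x: "x \<in> Rel"
  then have "x \<in> paths Q" "length (arrs x) = 2" using Rel by (auto simp: path_length_def split_beta)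
  moreover obtain e f where "arrs x = [e, f]" using calculation(2) by (auto simp: numeral_2_eq_2 length_Suc_conv)
  moreover have "rel e f" unfolding rel_def using x calculation(3) by (metis prod.collapse)
  ultimately show "\<delta> x \<in> J" by (simp add: J_def qq.good_def)
qed

lemma not_successively: "\<not> successively P xs \<Longrightarrow> \<exists>ys e f zs. xs = ys @ [e, f] @ zs \<and> \<not> P e f"
proof (induction xs rule: induct_list012)
  case (3 x y zs)
  show ?case
  proof (cases "P x y")
    case True
    then obtain ys e f ws where "y # zs = ys @ [e, f] @ ws" "\<not> P e f" using 3 by auto
    then have "x # y # zs = (x # ys) @ [e, f] @ ws" by simp
    then show ?thesis using \<open>\<not> P e f\<close> by metis
  next
    case False
    then show ?thesis by (metis append_Nil append_Cons)
  qed
qed auto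

text \<open>A path with a forbidden pair factors as a path, a relation and a path, so it lies in the
  ideal; for the other inclusion, \<open>J\<close> is itself an ideal containing the
  relations.\<close>

lemma genideal_eq: "Idl\<^bsub>PA\<^esub> (\<delta> ` Rel) = J"
proof
  show "Idl\<^bsub>PA\<^esub> (\<delta> ` Rel) \<subseteq> J"
    by (rule ring.genideal_minimal[OF ring_path_algebra ideal_J]) (use rel_in_J in auto)
  have Rc: "\<delta> ` Rel \<subseteq> carrier PA" using Rel by auto
  interpret I: ideal "Idl\<^bsub>PA\<^esub> (\<delta> ` Rel)" PA by (rule ring.genideal_ideal[OF ring_path_algebra Rc])
  have gen: "\<delta> x \<in> Idl\<^bsub>PA\<^esub> (\<delta> ` Rel)" if "x \<in> Rel" for x
    using ring.genideal_self[OF ring_path_algebra Rc] that by blast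
  have bad: "\<delta> p \<in> Idl\<^bsub>PA\<^esub> (\<delta> ` Rel)" if p: "p \<in> paths Q" "\<not> qq.good p" for p
  proof -
    obtain ys e f zs where a: "arrs p = ys @ [e, f] @ zs" "rel e f"
      using not_successively[of "\<lambda>e f. \<not> rel e f" "arrs p"] p by (auto simp: qq.good_def)
    obtain u v where uv: "(u, [e, f], v) \<in> Rel" using a(2) rel_def by blast
    then have "awalk u [e, f] v" using Rel by (auto simp: paths_def)
    \<comment> \<open>\<open>rel\<close> records a relation without its endpoints; its arrows
      determine them.\<close>
    then have "u = tail Q e" "v = head Q f" by (auto simp: awalk_Cons_iff awalk_Nil_iff)
    moreover have "awalk (src p) (ys @ [e, f] @ zs) (tgt p)" using p(1) a(1) by (auto simp: paths_def split_beta)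
    ultimately have w: "(src p, ys, u) \<in> paths Q" "(v, zs, tgt p) \<in> paths Q"
      by (auto simp: paths_def awalk_append_iff awalk_Cons_iff)
    have "\<delta> (u, [e, f] @ zs, tgt p) = \<delta> (u, [e, f], v) \<otimes>\<^bsub>PA\<^esub> \<delta> (v, zs, tgt p)"
      by (simp add: path_mult_def)
    also have "\<dots> \<in> Idl\<^bsub>PA\<^esub> (\<delta> ` Rel)" by (rule I.I_r_closed[OF gen[OF uv]]) (use w in simp)
    finally have "\<delta> (src p, ys, u) \<otimes>\<^bsub>PA\<^esub> \<delta> (u, [e, f] @ zs, tgt p) \<in> Idl\<^bsub>PA\<^esub> (\<delta> ` Rel)"
      by (rule I.I_l_closed) (use w in simp)
    moreover have "\<delta> (src p, ys, u) \<otimes>\<^bsub>PA\<^esub> \<delta> (u, [e, f] @ zs, tgt p) = (\<delta> p :: _ \<Rightarrow>\<^sub>0 'k)"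
      using a(1) by (cases p) (simp add: path_mult_def)
    ultimately show ?thesis by simp
  qed
  show "J \<subseteq> Idl\<^bsub>PA\<^esub> (\<delta> ` Rel)"
  proof
    fix f assume "f \<in> J"
    then have "Poly_Mapping.keys f \<subseteq> {p \<in> paths Q. \<not> qq.good p}" by (simp add: J_def)
    then show "f \<in> Idl\<^bsub>PA\<^esub> (\<delta> ` Rel)"
    proof (induction rule: span_of_deltas_induct)
      case zero
      then show ?case using additive_subgroup.zero_closed[OF I.additive_subgroup_axioms] by simp
    next
      case (step p a f)
      have sp: "src p \<in> verts Q" using step(1) by (auto simp: paths_def split_beta awalk_hd_in_verts)
      \<comment> \<open>A ring ideal is closed under ring multiplication only, so the scalar enters
        as a multiple of the trivial path at the source.\<close>
      have "fscale a (\<delta> (src p, [], src p)) \<in> carrier PA"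
        using free_vs.subspace_scale[OF subspace_keys, of "\<delta> (src p, [], src p)" "paths Q" a] vertex_paths[OF sp] by simp
      then have "fscale a (\<delta> (src p, [], src p)) \<otimes>\<^bsub>PA\<^esub> \<delta> p \<in> Idl\<^bsub>PA\<^esub> (\<delta> ` Rel)"
        using I.I_l_closed bad step(1) by blast
      moreover have "fscale a (\<delta> (src p, [], src p)) \<otimes>\<^bsub>PA\<^esub> \<delta> p = fscale a (\<delta> p :: _ \<Rightarrow>\<^sub>0 'k)"
        by (cases p) (simp add: path_mult_def)
      ultimately have "fscale a (\<delta> p) \<in> Idl\<^bsub>PA\<^esub> (\<delta> ` Rel)" by (simp only:)
      then show ?case using additive_subgroup.a_closed[OF I.additive_subgroup_axioms _ step(2)] by simp
    qed
  qed
qed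

section \<open>Normal forms in the quotient algebra\<close>

definition nf :: "(('v, 'e) path \<Rightarrow>\<^sub>0 'k) \<Rightarrow> (('v, 'e) path \<Rightarrow>\<^sub>0 'k)" where
  "nf = lin_ext (\<lambda>p. if qq.good p then \<delta> p else 0)"

lemma lin_nf: "lin nf" unfolding nf_def by (rule lin_lin_ext)
lemmas nf_simps = lin_simps[OF lin_nf]

lemma keys_nf: "Poly_Mapping.keys (nf f) \<subseteq> {p. qq.good p} \<inter> Poly_Mapping.keys f"
  by (rule keys_lin_subset[OF lin_nf _ order_refl]) (auto simp: nf_def)

lemma nf_good: "Poly_Mapping.keys f \<subseteq> {p. qq.good p} \<Longrightarrow> nf f = f"
  by (rule lin_eqI[OF lin_nf lin_ident]) (auto simp: nf_def)

lemma nf_J: "f \<in> J \<Longrightarrow> nf f = 0"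
  by (rule lin_eqI[OF lin_nf lin_const0, of "{p \<in> paths Q. \<not> qq.good p}"]) (auto simp: nf_def J_def)

lemma diff_nf_J: assumes "f \<in> carrier PA" shows "f - nf f \<in> J"
proof -
  have "lin (\<lambda>f. f - nf f)" by (intro lin_intros lin_nf)
  then show ?thesis
    unfolding J_def mem_Collect_eq by (rule keys_lin_subset[of _ "paths Q"]) (use assms in \<open>auto simp: nf_def\<close>)
qed

lemma nf_mult:
  assumes f: "f \<in> carrier PA" and g: "g \<in> carrier PA"
  shows "nf (f \<otimes>\<^bsub>PA\<^esub> g) = lin_ext (\<lambda>p. lin_ext (\<lambda>q. case qq.pmult p q of None \<Rightarrow> 0 | Some u \<Rightarrow> \<delta> u) (nf g)) (nf f)"
proof -
  let ?m = "\<lambda>p q. case qq.pmult p q of None \<Rightarrow> 0 | Some u \<Rightarrow> \<delta> u"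
  have "nf (path_mult p q) = (if qq.good p then if qq.good q then ?m p q else 0 else 0)"
    if "p \<in> paths Q" "q \<in> paths Q" for p q
    using good_composite[OF that] by (auto simp: path_mult_eq nf_def qq.pmult_def)
  then have "lin_ext (\<lambda>p. lin_ext (\<lambda>q. nf (path_mult p q)) g) f
      = lin_ext (\<lambda>p. lin_ext (\<lambda>q. if qq.good p then if qq.good q then ?m p q else 0 else 0) g) f"
    using f g by (intro lin_ext_cong) (auto simp: subset_iff)
  also have "\<dots> = lin_ext (\<lambda>p. if qq.good p then lin_ext (\<lambda>q. if qq.good q then ?m p q else 0) g else 0) f"
    by (rule lin_ext_cong) (simp add: lin_ext_zero_fun)
  also have "\<dots> = lin_ext (\<lambda>p. lin_ext (?m p) (nf g)) (nf f)"
    unfolding nf_def lin_lin_ext_comp[OF lin_lin_ext] by (intro lin_ext_cong) (auto intro!: lin_ext_cong)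
  finally show ?thesis by (simp add: lin_lin_ext_comp[OF lin_nf])
qed

abbreviation AQ :: "('k, (('v, 'e) path \<Rightarrow>\<^sub>0 'k) set) module" where "AQ \<equiv> quot_space PA J"

text \<open>Any representative gives the same value, as \<open>nf\<close> vanishes on
  \<open>J\<close>. This is the coordinate map of the quotient in the basis of paths without a
  forbidden pair.\<close>

definition cf :: "(('v, 'e) path \<Rightarrow>\<^sub>0 'k) set \<Rightarrow> (('v, 'e) path \<Rightarrow>\<^sub>0 'k)" where "cf X = nf (SOME f. f \<in> X)"

lemma presents_PA: "presents fscale PA {f. Poly_Mapping.keys f \<subseteq> paths Q} {0} (\<lambda>x. x)"
  unfolding presents_def using free_vs.vector_space_axioms subspace_keys[of "paths Q"] by auto

lemma presents_A: "presents fscale AQ {f. Poly_Mapping.keys f \<subseteq> paths Q} J (\<lambda>f. J +>\<^bsub>PA\<^esub> f)"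
  by (rule presents_quot[OF presents_PA subspace_J]) (use free_vs.subspace_0[OF subspace_J] J_PA in auto)

lemma cf_coset: assumes "f \<in> carrier PA" shows "cf (J +>\<^bsub>PA\<^esub> f) = nf f"
  unfolding cf_def
proof (rule someI2)
  show "0 + f \<in> J +>\<^bsub>PA\<^esub> f" using free_vs.subspace_0[OF subspace_J] by (auto simp: a_r_coset_def')
  show "nf g = nf f" if "g \<in> J +>\<^bsub>PA\<^esub> f" for g
    using that nf_J by (auto simp: a_r_coset_def' nf_simps)
qed

lemma coset_eq_iff: "f \<in> carrier PA \<Longrightarrow> g \<in> carrier PA \<Longrightarrow> J +>\<^bsub>PA\<^esub> f = J +>\<^bsub>PA\<^esub> g \<longleftrightarrow> nf f = nf g"
proof
  assume f: "f \<in> carrier PA" and g: "g \<in> carrier PA"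
  show "J +>\<^bsub>PA\<^esub> f = J +>\<^bsub>PA\<^esub> g \<Longrightarrow> nf f = nf g" using cf_coset[OF f] cf_coset[OF g] by simp
  assume "nf f = nf g"
  then have "f - g = (f - nf f) - (g - nf g)" by simp
  also have "\<dots> \<in> J" using free_vs.subspace_diff[OF subspace_J diff_nf_J[OF f] diff_nf_J[OF g]] .
  finally show "J +>\<^bsub>PA\<^esub> f = J +>\<^bsub>PA\<^esub> g" using presents_eq_iff[OF presents_A, of f g] f g by simp
qed

lemma A_carrier: "x \<in> carrier AQ \<longleftrightarrow> (\<exists>f\<in>carrier PA. x = J +>\<^bsub>PA\<^esub> f)"
  unfolding presents_carrier[OF presents_A, symmetric] by auto

lemma coset_in_A: "f \<in> carrier PA \<Longrightarrow> J +>\<^bsub>PA\<^esub> f \<in> carrier AQ"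
  using A_carrier by blast

lemma A_mult: "f \<in> carrier PA \<Longrightarrow> g \<in> carrier PA \<Longrightarrow> (J +>\<^bsub>PA\<^esub> f) \<otimes>\<^bsub>AQ\<^esub> (J +>\<^bsub>PA\<^esub> g) = J +>\<^bsub>PA\<^esub> (f \<otimes>\<^bsub>PA\<^esub> g)"
  using ideal.rcoset_mult_add[OF ideal_J, of f g] by (simp add: quot_space_def ring.defs module.defs FactRing_def)

lemma good_vertex_path: "v \<in> verts Q \<Longrightarrow> qq.good (v, [], v)"
  using vertex_paths by (simp add: qq.good_def)

lemma path_basis: "path_basis Q rel AQ (vertex_subalgebra Q J) cf (\<lambda>p. J +>\<^bsub>PA\<^esub> \<delta> p)"
proof (unfold_locales, goal_cases)
  case 1 show ?case by (rule finite_verts)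
next
  case (2 x y)
  then obtain f g where fg: "f \<in> carrier PA" "g \<in> carrier PA" "x = J +>\<^bsub>PA\<^esub> f" "y = J +>\<^bsub>PA\<^esub> g" using A_carrier by metis
  have "f + g \<in> carrier PA" using fg free_vs.subspace_add[OF subspace_keys, of f _ g] by simp
  then show ?case using fg coset_in_A[of "f + g"] by (simp add: presents_add[OF presents_A, symmetric])
next
  case (3 x y)
  then obtain f g where fg: "f \<in> carrier PA" "g \<in> carrier PA" "x = J +>\<^bsub>PA\<^esub> f" "y = J +>\<^bsub>PA\<^esub> g" using A_carrier by metis
  have "f + g \<in> carrier PA" using fg free_vs.subspace_add[OF subspace_keys, of f _ g] by simp
  then show ?case using fg cf_coset[of "f + g"] cf_coset[of f] cf_coset[of g]
    by (simp add: presents_add[OF presents_A, symmetric] nf_simps)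
next
  case (4 x r)
  then obtain f where f: "f \<in> carrier PA" "x = J +>\<^bsub>PA\<^esub> f" using A_carrier by metis
  have "fscale r f \<in> carrier PA" using f free_vs.subspace_scale[OF subspace_keys, of f] by simp
  then show ?case using f coset_in_A[of "fscale r f"] by (simp add: presents_scale[OF presents_A, symmetric])
next
  case (5 x r)
  then obtain f where f: "f \<in> carrier PA" "x = J +>\<^bsub>PA\<^esub> f" using A_carrier by metis
  have "fscale r f \<in> carrier PA" using f free_vs.subspace_scale[OF subspace_keys, of f] by simp
  then show ?case using f cf_coset[of "fscale r f"] cf_coset[of f]
    by (simp add: presents_scale[OF presents_A, symmetric] nf_simps)
next
  case (6 x y)
  then obtain f g where fg: "f \<in> carrier PA" "g \<in> carrier PA" "x = J +>\<^bsub>PA\<^esub> f" "y = J +>\<^bsub>PA\<^esub> g" using A_carrier by metis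
  have "f \<otimes>\<^bsub>PA\<^esub> g \<in> carrier PA" by (rule monoid.m_closed[OF ring.is_monoid[OF ring_path_algebra] fg(1,2)])
  then show ?case unfolding fg(3,4) A_mult[OF fg(1,2)] by (rule coset_in_A)
next
  case (7 x y)
  then obtain f g where fg: "f \<in> carrier PA" "g \<in> carrier PA" "x = J +>\<^bsub>PA\<^esub> f" "y = J +>\<^bsub>PA\<^esub> g" using A_carrier by metis
  have "f \<otimes>\<^bsub>PA\<^esub> g \<in> carrier PA" by (rule monoid.m_closed[OF ring.is_monoid[OF ring_path_algebra] fg(1,2)])
  then show ?case unfolding fg(3,4) A_mult[OF fg(1,2)] cf_coset[OF fg(1)] cf_coset[OF fg(2)]
    using cf_coset nf_mult[OF fg(1,2)] by metis
next
  case 8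
  have "\<one>\<^bsub>AQ\<^esub> = J +>\<^bsub>PA\<^esub> \<one>\<^bsub>PA\<^esub>" by (simp add: quot_space_def ring.defs module.defs FactRing_def)
  then show ?case using coset_in_A monoid.one_closed[OF ring.is_monoid[OF ring_path_algebra]] by metis
next
  case 9
  have "\<one>\<^bsub>AQ\<^esub> = J +>\<^bsub>PA\<^esub> \<one>\<^bsub>PA\<^esub>" by (simp add: quot_space_def ring.defs module.defs FactRing_def)
  then have "cf \<one>\<^bsub>AQ\<^esub> = nf \<one>\<^bsub>PA\<^esub>" using cf_coset monoid.one_closed[OF ring.is_monoid[OF ring_path_algebra]] by metis
  also have "\<dots> = (\<Sum>v\<in>verts Q. nf (\<delta> (v, [], v)))" by (simp add: nf_simps)
  also have "\<dots> = (\<Sum>v\<in>verts Q. \<delta> (v, [], v))" by (rule sum.cong) (use good_vertex_path in \<open>auto simp: nf_def\<close>)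
  finally show ?case .
next
  case (10 x)
  then obtain f where "f \<in> carrier PA" "x = J +>\<^bsub>PA\<^esub> f" using A_carrier by metis
  then show ?case using keys_nf[of f] cf_coset by simp
next
  case (11 x y)
  then obtain f g where "f \<in> carrier PA" "g \<in> carrier PA" "x = J +>\<^bsub>PA\<^esub> f" "y = J +>\<^bsub>PA\<^esub> g" using A_carrier by metis
  then show ?case using 11(3) cf_coset coset_eq_iff by metis
next
  case (12 p)
  then show ?case by (intro coset_in_A) (simp add: qq.good_def)
next
  case (13 p)
  then have "\<delta> p \<in> carrier PA" by (simp add: qq.good_def)
  then show ?case using cf_coset 13 by (simp add: nf_def)
next
  case 14
  let ?V = "{(v, [], v) |v. v \<in> verts Q}"
  have V: "?V \<subseteq> paths Q" "?V \<subseteq> {p. qq.good p}" using vertex_paths good_vertex_path by auto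
  show ?case
  proof (intro equalityI subsetI)
    fix x assume "x \<in> vertex_subalgebra Q J"
    then obtain f where f: "Poly_Mapping.keys f \<subseteq> ?V" "x = J +>\<^bsub>PA\<^esub> f" by (auto simp: vertex_subalgebra_def)
    then have "f \<in> carrier PA" "nf f = f" using V nf_good[of f] by auto
    then show "x \<in> {x \<in> carrier AQ. Poly_Mapping.keys (cf x) \<subseteq> ?V}" using f cf_coset coset_in_A by auto
  next
    fix x assume x: "x \<in> {x \<in> carrier AQ. Poly_Mapping.keys (cf x) \<subseteq> ?V}"
    then obtain f where f: "f \<in> carrier PA" "x = J +>\<^bsub>PA\<^esub> f" using A_carrier by blast
    then have k: "Poly_Mapping.keys (nf f) \<subseteq> ?V" using x cf_coset by simp
    then have "nf f \<in> carrier PA" "nf (nf f) = nf f" using V nf_good[of "nf f"] by auto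
    then have "x = J +>\<^bsub>PA\<^esub> nf f" using f coset_eq_iff by metis
    then show "x \<in> vertex_subalgebra Q J" using k by (auto simp: vertex_subalgebra_def)
  qed
qed

end

theorem theorem4p14:
  fixes Q :: "('v, 'e) pre_digraph"
    and I :: "(('v, 'e) path \<Rightarrow>\<^sub>0 'k::field) set"
    and A :: "('k, (('v, 'e) path \<Rightarrow>\<^sub>0 'k) set) module"
    and E :: "(('v, 'e) path \<Rightarrow>\<^sub>0 'k) set set"
  assumes "fin_digraph Q"
    and "quadratic_monomial_presentation Q I"
    and "A = quot_space (path_algebra Q) I"
    and "E = vertex_subalgebra Q I"
  shows "(\<forall>r\<ge>2. \<forall>p q. \<forall>X\<in>carrier (connes_page A E r p q).
            connes_diff A E r p q X = \<zero>\<^bsub>connes_page A E r (p - r) (q + r - 1)\<^esub>)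
       \<and> (\<forall>m\<ge>0. HC A E m \<cong>\<^sub>v
            direct_sum2 (cokernel (HH A E (m - 1)) (HH A E m) (HH_B A E (m - 1)))
                        (direct_sum {1..} (\<lambda>i::int. HdR A E (m - 2 * i))))"
proof -
  obtain Rel where R: "Rel \<subseteq> {x \<in> paths Q. path_length x = 2}"
      "I = Idl\<^bsub>path_algebra Q\<^esub> ((\<lambda>x. Poly_Mapping.single x 1) ` Rel)"
    using assms(2) by (auto simp: quadratic_monomial_presentation_def)
  define rel where rel_eq: "rel e f \<longleftrightarrow> (\<exists>u v. (u, [e, f], v) \<in> Rel)" for e f
  interpret fin_digraph Q by fact
  interpret quadratic_monomial Q Rel rel "TYPE('k)"
    by unfold_locales (use R(1) in \<open>auto simp: rel_eq\<close>)
  have I: "I = J" unfolding R(2) by (rule genideal_eq)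
  interpret path_basis Q rel "TYPE('k)" A E cf "\<lambda>p. J +>\<^bsub>path_algebra Q\<^esub> \<delta> p"
    unfolding assms(3,4) I by (rule path_basis)
  interpret presented_mixed_complex fscale qq.K qq.hb qq.BK A E chain by (rule presented)
  show ?thesis using connes_degeneration HC_decomposition by blast
qed

end
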